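(* Let $G=(V,m,E,a)$ be a weighted directed graph with a collection of directed clusters with total (finite) edge set $\tilde E\subseteq E$. For $\beta>0$ let $L^+_\beta=L^+_{E\setminus\tilde E}+\beta L^+_{\tilde E}$ on $\ell^2(G)$, and let $\underline L^+$ be the out-degree Laplacian of the reduced graph $\underline G^+$. Then for every $z\in\mathbb C\setminus\{0\}$ in the resolvent set of $\underline L^+$ there exist $C,\beta_0>0$ such that for all $\beta\ge\beta_0$ the point $z$ is in the resolvent set of $L^+_\beta$ and $$\big\|(L^+_\beta-z)^{-1}-J^+_\uparrow(\underline L^+-z)^{-1}J^+_\downarrow\big\|\le\frac C\beta .$$ In particular the left-hand side tends to $0$ as $\beta\to\infty$.
   Context: Graphs: $G=(V,m,E,a)$ has an at most countably infinite vertex set $V$, node masses $m:V\to(0,\infty)$, a locally finite edge set $E\subseteq V\times V$, and weights $a:V\times V\to[0,\infty)$ with $a(v,w)>0$ iff $(v,w)\in E$. The edge $(i,j)$ originates at $j$ and terminates at $i$. Transposes: $E^\intercal=\{(i,j):(j,i)\in E\}$, $a^\intercal(i,j)=a(j,i)$. $\ell^2(G)=\{f:V\to\mathbb C:\sum_v|f(v)|^2m(v)<\infty\}$, $\langle f,g\rangle_{\ell^2(G)}=\sum_x\overline{f(x)}g(x)m(x)$. $\chi_S$ is the indicator function of $S\subseteq V$. With $d^-(v)=\sum_ia(v,i)$ and $d^+(v)=\sum_ja(j,v)$, the in- and out-degree Laplacians are $[L^\pm f](x)=\frac1{m(x)}\big(d^\pm(x)f(x)-\sum_ya(x,y)f(y)\big)$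 ($-$: in-degree, $+$: out-degree). Standing assumption: there is $K>0$ with $d^\pm(v)\le K\,m(v)$ for all $v\in V$. For $F\subseteq E$, $L^\pm_F$ is the Laplacian of $(V,m,F,a\chi_F)$. Reaches of a directed graph: the reachable set of a node $i$ is the set of all nodes $j$ (including $i$) for which there is a directed path starting at $i$ and ending at $j$. A reach is a maximal reachable set. The exclusive part $H(R)$ of a reach $R$ is the set of vertices of $R$ lying in no other reach; the common part is $C(R)=R\setminus H(R)$. Collection of directed clusters: a finite family of finite edge sets $\tilde E_i\subseteq E$ with union $\tilde E$, such that each $\tilde E_i$ determines a single reach of $(V,\tilde E)$. (Any finite $\tilde E\subseteq E$ decomposes in this way; reaches may share nodes.) Kernel vectors: let $R^\intercal$ be a reach of $(V,\tilde E^\intercal)$ (a vertex not incident to $\tilde E$ forms a singleton reach). $\overleftarrow\gamma^+_{R^\intercal}$ is the unique element of the kernel of the in-degree Laplacian of $(V,m,\tilde E^\intercal,a^\intercal\chi_{\tilde E^\intercal})$ that equals $1$ on $H(R^\intercal)$ and vanishes outside $R^\intercal$ (its values on $C(R^\intercal)$ lie in $(0,1)$). The weight vector is $\omega_{R^\intercal}(i)=\sum_\tau\prod_{(x,y)\in\tau}a^\intercal(x,y)$, summed over all directed spanning trees $\tau\subseteq\tilde E^\intercal$ of $R^\intercal$ rooted at $i$ (all edges directed away from the root; an empty product is $1$), and $\omega_{R^\intercal}(i)=0$ if there are none. Set $\vec\gamma^+_{R^\intercal}=\omega_{R^\intercal}/\sum_j\omega_{R^\intercal}(j)m(j)$. $P^+$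 is the Riesz projection of $L^+_{\tilde E}$ at $0$: $P^+=\frac1{2\pi i}\oint_{|\zeta|=\epsilon}(\zeta-L^+_{\tilde E})^{-1}d\zeta$, with $\epsilon>0$ so small that $0$ is the only point of $\sigma(L^+_{\tilde E})$ in the closed disc of radius $\epsilon$. Reduced graph $\underline G^+=(\underline V^+,\underline m^+,\underline E^+,\underline a^+)$: $\underline V^+$ is the set of reaches of $(V,\tilde E^\intercal)$; $\underline m^+(S^\intercal)=\langle\chi_{S^\intercal},P^+\chi_{S^\intercal}\rangle_{\ell^2(G)}$; $\underline a^+(R^\intercal,S^\intercal)=\Big(\sum_{r\in R^\intercal,\,s\in S^\intercal}\overleftarrow\gamma^+_{R^\intercal}(r)\,a(r,s)\,\vec\gamma^+_{S^\intercal}(s)\Big)\underline m^+(S^\intercal)$; $\underline E^+$ is the support of $\underline a^+$. $\underline L^+$ is its out-degree Laplacian on $\ell^2(\underline G^+)$. $J^+_\downarrow:\ell^2(G)\to\ell^2(\underline G^+)$, $[J^+_\downarrow f](R^\intercal)=\langle\overleftarrow\gamma^+_{R^\intercal},f\rangle_{\ell^2(G)}/\underline m^+(R^\intercal)$; $J^+_\uparrow:\ell^2(\underline G^+)\to\ell^2(G)$, $J^+_\uparrow\underline f=\sum_{R^\intercal}\underline m^+(R^\intercal)\underline f(R^\intercal)\vec\gamma^+_{R^\intercal}$. *)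

theory Defs
  imports "HOL-Complex_Analysis.Complex_Analysis"
begin

section \<open>Weighted directed graphs\<close>

text \<open>
  The edge \<open>(i, j)\<close> originates at \<open>j\<close> and terminates at \<open>i\<close>. Only the values of
  \<open>mass\<close> on \<open>verts\<close> and of \<open>weight\<close> on \<open>verts \<times> verts\<close> are meaningful.
\<close>

record 'v wgraph =
  verts :: "'v set"
  mass :: "'v \<Rightarrow> real"
  edges :: "('v \<times> 'v) set"
  weight :: "'v \<Rightarrow> 'v \<Rightarrow> real"

definition in_deg :: "'v wgraph \<Rightarrow> 'v \<Rightarrow> real" where
  "in_deg G v = (\<Sum>\<^sub>\<infinity>i\<in>verts G. weight G v i)"

definition out_deg :: "'v wgraph \<Rightarrow> 'v \<Rightarrow> real" where
  "out_deg G v = (\<Sum>\<^sub>\<infinity>j\<in>verts G. weight G j v)"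

text \<open>The last conjunct is the standing assumption bounding the degrees by the node masses.\<close>

definition weighted_digraph :: "'v wgraph \<Rightarrow> bool" where
  "weighted_digraph G \<longleftrightarrow>
     countable (verts G) \<and>
     (\<forall>v\<in>verts G. mass G v > 0) \<and>
     edges G \<subseteq> verts G \<times> verts G \<and>
     (\<forall>v\<in>verts G. finite {w. (v, w) \<in> edges G} \<and> finite {w. (w, v) \<in> edges G}) \<and>
     (\<forall>v\<in>verts G. \<forall>w\<in>verts G. weight G v w \<ge> 0 \<and> (weight G v w > 0 \<longleftrightarrow> (v, w) \<in> edges G)) \<and>
     (\<exists>K>0. \<forall>v\<in>verts G. in_deg G v \<le> K * mass G v \<and> out_deg G v \<le> K * mass G v)"

definition transpose_graph :: "'v wgraph \<Rightarrow> 'v wgraph" where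
  "transpose_graph G = G\<lparr>edges := (edges G)\<inverse>, weight := (\<lambda>i j. weight G j i)\<rparr>"

definition restrict_graph :: "'v wgraph \<Rightarrow> ('v \<times> 'v) set \<Rightarrow> 'v wgraph" where
  "restrict_graph G F =
     G\<lparr>edges := F, weight := (\<lambda>i j. if (i, j) \<in> F then weight G i j else 0)\<rparr>"

section \<open>The space of square-summable functions and its operators\<close>

text \<open>
  Functions on \<open>verts G\<close> are represented by functions on the whole type that vanish
  outside \<open>verts G\<close>.
\<close>

definition ell2 :: "'v wgraph \<Rightarrow> ('v \<Rightarrow> complex) set" where
  "ell2 G = {f. (\<forall>x. x \<notin> verts G \<longrightarrow> f x = 0) \<and>
                (\<lambda>x. (cmod (f x))\<^sup>2 * mass G x) summable_on verts G}"

definition ell2_norm :: "'v wgraph \<Rightarrow> ('v \<Rightarrow> complex) \<Rightarrow> real" where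
  "ell2_norm G f = sqrt (\<Sum>\<^sub>\<infinity>x\<in>verts G. (cmod (f x))\<^sup>2 * mass G x)"

definition ell2_inner :: "'v wgraph \<Rightarrow> ('v \<Rightarrow> complex) \<Rightarrow> ('v \<Rightarrow> complex) \<Rightarrow> complex" where
  "ell2_inner G f g = (\<Sum>\<^sub>\<infinity>x\<in>verts G. cnj (f x) * g x * complex_of_real (mass G x))"

definition char_fun :: "'v set \<Rightarrow> 'v \<Rightarrow> complex" where
  "char_fun S x = (if x \<in> S then 1 else 0)"

text \<open>
  The operator norm is \<open>\<infinity>\<close> (the infimum of the empty set) for an operator that is
  unbounded or does not map \<open>ell2 G\<close> into \<open>ell2 H\<close>.
\<close>

definition op_norm ::
    "'v wgraph \<Rightarrow> 'w wgraph \<Rightarrow> (('v \<Rightarrow> complex) \<Rightarrow> ('w \<Rightarrow> complex)) \<Rightarrow> ennreal" where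
  "op_norm G H T =
     Inf {ennreal c | c. c \<ge> 0 \<and>
            (\<forall>f\<in>ell2 G. T f \<in> ell2 H \<and> ell2_norm H (T f) \<le> c * ell2_norm G f)}"

definition op_inverse ::
    "'v wgraph \<Rightarrow> (('v \<Rightarrow> complex) \<Rightarrow> ('v \<Rightarrow> complex)) \<Rightarrow> (('v \<Rightarrow> complex) \<Rightarrow> ('v \<Rightarrow> complex))" where
  "op_inverse G T = inv_into (ell2 G) T"

definition resolvent_set ::
    "'v wgraph \<Rightarrow> (('v \<Rightarrow> complex) \<Rightarrow> ('v \<Rightarrow> complex)) \<Rightarrow> complex set" where
  "resolvent_set G T =
     {z. bij_betw (\<lambda>f x. T f x - z * f x) (ell2 G) (ell2 G) \<and>
         op_norm G G (op_inverse G (\<lambda>f x. T f x - z * f x)) < \<infinity>}"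

definition resolvent ::
    "'v wgraph \<Rightarrow> (('v \<Rightarrow> complex) \<Rightarrow> ('v \<Rightarrow> complex)) \<Rightarrow> complex \<Rightarrow>
     (('v \<Rightarrow> complex) \<Rightarrow> ('v \<Rightarrow> complex))" where
  "resolvent G T z = op_inverse G (\<lambda>f x. T f x - z * f x)"

definition spectrum ::
    "'v wgraph \<Rightarrow> (('v \<Rightarrow> complex) \<Rightarrow> ('v \<Rightarrow> complex)) \<Rightarrow> complex set" where
  "spectrum G T = - resolvent_set G T"

text \<open>
  The operator-valued contour integral is evaluated pointwise: the integrand is continuous
  in operator norm on the circle, and \<open>T \<mapsto> T f x\<close> is a bounded linear functional of \<open>T\<close>,
  so it commutes with the integral. The admissible radius is arbitrary; the integral does not
  depend on it.
\<close>

definition riesz_radius :: "'v wgraph \<Rightarrow> (('v \<Rightarrow> complex) \<Rightarrow> ('v \<Rightarrow> complex)) \<Rightarrow> real" where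
  "riesz_radius G T = (SOME \<epsilon>. \<epsilon> > 0 \<and> spectrum G T \<inter> cball 0 \<epsilon> = {0})"

definition riesz_projection ::
    "'v wgraph \<Rightarrow> (('v \<Rightarrow> complex) \<Rightarrow> ('v \<Rightarrow> complex)) \<Rightarrow> (('v \<Rightarrow> complex) \<Rightarrow> ('v \<Rightarrow> complex))" where
  "riesz_projection G T f x =
     1 / (2 * of_real pi * \<i>) *
       contour_integral (circlepath 0 (riesz_radius G T))
         (\<lambda>\<zeta>. op_inverse G (\<lambda>g y. \<zeta> * g y - T g y) f x)"

section \<open>Laplacians\<close>

definition lap_in :: "'v wgraph \<Rightarrow> ('v \<Rightarrow> complex) \<Rightarrow> ('v \<Rightarrow> complex)" where
  "lap_in G f x =
     (if x \<in> verts G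
      then 1 / of_real (mass G x) *
             (of_real (in_deg G x) * f x - (\<Sum>\<^sub>\<infinity>y\<in>verts G. of_real (weight G x y) * f y))
      else 0)"

definition lap_out :: "'v wgraph \<Rightarrow> ('v \<Rightarrow> complex) \<Rightarrow> ('v \<Rightarrow> complex)" where
  "lap_out G f x =
     (if x \<in> verts G
      then 1 / of_real (mass G x) *
             (of_real (out_deg G x) * f x - (\<Sum>\<^sub>\<infinity>y\<in>verts G. of_real (weight G x y) * f y))
      else 0)"

definition lap_out_scaled ::
    "'v wgraph \<Rightarrow> ('v \<times> 'v) set \<Rightarrow> real \<Rightarrow> ('v \<Rightarrow> complex) \<Rightarrow> ('v \<Rightarrow> complex)" where
  "lap_out_scaled G Et \<beta> f x =
     lap_out (restrict_graph G (edges G - Et)) f x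
       + of_real \<beta> * lap_out (restrict_graph G Et) f x"

section \<open>Reaches and directed clusters\<close>

text \<open>
  Since \<open>(i, j)\<close> is an edge from \<open>j\<close> to \<open>i\<close>, directed paths follow the converse relation.
\<close>

definition reachable_set :: "'v set \<Rightarrow> ('v \<times> 'v) set \<Rightarrow> 'v \<Rightarrow> 'v set" where
  "reachable_set V E i = {j \<in> V. (i, j) \<in> (E\<inverse>)\<^sup>*}"

definition reaches :: "'v set \<Rightarrow> ('v \<times> 'v) set \<Rightarrow> 'v set set" where
  "reaches V E =
     {R. (\<exists>i\<in>V. R = reachable_set V E i) \<and>
         (\<forall>j\<in>V. R \<subseteq> reachable_set V E j \<longrightarrow> R = reachable_set V E j)}"

definition exclusive_part :: "'v set \<Rightarrow> ('v \<times> 'v) set \<Rightarrow> 'v set \<Rightarrow> 'v set" where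
  "exclusive_part V E R = {v \<in> R. \<forall>S\<in>reaches V E. v \<in> S \<longrightarrow> S = R}"

text \<open>
  An edge set \<open>F\<close> determines the reach consisting of the endpoints of its edges. Every finite
  \<open>Et \<subseteq> edges G\<close> is the union of such a family, namely of the nonempty sets
  \<open>Et \<inter> R \<times> R\<close> with \<open>R\<close> a reach of \<open>(verts G, Et)\<close>.
\<close>

definition directed_clusters :: "'v wgraph \<Rightarrow> ('v \<times> 'v) set set \<Rightarrow> bool" where
  "directed_clusters G \<F> \<longleftrightarrow>
     finite \<F> \<and>
     (\<forall>F\<in>\<F>. finite F \<and> F \<subseteq> edges G \<and> fst ` F \<union> snd ` F \<in> reaches (verts G) (\<Union>\<F>))"

section \<open>Kernel vectors\<close>

text \<open>
  Below, \<open>Et\<close> is the total edge set of the clusters and \<open>R\<close>, \<open>S\<close> are reaches of the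
  transposed graph \<open>(verts G, Et\<inverse>)\<close>.
\<close>

definition gamma_left ::
    "'v wgraph \<Rightarrow> ('v \<times> 'v) set \<Rightarrow> 'v set \<Rightarrow> 'v \<Rightarrow> complex" where
  "gamma_left G Et R =
     (THE f. f \<in> ell2 G \<and>
             lap_in (transpose_graph (restrict_graph G Et)) f = (\<lambda>x. 0) \<and>
             (\<forall>v\<in>exclusive_part (verts G) (Et\<inverse>) R. f v = 1) \<and>
             (\<forall>v. v \<notin> R \<longrightarrow> f v = 0))"

text \<open>
  Spanning trees of \<open>R\<close> with all edges directed away from the root \<open>i\<close>: no edge terminates
  at \<open>i\<close>, exactly one edge terminates at every other vertex of \<open>R\<close>, and every vertex of \<open>R\<close>
  is reached from \<open>i\<close>.
\<close>

definition spanning_out_trees ::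
    "('v \<times> 'v) set \<Rightarrow> 'v set \<Rightarrow> 'v \<Rightarrow> ('v \<times> 'v) set set" where
  "spanning_out_trees E R i =
     {\<tau>. \<tau> \<subseteq> E \<inter> R \<times> R \<and> i \<in> R \<and>
         (\<forall>x. (i, x) \<notin> \<tau>) \<and>
         (\<forall>v\<in>R - {i}. \<exists>!x. (v, x) \<in> \<tau>) \<and>
         (\<forall>v\<in>R. (i, v) \<in> (\<tau>\<inverse>)\<^sup>*)}"

definition tree_weight :: "'v wgraph \<Rightarrow> ('v \<times> 'v) set \<Rightarrow> 'v set \<Rightarrow> 'v \<Rightarrow> real" where
  "tree_weight G Et R i =
     (\<Sum>\<tau>\<in>spanning_out_trees (Et\<inverse>) R i. \<Prod>(x, y)\<in>\<tau>. weight (transpose_graph G) x y)"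

definition gamma_right :: "'v wgraph \<Rightarrow> ('v \<times> 'v) set \<Rightarrow> 'v set \<Rightarrow> 'v \<Rightarrow> real" where
  "gamma_right G Et R i = tree_weight G Et R i / (\<Sum>j\<in>R. tree_weight G Et R j * mass G j)"

section \<open>The reduced graph and the transfer operators\<close>

text \<open>
  The expressions under \<open>Re\<close> are real numbers; \<open>Re\<close> only performs the change of type.
\<close>

definition red_mass :: "'v wgraph \<Rightarrow> ('v \<times> 'v) set \<Rightarrow> 'v set \<Rightarrow> real" where
  "red_mass G Et S =
     Re (ell2_inner G (char_fun S)
           (riesz_projection G (lap_out (restrict_graph G Et)) (char_fun S)))"

definition red_weight :: "'v wgraph \<Rightarrow> ('v \<times> 'v) set \<Rightarrow> 'v set \<Rightarrow> 'v set \<Rightarrow> real" where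
  "red_weight G Et R S =
     Re (\<Sum>r\<in>R. \<Sum>s\<in>S. gamma_left G Et R r * of_real (weight G r s) * of_real (gamma_right G Et S s))
       * red_mass G Et S"

definition reduced_graph :: "'v wgraph \<Rightarrow> ('v \<times> 'v) set \<Rightarrow> 'v set wgraph" where
  "reduced_graph G Et =
     (let \<R> = reaches (verts G) (Et\<inverse>) in
      \<lparr>verts = \<R>,
       mass = red_mass G Et,
       edges = {(R, S). R \<in> \<R> \<and> S \<in> \<R> \<and> red_weight G Et R S \<noteq> 0},
       weight = red_weight G Et\<rparr>)"

definition J_down ::
    "'v wgraph \<Rightarrow> ('v \<times> 'v) set \<Rightarrow> ('v \<Rightarrow> complex) \<Rightarrow> ('v set \<Rightarrow> complex)" where
  "J_down G Et f R =
     (if R \<in> verts (reduced_graph G Et)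
      then ell2_inner G (gamma_left G Et R) f / of_real (mass (reduced_graph G Et) R)
      else 0)"

text \<open>At every vertex at most finitely many summands are nonzero.\<close>

definition J_up ::
    "'v wgraph \<Rightarrow> ('v \<times> 'v) set \<Rightarrow> ('v set \<Rightarrow> complex) \<Rightarrow> ('v \<Rightarrow> complex)" where
  "J_up G Et g x =
     (\<Sum>\<^sub>\<infinity>R\<in>verts (reduced_graph G Et).
        of_real (mass (reduced_graph G Et) R) * g R * of_real (gamma_right G Et R x))"

end

theory Submission
  imports Defs "Jordan_Normal_Form.Determinant"
begin

text \<open>
  Write \<open>L\<close> for the out-degree Laplacian of \<open>G\<close> and \<open>T\<close> for that of the clusters, so that
  \<open>L\<^sub>\<beta> = L + (\<beta> - 1) T\<close>. The left kernel vectors are the absorption probabilities and the right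
  ones the stationary distributions (Markov chain tree theorem) of the random walk on the clusters.
  They are biorthogonal, so \<open>P = J_up J_down\<close> is a projection with \<open>P T = T P = 0\<close>; it is the Riesz
  projection because \<open>T\<close> is invertible on the range of \<open>Q = 1 - P\<close>, by the maximum principle for
  the adjoint. Moreover \<open>J_down L J_up\<close> is the reduced Laplacian, so the \<open>P\<close>-block of \<open>L\<^sub>\<beta> - z\<close> is
  invertible by assumption. As \<open>P\<close> is the identity away from the clusters, the range of \<open>Q\<close> is
  finite-dimensional, and there the Schur complement is \<open>(\<beta> - 1) T\<close> plus a fixed operator. It is
  invertible for large \<open>\<beta>\<close> with an inverse of order \<open>1 / \<beta>\<close>; no completeness is needed.
\<close>

section \<open>Linear maps on finitely supported functions\<close>

text \<open>The vertex set may be infinite and \<open>ell2 G\<close> is a bare set of functions, so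
  two reductions carry the analysis. Membership and norm bounds come from uniform bounds on finite
  partial sums, and the inversions on the range of \<open>Q\<close> are traced back to square linear
  systems on the finite set \<open>Field Et\<close>, where injectivity implies bijectivity.
  Perturbed inverses come from a lower bound of the form
  \<open>norm q \<le> 2 * norm (q + \<kappa> U q)\<close> in place of a Neumann series; the same
  bound later yields the rate. The maximum principle governs the adjoint of \<open>T\<close>, whose
  kernel consists of harmonic functions, and not \<open>T\<close> itself, whose kernel consists of
  stationary measures. This is why invertibility is derived from injectivity of a transpose. The
  Riesz projection enters the reduced graph only through its masses, but these normalise both
  transfer operators and all reduced weights. Hence the contour integral has to be evaluated before
  anything can be said about the reduced graph.\<close>

lemma det_square_system_nonzero:
  fixes M :: "complex mat"
  assumes M: "M \<in> carrier_mat n n"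
    and e: "bij_betw e {0..<n} W"
    and A: "\<And>i j. i < n \<Longrightarrow> j < n \<Longrightarrow> M $$ (i, j) = A (e i) (e j)"
    and inj: "\<And>f. (\<forall>x\<in>W. (\<Sum>y\<in>W. A x y * f y) = 0) \<Longrightarrow> \<forall>y\<in>W. f y = 0"
  shows "det M \<noteq> 0"
proof
  assume "det M = 0"
  then obtain v where v: "v \<in> carrier_vec n" "v \<noteq> 0\<^sub>v n" "M *\<^sub>v v = 0\<^sub>v n"
    using det_0_iff_vec_prod_zero[OF M] by blast
  define f where "f = (\<lambda>y. vec_index v (the_inv_into {0..<n} e y))"
  have inv: "the_inv_into {0..<n} e (e i) = i" if "i < n" for i
    using e that by (auto simp: bij_betw_def intro: the_inv_into_f_f)
  have "(\<Sum>y\<in>W. A (e i) y * f y) = 0" if i: "i < n" for i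
  proof -
    have "(\<Sum>y\<in>W. A (e i) y * f y) = (\<Sum>j\<in>{0..<n}. A (e i) (e j) * f (e j))"
      by (rule sum.reindex_bij_betw[OF e, symmetric])
    also have "\<dots> = (\<Sum>j\<in>{0..<n}. M $$ (i, j) * vec_index v j)"
      by (rule sum.cong) (auto simp: A i f_def inv)
    also have "\<dots> = vec_index (M *\<^sub>v v) i"
      using M v(1) i by (auto simp: scalar_prod_def)
    finally show ?thesis using v(3) i by simp
  qed
  then have "\<forall>x\<in>W. (\<Sum>y\<in>W. A x y * f y) = 0"
    using e by (auto simp: bij_betw_def)
  then have "\<forall>y\<in>W. f y = 0" by (rule inj)
  then have "vec_index v i = 0" if "i < n" for i
    using e that inv[OF that] unfolding f_def bij_betw_def by force
  then have "v = 0\<^sub>v n" using v(1) by (intro eq_vecI) auto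
  then show False using v(2) by simp
qed

text \<open>Cramer's rule: the adjugate applied to the right-hand side and divided by the
  determinant solves the system; the enumeration \<open>e\<close> carries it from indices to
  \<open>W\<close>.\<close>

lemma square_system_solvable:
  fixes M :: "complex mat"
  assumes M: "M \<in> carrier_mat n n" and e: "bij_betw e {0..<n} W"
    and A: "\<And>i j. i < n \<Longrightarrow> j < n \<Longrightarrow> M $$ (i, j) = A (e i) (e j)"
    and det: "det M \<noteq> 0"
  shows "\<exists>f. \<forall>x\<in>W. (\<Sum>y\<in>W. A x y * f y) = b x"
proof -
  define w where "w = vec n (\<lambda>i. b (e i))"
  define v where "v = (1 / det M) \<cdot>\<^sub>v (adj_mat M *\<^sub>v w)"
  note adj = adj_mat[OF M]
  have w: "w \<in> carrier_vec n" by (simp add: w_def)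
  have v: "v \<in> carrier_vec n" unfolding v_def using adj(1) w by auto
  have "M *\<^sub>v v = (1 / det M) \<cdot>\<^sub>v (M *\<^sub>v (adj_mat M *\<^sub>v w))"
    unfolding v_def using M adj(1) w by (intro mult_mat_vec) auto
  also have "M *\<^sub>v (adj_mat M *\<^sub>v w) = (M * adj_mat M) *\<^sub>v w"
    using M adj(1) w by simp
  also have "\<dots> = det M \<cdot>\<^sub>v w"
    unfolding adj(2)
  proof (rule eq_vecI)
    fix i assume "i < dim_vec (det M \<cdot>\<^sub>v w)"
    then have i: "i < n" using w by simp
    have "vec_index ((det M \<cdot>\<^sub>m 1\<^sub>m n) *\<^sub>v w) i
        = (\<Sum>j = 0..<n. det M * (if j = i then 1 else 0) * vec_index w j)"
      using i w by (simp add: scalar_prod_def)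
    also have "\<dots> = (\<Sum>j = 0..<n. if j = i then det M * vec_index w j else 0)"
      by (rule sum.cong) auto
    finally show "vec_index ((det M \<cdot>\<^sub>m 1\<^sub>m n) *\<^sub>v w) i = vec_index (det M \<cdot>\<^sub>v w) i"
      using i w by simp
  qed (use w in simp)
  finally have Mv: "M *\<^sub>v v = w" using det w by (auto simp: smult_smult_assoc)
  define f where "f = (\<lambda>y. vec_index v (the_inv_into {0..<n} e y))"
  have inv: "the_inv_into {0..<n} e (e i) = i" if "i < n" for i
    using e that by (auto simp: bij_betw_def intro: the_inv_into_f_f)
  have "(\<Sum>y\<in>W. A (e i) y * f y) = b (e i)" if i: "i < n" for i
  proof -
    have "(\<Sum>y\<in>W. A (e i) y * f y) = (\<Sum>j\<in>{0..<n}. A (e i) (e j) * f (e j))"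
      by (rule sum.reindex_bij_betw[OF e, symmetric])
    also have "\<dots> = (\<Sum>j\<in>{0..<n}. M $$ (i, j) * vec_index v j)"
      by (rule sum.cong) (auto simp: A i f_def inv)
    also have "\<dots> = vec_index (M *\<^sub>v v) i"
      using M v i by (auto simp: scalar_prod_def)
    finally show ?thesis using Mv i by (simp add: w_def)
  qed
  then have "\<forall>x\<in>W. (\<Sum>y\<in>W. A x y * f y) = b x"
    using e by (auto simp: bij_betw_def)
  then show ?thesis by blast
qed

lemma injective_system_solvable:
  fixes A :: "'i \<Rightarrow> 'i \<Rightarrow> complex"
  assumes "finite W"
    and inj: "\<And>f. (\<forall>x\<in>W. (\<Sum>y\<in>W. A x y * f y) = 0) \<Longrightarrow> \<forall>y\<in>W. f y = 0"
  shows "\<exists>f. \<forall>x\<in>W. (\<Sum>y\<in>W. A x y * f y) = b x"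
proof -
  obtain e where e: "bij_betw e {0..<card W} W"
    using ex_bij_betw_nat_finite[OF assms(1)] by blast
  define M where "M = mat (card W) (card W) (\<lambda>(i, j). A (e i) (e j))"
  have M: "M \<in> carrier_mat (card W) (card W)" by (simp add: M_def)
  have ent: "M $$ (i, j) = A (e i) (e j)" if "i < card W" "j < card W" for i j
    using that by (simp add: M_def)
  show ?thesis
    by (rule square_system_solvable[where A = A, OF M e ent
          det_square_system_nonzero[where A = A, OF M e ent inj]])
qed

text \<open>Duality: the transposed system is solvable with right-hand side \<open>cnj f\<close>,
  and pairing that solution with \<open>A f = 0\<close> makes the sum of the squared moduli of
  \<open>f\<close> vanish.\<close>

lemma transpose_injective_system:
  fixes A :: "'i \<Rightarrow> 'i \<Rightarrow> complex"
  assumes "finite W"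
    and inj: "\<And>g. (\<forall>y\<in>W. (\<Sum>x\<in>W. A x y * g x) = 0) \<Longrightarrow> \<forall>x\<in>W. g x = 0"
    and f: "\<forall>x\<in>W. (\<Sum>y\<in>W. A x y * f y) = 0"
  shows "\<forall>y\<in>W. f y = 0"
proof -
  define B where "B = (\<lambda>x y. A y x)"
  have inj': "\<And>g. (\<forall>x\<in>W. (\<Sum>y\<in>W. B x y * g y) = 0) \<Longrightarrow> \<forall>y\<in>W. g y = 0"
    unfolding B_def by (rule inj)
  have "\<exists>g. \<forall>y\<in>W. (\<Sum>x\<in>W. B y x * g x) = cnj (f y)"
    by (rule injective_system_solvable[OF assms(1) inj'])
  then obtain g where g: "\<And>y. y \<in> W \<Longrightarrow> (\<Sum>x\<in>W. A x y * g x) = cnj (f y)"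
    unfolding B_def by blast
  have "(\<Sum>y\<in>W. f y * cnj (f y)) = (\<Sum>y\<in>W. \<Sum>x\<in>W. f y * (A x y * g x))"
    by (simp add: g[symmetric] sum_distrib_left)
  also have "\<dots> = (\<Sum>x\<in>W. g x * (\<Sum>y\<in>W. A x y * f y))"
    by (subst sum.swap) (simp add: sum_distrib_left mult_ac)
  also have "\<dots> = 0" using f by simp
  finally have "(\<Sum>y\<in>W. f y * cnj (f y)) = 0" .
  then have "complex_of_real (\<Sum>y\<in>W. (cmod (f y))\<^sup>2) = 0"
    by (simp flip: complex_norm_square)
  then have "(\<Sum>y\<in>W. (cmod (f y))\<^sup>2) = 0" by (simp only: of_real_eq_0_iff)
  then show ?thesis using assms(1) by (simp add: sum_nonneg_eq_0_iff)
qed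

section \<open>Finite-dimensional operators acting on functions supported in a finite set\<close>

definition supp_funs :: "'v set \<Rightarrow> ('v \<Rightarrow> complex) set" where
  "supp_funs W = {f. \<forall>x. x \<notin> W \<longrightarrow> f x = 0}"

text \<open>Linearity is relative to \<open>X\<close>, since operators built with
  \<open>inv_into\<close> or \<open>THE\<close> are arbitrary outside their domain. The single
  combination encodes additivity and homogeneity together; \<open>f = g\<close> with
  \<open>c = -1\<close> gives the value at 0.\<close>

definition lin_on :: "('v \<Rightarrow> complex) set \<Rightarrow> (('v \<Rightarrow> complex) \<Rightarrow> ('w \<Rightarrow> complex)) \<Rightarrow> bool" where
  "lin_on X A \<longleftrightarrow> (\<forall>f\<in>X. \<forall>g\<in>X. \<forall>c. A (\<lambda>x. f x + c * g x) = (\<lambda>x. A f x + c * A g x))"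

definition delta_fun :: "'v \<Rightarrow> 'v \<Rightarrow> complex" where
  "delta_fun y x = (if x = y then 1 else 0)"

definition l1_norm :: "'v set \<Rightarrow> ('v \<Rightarrow> complex) \<Rightarrow> real" where
  "l1_norm W f = (\<Sum>x\<in>W. cmod (f x))"

lemma lin_onD: "lin_on X A \<Longrightarrow> f \<in> X \<Longrightarrow> g \<in> X \<Longrightarrow> A (\<lambda>x. f x + c * g x) = (\<lambda>x. A f x + c * A g x)"
  by (auto simp: lin_on_def)

lemma lin_on_zero:
  assumes "lin_on X A" "(\<lambda>x. 0) \<in> X" shows "A (\<lambda>x. 0) = (\<lambda>x. 0)"
  using lin_onD[OF assms(1,2,2), of "-1"] by simp

lemma lin_on_diff:
  assumes "lin_on X A" "f \<in> X" "g \<in> X" shows "A (\<lambda>x. f x - g x) = (\<lambda>x. A f x - A g x)"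
  using lin_onD[OF assms, of "-1"] by simp

lemma lin_on_scale:
  assumes "lin_on X A" "f \<in> X" "(\<lambda>x. 0) \<in> X" shows "A (\<lambda>x. c * f x) = (\<lambda>x. c * A f x)"
  using lin_onD[OF assms(1) assms(3) assms(2), of c] lin_on_zero[OF assms(1,3)] by simp

lemma supp_funs_comb: "f \<in> supp_funs W \<Longrightarrow> g \<in> supp_funs W \<Longrightarrow> (\<lambda>x. f x + c * g x) \<in> supp_funs W"
  by (auto simp: supp_funs_def)

lemma zero_supp_funs: "(\<lambda>x. 0) \<in> supp_funs W"
  by (auto simp: supp_funs_def)

lemma delta_supp_funs: "y \<in> W \<Longrightarrow> delta_fun y \<in> supp_funs W"
  by (auto simp: supp_funs_def delta_fun_def)

lemma l1_norm_nonneg: "l1_norm W f \<ge> 0"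
  by (simp add: l1_norm_def sum_nonneg)

lemma lin_on_expand:
  assumes "finite W" "lin_on (supp_funs W) A" "f \<in> supp_funs W"
  shows "A f x = (\<Sum>y\<in>W. f y * A (delta_fun y) x)"
proof -
  have *: "A (\<lambda>x. \<Sum>y\<in>Y. f y * delta_fun y x) x = (\<Sum>y\<in>Y. f y * A (delta_fun y) x)
           \<and> (\<lambda>x. \<Sum>y\<in>Y. f y * delta_fun y x) \<in> supp_funs W"
    if "finite Y" "Y \<subseteq> W" for Y
    using that
  proof (induction Y)
    case empty
    then show ?case using lin_on_zero[OF assms(2) zero_supp_funs] by (simp add: zero_supp_funs)
  next
    case (insert y Y)
    then have IH: "A (\<lambda>x. \<Sum>y\<in>Y. f y * delta_fun y x) x = (\<Sum>y\<in>Y. f y * A (delta_fun y) x)"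
      and S: "(\<lambda>x. \<Sum>y\<in>Y. f y * delta_fun y x) \<in> supp_funs W" by auto
    have d: "delta_fun y \<in> supp_funs W" using insert by (auto intro: delta_supp_funs)
    have eq: "(\<lambda>x. \<Sum>y\<in>insert y Y. f y * delta_fun y x)
              = (\<lambda>x. (\<Sum>y\<in>Y. f y * delta_fun y x) + f y * delta_fun y x)"
      using insert by (auto simp: fun_eq_iff add.commute)
    show ?case unfolding eq lin_onD[OF assms(2) S d]
      using supp_funs_comb[OF S d, of "f y"] insert IH by (simp add: add.commute)
  qed
  have "(\<lambda>x. \<Sum>y\<in>W. f y * delta_fun y x) = f"
  proof
    fix x show "(\<Sum>y\<in>W. f y * delta_fun y x) = f x"
      using assms(1,3) by (cases "x \<in> W") (auto simp: delta_fun_def supp_funs_def if_distrib cong: if_cong)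
  qed
  then show ?thesis using *[OF assms(1) subset_refl] by simp
qed

text \<open>An injective endomorphism of a finite-dimensional space is onto; the matrix of
  \<open>A\<close> has the entries \<open>A (delta_fun y) x\<close>.\<close>

lemma lin_inj_bij:
  assumes W: "finite W" and lin: "lin_on (supp_funs W) A"
    and into: "\<And>f. f \<in> supp_funs W \<Longrightarrow> A f \<in> supp_funs W"
    and inj: "\<And>f. f \<in> supp_funs W \<Longrightarrow> A f = (\<lambda>x. 0) \<Longrightarrow> f = (\<lambda>x. 0)"
  shows "bij_betw A (supp_funs W) (supp_funs W)"
  unfolding bij_betw_def
proof
  show "inj_on A (supp_funs W)"
  proof (rule inj_onI)
    fix f g assume fg: "f \<in> supp_funs W" "g \<in> supp_funs W" "A f = A g"
    have "A (\<lambda>x. f x - g x) = (\<lambda>x. 0)" using lin_on_diff[OF lin fg(1,2)] fg(3) by simp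
    moreover have "(\<lambda>x. f x - g x) \<in> supp_funs W" using supp_funs_comb[OF fg(1,2), of "-1"] by simp
    ultimately have "(\<lambda>x. f x - g x) = (\<lambda>x. 0)" by (rule inj[rotated])
    then show "f = g" by (auto simp: fun_eq_iff)
  qed
  have "h \<in> A ` supp_funs W" if h: "h \<in> supp_funs W" for h
  proof -
    \<comment> \<open>A solution of the square system is determined only on \<open>W\<close>; its
      values outside are discarded.\<close>
    define cut where "cut = (\<lambda>(f :: 'a \<Rightarrow> complex) x. if x \<in> W then f x else 0)"
    have cut: "cut f \<in> supp_funs W" for f
      by (simp add: supp_funs_def cut_def)
    have ex: "A (cut f) x = (\<Sum>y\<in>W. A (delta_fun y) x * f y)" for f x
      unfolding lin_on_expand[OF W lin cut] by (rule sum.cong) (auto simp: cut_def)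
    have out: "x \<notin> W \<Longrightarrow> A (cut f) x = 0" for f x
      using into[OF cut, of f] by (auto simp: supp_funs_def)
    have "\<exists>f. \<forall>x\<in>W. (\<Sum>y\<in>W. A (delta_fun y) x * f y) = h x"
    proof (rule injective_system_solvable[OF W])
      fix f assume f: "\<forall>x\<in>W. (\<Sum>y\<in>W. A (delta_fun y) x * f y) = 0"
      have "A (cut f) x = 0" for x
        using f out[of x f] by (cases "x \<in> W") (auto simp: ex)
      then have "A (cut f) = (\<lambda>x. 0)" ..
      then have "cut f = (\<lambda>x. 0)" by (rule inj[OF cut])
      then show "\<forall>y\<in>W. f y = 0" unfolding cut_def by (metis (no_types, lifting))
    qed
    then obtain f where f: "\<forall>x\<in>W. (\<Sum>y\<in>W. A (delta_fun y) x * f y) = h x" ..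
    have "A (cut f) x = h x" for x
    proof (cases "x \<in> W")
      case True
      then show ?thesis using f by (simp add: ex)
    next
      case False
      then show ?thesis using h out by (auto simp: supp_funs_def)
    qed
    then have "A (cut f) = h" ..
    then show ?thesis using cut by blast
  qed
  then show "A ` supp_funs W = supp_funs W" using into by blast
qed

text \<open>The hypothesis says that only the zero functional annihilates the range of
  \<open>A\<close>. In this form the criterion is applied to \<open>T\<close> plus the projection,
  whose adjoint is accessible through harmonic functions.\<close>

lemma lin_transpose_inj_bij:
  assumes W: "finite W" and lin: "lin_on (supp_funs W) A"
    and into: "\<And>f. f \<in> supp_funs W \<Longrightarrow> A f \<in> supp_funs W"
    and inj: "\<And>g. (\<And>f. f \<in> supp_funs W \<Longrightarrow> (\<Sum>x\<in>W. g x * A f x) = 0) \<Longrightarrow> \<forall>x\<in>W. g x = 0"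
  shows "bij_betw A (supp_funs W) (supp_funs W)"
proof (rule lin_inj_bij[OF W lin into])
  fix f assume f: "f \<in> supp_funs W" "A f = (\<lambda>x. 0)"
  have "\<forall>y\<in>W. f y = 0"
  proof (rule transpose_injective_system[OF W])
    fix g assume g: "\<forall>y\<in>W. (\<Sum>x\<in>W. A (delta_fun y) x * g x) = 0"
    show "\<forall>x\<in>W. g x = 0"
    proof (rule inj)
      fix k assume k: "k \<in> supp_funs W"
      have "(\<Sum>x\<in>W. g x * A k x) = (\<Sum>x\<in>W. \<Sum>y\<in>W. g x * (k y * A (delta_fun y) x))"
        unfolding lin_on_expand[OF W lin k] by (simp add: sum_distrib_left)
      also have "\<dots> = (\<Sum>y\<in>W. k y * (\<Sum>x\<in>W. A (delta_fun y) x * g x))"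
        by (subst sum.swap) (simp add: sum_distrib_left mult_ac)
      also have "\<dots> = 0" using g by simp
      finally show "(\<Sum>x\<in>W. g x * A k x) = 0" .
    qed
  next
    have "(\<Sum>y\<in>W. A (delta_fun y) x * f y) = 0" for x
      using lin_on_expand[OF W lin f(1), of x] f(2) by (simp add: mult.commute)
    then show "\<forall>x\<in>W. (\<Sum>y\<in>W. A (delta_fun y) x * f y) = 0" by simp
  qed
  then show "f = (\<lambda>x. 0)" using f(1) by (auto simp: supp_funs_def fun_eq_iff)
qed

lemma lin_l1_bounded:
  assumes W: "finite W" and lin: "lin_on (supp_funs W) A"
  shows "\<exists>c>0. \<forall>f\<in>supp_funs W. l1_norm Y (A f) \<le> c * l1_norm W f"
proof (intro exI conjI ballI)
  \<comment> \<open>The summand 1 keeps the constant positive even for empty \<open>W\<close>; its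
    reciprocal later serves as a radius.\<close>
  let ?c = "1 + (\<Sum>y\<in>W. l1_norm Y (A (delta_fun y)))"
  show "0 < ?c" using sum_nonneg[of W "\<lambda>y. l1_norm Y (A (delta_fun y))"] by (simp add: l1_norm_nonneg)
  fix f assume f: "f \<in> supp_funs W"
  have "l1_norm Y (A f) \<le> (\<Sum>x\<in>Y. \<Sum>y\<in>W. cmod (f y) * cmod (A (delta_fun y) x))"
    unfolding l1_norm_def lin_on_expand[OF W lin f]
    by (intro sum_mono order.trans[OF norm_sum]) (simp add: norm_mult)
  also have "\<dots> = (\<Sum>y\<in>W. cmod (f y) * l1_norm Y (A (delta_fun y)))"
    by (subst sum.swap) (simp add: l1_norm_def sum_distrib_left)
  also have "\<dots> \<le> (\<Sum>y\<in>W. cmod (f y) * ?c)"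
  proof (intro sum_mono mult_left_mono)
    fix y assume "y \<in> W"
    then have "l1_norm Y (A (delta_fun y)) \<le> (\<Sum>y\<in>W. l1_norm Y (A (delta_fun y)))"
      using W by (intro member_le_sum) (auto simp: l1_norm_nonneg)
    then show "l1_norm Y (A (delta_fun y)) \<le> ?c" by simp
  qed simp
  also have "\<dots> = ?c * l1_norm W f" by (simp add: l1_norm_def[of W] sum_distrib_right mult.commute)
  finally show "l1_norm Y (A f) \<le> ?c * l1_norm W f" .
qed

text \<open>If \<open>U\<close> has norm at most \<open>c\<close>, then under
  \<open>cmod \<kappa> * (2 * c) \<le> 1\<close> the perturbation takes away at most half of the
  norm of \<open>q\<close>. The resulting lower bound gives injectivity, and finite dimension gives
  the rest.\<close>

lemma small_perturbation_bij:
  assumes W: "finite W" and lin: "lin_on (supp_funs W) U"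
    and into: "\<And>f. f \<in> supp_funs W \<Longrightarrow> U f \<in> supp_funs W"
  shows "\<exists>c>0. \<forall>\<kappa>. cmod \<kappa> * c \<le> 1 \<longrightarrow>
           (\<forall>q\<in>supp_funs W. l1_norm W q \<le> 2 * l1_norm W (\<lambda>x. q x + \<kappa> * U q x)) \<and>
           bij_betw (\<lambda>q x. q x + \<kappa> * U q x) (supp_funs W) (supp_funs W)"
proof -
  obtain c where c: "c > 0" and bd: "\<And>f. f \<in> supp_funs W \<Longrightarrow> l1_norm W (U f) \<le> c * l1_norm W f"
    using lin_l1_bounded[OF W lin] by blast
  have low: "l1_norm W q \<le> 2 * l1_norm W (\<lambda>x. q x + \<kappa> * U q x)"
    if \<kappa>: "cmod \<kappa> * (2 * c) \<le> 1" and q: "q \<in> supp_funs W" for \<kappa> q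
  proof -
    have "l1_norm W q \<le> l1_norm W (\<lambda>x. q x + \<kappa> * U q x) + cmod \<kappa> * l1_norm W (U q)"
      unfolding l1_norm_def sum_distrib_left sum.distrib[symmetric]
    proof (rule sum_mono)
      fix x
      have "cmod (q x) \<le> cmod (q x + \<kappa> * U q x) + cmod (\<kappa> * U q x)"
        using norm_triangle_ineq4[of "q x + \<kappa> * U q x" "\<kappa> * U q x"] by simp
      then show "cmod (q x) \<le> cmod (q x + \<kappa> * U q x) + cmod \<kappa> * cmod (U q x)"
        by (simp add: norm_mult)
    qed
    also have "cmod \<kappa> * l1_norm W (U q) \<le> cmod \<kappa> * (c * l1_norm W q)"
      by (intro mult_left_mono bd q) auto
    also have "\<dots> = (cmod \<kappa> * (2 * c)) * l1_norm W q / 2" by simp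
    also have "\<dots> \<le> 1 * l1_norm W q / 2"
      by (intro divide_right_mono mult_right_mono \<kappa>) (auto simp: l1_norm_nonneg)
    finally show ?thesis by simp
  qed
  have "bij_betw (\<lambda>q x. q x + \<kappa> * U q x) (supp_funs W) (supp_funs W)"
    if \<kappa>: "cmod \<kappa> * (2 * c) \<le> 1" for \<kappa>
  proof (rule lin_inj_bij[OF W])
    show "lin_on (supp_funs W) (\<lambda>q x. q x + \<kappa> * U q x)"
      unfolding lin_on_def by (auto simp: lin_onD[OF lin] algebra_simps fun_eq_iff)
    show "(\<lambda>x. f x + \<kappa> * U f x) \<in> supp_funs W" if "f \<in> supp_funs W" for f
      using that into[OF that] by (rule supp_funs_comb)
    fix f assume f: "f \<in> supp_funs W" and 0: "(\<lambda>x. f x + \<kappa> * U f x) = (\<lambda>x. 0)"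
    have "l1_norm W f \<le> 0" using low[OF \<kappa> f] unfolding 0 by (simp add: l1_norm_def)
    then have "l1_norm W f = 0" using l1_norm_nonneg[of W f] by linarith
    then show "f = (\<lambda>x. 0)"
      using f W by (auto simp: l1_norm_def sum_nonneg_eq_0_iff supp_funs_def fun_eq_iff)
  qed
  then show ?thesis using low c by (intro exI[of _ "2 * c"]) auto
qed

section \<open>Bounded operators between spaces of square-summable functions\<close>

definition ell2_bounded ::
    "'v wgraph \<Rightarrow> 'w wgraph \<Rightarrow> (('v \<Rightarrow> complex) \<Rightarrow> ('w \<Rightarrow> complex)) \<Rightarrow> bool" where
  "ell2_bounded G H A \<longleftrightarrow>
     (\<exists>c\<ge>0. \<forall>f\<in>ell2 G. A f \<in> ell2 H \<and> ell2_norm H (A f) \<le> c * ell2_norm G f)"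

definition nonneg_mass :: "'v wgraph \<Rightarrow> bool" where
  "nonneg_mass G \<longleftrightarrow> (\<forall>v\<in>verts G. mass G v \<ge> 0)"

text \<open>Summability and the norm bound both follow from one bound on all finite partial sums, so
  later estimates never handle infinite sums directly.\<close>

lemma ell2I:
  assumes "nonneg_mass G" "\<And>x. x \<notin> verts G \<Longrightarrow> f x = 0"
    and bd: "\<And>F. finite F \<Longrightarrow> F \<subseteq> verts G \<Longrightarrow> (\<Sum>x\<in>F. (cmod (f x))\<^sup>2 * mass G x) \<le> B\<^sup>2"
    and "B \<ge> 0"
  shows "f \<in> ell2 G" "ell2_norm G f \<le> B"
proof -
  have s: "(\<lambda>x. (cmod (f x))\<^sup>2 * mass G x) summable_on verts G"
  proof (rule nonneg_bdd_above_summable_on)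
    show "0 \<le> (cmod (f x))\<^sup>2 * mass G x" if "x \<in> verts G" for x
      using assms(1) that by (auto simp: nonneg_mass_def)
    show "bdd_above (sum (\<lambda>x. (cmod (f x))\<^sup>2 * mass G x) ` {F. F \<subseteq> verts G \<and> finite F})"
      by (rule bdd_aboveI[of _ "B\<^sup>2"]) (auto intro: bd)
  qed
  then show "f \<in> ell2 G" using assms(2) by (auto simp: ell2_def)
  have "(\<Sum>\<^sub>\<infinity>x\<in>verts G. (cmod (f x))\<^sup>2 * mass G x) \<le> B\<^sup>2"
    using s bd by (rule infsum_le_finite_sums)
  then show "ell2_norm G f \<le> B"
    unfolding ell2_norm_def using \<open>B \<ge> 0\<close> by (rule real_le_lsqrt[rotated])
qed

lemma ell2_norm_nonneg:
  assumes "nonneg_mass G" shows "ell2_norm G f \<ge> 0"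
  unfolding ell2_norm_def using assms
  by (intro real_sqrt_ge_zero infsum_nonneg) (auto simp: nonneg_mass_def)

lemma ell2_finite_sum_le:
  assumes "nonneg_mass G" "f \<in> ell2 G" "finite F" "F \<subseteq> verts G"
  shows "(\<Sum>x\<in>F. (cmod (f x))\<^sup>2 * mass G x) \<le> (ell2_norm G f)\<^sup>2"
proof -
  have "(\<Sum>x\<in>F. (cmod (f x))\<^sup>2 * mass G x) \<le> (\<Sum>\<^sub>\<infinity>x\<in>verts G. (cmod (f x))\<^sup>2 * mass G x)"
    using assms by (intro finite_sum_le_infsum) (auto simp: ell2_def nonneg_mass_def)
  moreover have "0 \<le> (\<Sum>\<^sub>\<infinity>x\<in>verts G. (cmod (f x))\<^sup>2 * mass G x)"
    using assms(1) by (intro infsum_nonneg) (auto simp: nonneg_mass_def)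
  ultimately show ?thesis by (simp add: ell2_norm_def)
qed

text \<open>
  The crude factor 2 avoids Minkowski's inequality; only boundedness matters below.
\<close>

lemma ell2_comb:
  assumes G: "nonneg_mass G" and f: "f \<in> ell2 G" and g: "g \<in> ell2 G"
  shows "(\<lambda>x. f x + c * g x) \<in> ell2 G"
    and "ell2_norm G (\<lambda>x. f x + c * g x) \<le> 2 * (ell2_norm G f + cmod c * ell2_norm G g)"
proof -
  let ?B = "2 * (ell2_norm G f + cmod c * ell2_norm G g)"
  have z: "f x + c * g x = 0" if "x \<notin> verts G" for x
    using f g that by (auto simp: ell2_def)
  have nn: "ell2_norm G f \<ge> 0" "ell2_norm G g \<ge> 0" using G by (auto intro: ell2_norm_nonneg)
  have B: "?B \<ge> 0" using nn by simp
  have "(\<Sum>x\<in>F. (cmod (f x + c * g x))\<^sup>2 * mass G x) \<le> ?B\<^sup>2"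
    if F: "finite F" "F \<subseteq> verts G" for F
  proof -
    have "(\<Sum>x\<in>F. (cmod (f x + c * g x))\<^sup>2 * mass G x)
        \<le> (\<Sum>x\<in>F. 2 * ((cmod (f x))\<^sup>2 * mass G x) + 2 * (cmod c)\<^sup>2 * ((cmod (g x))\<^sup>2 * mass G x))"
    proof (rule sum_mono)
      fix x assume "x \<in> F"
      then have m: "mass G x \<ge> 0" using F G by (auto simp: nonneg_mass_def)
      have "cmod (f x + c * g x) \<le> cmod (f x) + cmod c * cmod (g x)"
        using norm_triangle_ineq[of "f x" "c * g x"] by (simp add: norm_mult)
      then have "(cmod (f x + c * g x))\<^sup>2 \<le> (cmod (f x) + cmod c * cmod (g x))\<^sup>2"
        by (intro power_mono) auto
      also have "\<dots> \<le> 2 * (cmod (f x))\<^sup>2 + 2 * (cmod c * cmod (g x))\<^sup>2"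
        using sum_squares_bound[of "cmod (f x)" "cmod c * cmod (g x)"]
        by (simp add: power2_sum)
      finally have "(cmod (f x + c * g x))\<^sup>2 * mass G x
          \<le> (2 * (cmod (f x))\<^sup>2 + 2 * (cmod c * cmod (g x))\<^sup>2) * mass G x"
        using m by (intro mult_right_mono)
      then show "(cmod (f x + c * g x))\<^sup>2 * mass G x
          \<le> 2 * ((cmod (f x))\<^sup>2 * mass G x) + 2 * (cmod c)\<^sup>2 * ((cmod (g x))\<^sup>2 * mass G x)"
        by (simp add: algebra_simps power_mult_distrib)
    qed
    also have "\<dots> = 2 * (\<Sum>x\<in>F. (cmod (f x))\<^sup>2 * mass G x)
        + 2 * (cmod c)\<^sup>2 * (\<Sum>x\<in>F. (cmod (g x))\<^sup>2 * mass G x)"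
      by (simp add: sum.distrib sum_distrib_left)
    also have "\<dots> \<le> 2 * (ell2_norm G f)\<^sup>2 + 2 * (cmod c)\<^sup>2 * (ell2_norm G g)\<^sup>2"
      using ell2_finite_sum_le[OF G f F] ell2_finite_sum_le[OF G g F]
      by (intro add_mono mult_left_mono) auto
    also have "\<dots> \<le> 4 * (ell2_norm G f)\<^sup>2 + 4 * (cmod c * ell2_norm G g)\<^sup>2
        + 8 * (ell2_norm G f * (cmod c * ell2_norm G g))"
      using nn by (simp add: power_mult_distrib)
    also have "\<dots> = ?B\<^sup>2" by (simp add: power2_eq_square algebra_simps)
    finally show ?thesis .
  qed
  from ell2I[OF G z this B]
  show "(\<lambda>x. f x + c * g x) \<in> ell2 G"
    and "ell2_norm G (\<lambda>x. f x + c * g x) \<le> ?B" by blast+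
qed

lemma zero_ell2: "(\<lambda>x. 0) \<in> ell2 G"
  by (simp add: ell2_def)

lemma ell2_norm_zero: "ell2_norm G (\<lambda>x. 0) = 0"
  by (simp add: ell2_norm_def)

lemma ell2_diff:
  assumes "nonneg_mass G" "f \<in> ell2 G" "g \<in> ell2 G" shows "(\<lambda>x. f x - g x) \<in> ell2 G"
  using ell2_comb(1)[OF assms, of "-1"] by simp

lemma ell2_scale:
  assumes "nonneg_mass G" "f \<in> ell2 G" shows "(\<lambda>x. c * f x) \<in> ell2 G"
  using ell2_comb(1)[OF assms(1) zero_ell2 assms(2), of c] by simp

lemma ell2_boundedI:
  assumes "c \<ge> 0" "\<And>f. f \<in> ell2 G \<Longrightarrow> A f \<in> ell2 H"
    "\<And>f. f \<in> ell2 G \<Longrightarrow> ell2_norm H (A f) \<le> c * ell2_norm G f"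
  shows "ell2_bounded G H A"
  using assms by (auto simp: ell2_bounded_def)

lemma ell2_boundedE:
  assumes "ell2_bounded G H A"
  obtains c where "c \<ge> 0" "\<And>f. f \<in> ell2 G \<Longrightarrow> A f \<in> ell2 H"
    "\<And>f. f \<in> ell2 G \<Longrightarrow> ell2_norm H (A f) \<le> c * ell2_norm G f"
  using assms by (auto simp: ell2_bounded_def)

lemma ell2_bounded_mem: "ell2_bounded G H A \<Longrightarrow> f \<in> ell2 G \<Longrightarrow> A f \<in> ell2 H"
  by (auto simp: ell2_bounded_def)

lemma ell2_bounded_id: "ell2_bounded G G (\<lambda>f. f)"
  by (rule ell2_boundedI[of 1]) auto

lemma ell2_bounded_compose:
  assumes A: "ell2_bounded G H A" and B: "ell2_bounded H K B"
  shows "ell2_bounded G K (\<lambda>f. B (A f))"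
proof -
  obtain a where a: "a \<ge> 0" "\<And>f. f \<in> ell2 G \<Longrightarrow> A f \<in> ell2 H"
    "\<And>f. f \<in> ell2 G \<Longrightarrow> ell2_norm H (A f) \<le> a * ell2_norm G f" using A by (rule ell2_boundedE) blast
  obtain b where b: "b \<ge> 0" "\<And>f. f \<in> ell2 H \<Longrightarrow> B f \<in> ell2 K"
    "\<And>f. f \<in> ell2 H \<Longrightarrow> ell2_norm K (B f) \<le> b * ell2_norm H f" using B by (rule ell2_boundedE) blast
  show ?thesis
  proof (rule ell2_boundedI[of "b * a"])
    fix f assume f: "f \<in> ell2 G"
    have "ell2_norm K (B (A f)) \<le> b * ell2_norm H (A f)" using a b f by blast
    also have "\<dots> \<le> b * (a * ell2_norm G f)" using a b f by (intro mult_left_mono) auto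
    finally show "ell2_norm K (B (A f)) \<le> b * a * ell2_norm G f" by (simp add: mult.assoc)
  qed (use a b in auto)
qed

lemma ell2_bounded_comb:
  assumes H: "nonneg_mass H" and A: "ell2_bounded G H A" and B: "ell2_bounded G H B"
  shows "ell2_bounded G H (\<lambda>f x. A f x + c * B f x)"
proof -
  obtain a where a: "a \<ge> 0" "\<And>f. f \<in> ell2 G \<Longrightarrow> A f \<in> ell2 H"
    "\<And>f. f \<in> ell2 G \<Longrightarrow> ell2_norm H (A f) \<le> a * ell2_norm G f" using A by (rule ell2_boundedE) blast
  obtain b where b: "b \<ge> 0" "\<And>f. f \<in> ell2 G \<Longrightarrow> B f \<in> ell2 H"
    "\<And>f. f \<in> ell2 G \<Longrightarrow> ell2_norm H (B f) \<le> b * ell2_norm G f" using B by (rule ell2_boundedE) blast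
  show ?thesis
  proof (rule ell2_boundedI[of "2 * (a + cmod c * b)"])
    fix f assume f: "f \<in> ell2 G"
    have "ell2_norm H (\<lambda>x. A f x + c * B f x) \<le> 2 * (ell2_norm H (A f) + cmod c * ell2_norm H (B f))"
      using a b f by (intro ell2_comb H) auto
    also have "\<dots> \<le> 2 * (a * ell2_norm G f + cmod c * (b * ell2_norm G f))"
      using a b f by (intro mult_left_mono add_mono) auto
    finally show "ell2_norm H (\<lambda>x. A f x + c * B f x) \<le> 2 * (a + cmod c * b) * ell2_norm G f"
      by (simp add: algebra_simps)
  qed (use a b H in \<open>auto intro: ell2_comb\<close>)
qed

lemma ell2_bounded_diff:
  assumes "nonneg_mass H" "ell2_bounded G H A" "ell2_bounded G H B"
  shows "ell2_bounded G H (\<lambda>f x. A f x - B f x)"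
  using ell2_bounded_comb[OF assms, of "-1"] by simp

section \<open>The operator norm, point evaluation and operators of finite rank\<close>

lemma op_norm_le:
  assumes "c \<ge> 0" "\<And>f. f \<in> ell2 G \<Longrightarrow> T f \<in> ell2 H"
    "\<And>f. f \<in> ell2 G \<Longrightarrow> ell2_norm H (T f) \<le> c * ell2_norm G f"
  shows "op_norm G H T \<le> ennreal c"
  unfolding op_norm_def using assms by (intro Inf_lower) auto

text \<open>The infimum is infinite only over an empty set, so finiteness provides one admissible
  constant.\<close>

lemma op_norm_finite_iff: "op_norm G H T < \<infinity> \<longleftrightarrow> ell2_bounded G H T"
proof
  assume "op_norm G H T < \<infinity>"
  then have "{ennreal c | c. c \<ge> 0 \<and>
            (\<forall>f\<in>ell2 G. T f \<in> ell2 H \<and> ell2_norm H (T f) \<le> c * ell2_norm G f)} \<noteq> {}"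
    unfolding op_norm_def by (auto simp: Inf_empty simp del: Collect_empty_eq)
  then show "ell2_bounded G H T" by (auto simp: ell2_bounded_def)
next
  assume "ell2_bounded G H T"
  then obtain c where "c \<ge> 0" "\<And>f. f \<in> ell2 G \<Longrightarrow> T f \<in> ell2 H"
    "\<And>f. f \<in> ell2 G \<Longrightarrow> ell2_norm H (T f) \<le> c * ell2_norm G f" by (rule ell2_boundedE) blast
  then have "op_norm G H T \<le> ennreal c" by (rule op_norm_le)
  also have "\<dots> < \<infinity>" by simp
  finally show "op_norm G H T < \<infinity>" .
qed

lemma supp_funs_ell2:
  assumes "finite W" "W \<subseteq> verts G" "f \<in> supp_funs W"
  shows "f \<in> ell2 G"
proof -
  have "(\<lambda>x. (cmod (f x))\<^sup>2 * mass G x) summable_on verts G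
      \<longleftrightarrow> (\<lambda>x. (cmod (f x))\<^sup>2 * mass G x) summable_on W"
    using assms by (intro summable_on_cong_neutral) (auto simp: supp_funs_def)
  then show ?thesis using assms by (auto simp: ell2_def supp_funs_def)
qed

lemma ell2_eval_bound:
  assumes "nonneg_mass G" "f \<in> ell2 G" "x \<in> verts G" "mass G x > 0"
  shows "cmod (f x) \<le> ell2_norm G f / sqrt (mass G x)"
proof -
  have "(cmod (f x))\<^sup>2 * mass G x \<le> (ell2_norm G f)\<^sup>2"
    using ell2_finite_sum_le[OF assms(1,2), of "{x}"] assms(3) by simp
  then have "(cmod (f x) * sqrt (mass G x))\<^sup>2 \<le> (ell2_norm G f)\<^sup>2"
    using assms(4) by (simp add: power_mult_distrib)
  then have "cmod (f x) * sqrt (mass G x) \<le> ell2_norm G f"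
    using ell2_norm_nonneg[OF assms(1)] by (rule power2_le_imp_le)
  then show ?thesis using assms(4) by (simp add: field_simps)
qed

lemma l1_norm_le_ell2_norm:
  assumes "nonneg_mass G" "\<And>x. x \<in> W \<Longrightarrow> x \<in> verts G \<and> mass G x > 0"
  shows "\<exists>c\<ge>0. \<forall>f\<in>ell2 G. l1_norm W f \<le> c * ell2_norm G f"
proof (intro exI conjI ballI)
  show "0 \<le> (\<Sum>x\<in>W. 1 / sqrt (mass G x))"
    using assms(2) by (intro sum_nonneg) (simp add: less_imp_le)
  fix f assume f: "f \<in> ell2 G"
  have "l1_norm W f \<le> (\<Sum>x\<in>W. ell2_norm G f / sqrt (mass G x))"
    unfolding l1_norm_def using assms f by (intro sum_mono ell2_eval_bound) auto
  then show "l1_norm W f \<le> (\<Sum>x\<in>W. 1 / sqrt (mass G x)) * ell2_norm G f"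
    by (simp add: sum_distrib_right)
qed

lemma lin_ell2_bounded:
  assumes G: "nonneg_mass G" and W: "finite W" and lin: "lin_on (supp_funs W) U"
    and into: "\<And>f. f \<in> supp_funs W \<Longrightarrow> U f \<in> ell2 G"
  shows "\<exists>c\<ge>0. \<forall>f\<in>supp_funs W. ell2_norm G (U f) \<le> c * l1_norm W f"
proof -
  have "\<exists>c\<ge>0. \<forall>f. (\<lambda>x. \<Sum>y\<in>Y. f y * U (delta_fun y) x) \<in> ell2 G \<and>
          ell2_norm G (\<lambda>x. \<Sum>y\<in>Y. f y * U (delta_fun y) x) \<le> c * l1_norm Y f"
    if "finite Y" "Y \<subseteq> W" for Y
    using that
  proof (induction Y)
    case empty
    then show ?case by (auto simp: zero_ell2 ell2_norm_zero l1_norm_def)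
  next
    case (insert y Y)
    then obtain c where c: "c \<ge> 0" "\<And>f. (\<lambda>x. \<Sum>y\<in>Y. f y * U (delta_fun y) x) \<in> ell2 G"
      "\<And>f. ell2_norm G (\<lambda>x. \<Sum>y\<in>Y. f y * U (delta_fun y) x) \<le> c * l1_norm Y f" by auto
    have d: "U (delta_fun y) \<in> ell2 G" using insert by (intro into delta_supp_funs) auto
    have eq: "(\<lambda>x. \<Sum>y\<in>insert y Y. f y * U (delta_fun y) x)
            = (\<lambda>x. (\<Sum>y\<in>Y. f y * U (delta_fun y) x) + f y * U (delta_fun y) x)" for f
      using insert by (auto simp: add.commute)
    show ?case
    proof (intro exI conjI allI)
      let ?N = "ell2_norm G (U (delta_fun y))"
      \<comment> \<open>Each vertex costs one factor 2 of \<open>ell2_comb\<close>; the constant may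
        grow exponentially with \<open>card W\<close>, but only its existence is used.\<close>
      let ?c = "2 * (c + ?N)"
      have N: "?N \<ge> 0" using G by (rule ell2_norm_nonneg)
      then show "0 \<le> ?c" using c(1) by simp
      fix f :: "'b \<Rightarrow> complex"
      show "(\<lambda>x. \<Sum>y\<in>insert y Y. f y * U (delta_fun y) x) \<in> ell2 G"
        unfolding eq using c d G by (intro ell2_comb)
      have "ell2_norm G (\<lambda>x. \<Sum>y\<in>insert y Y. f y * U (delta_fun y) x)
          \<le> 2 * (ell2_norm G (\<lambda>x. \<Sum>y\<in>Y. f y * U (delta_fun y) x) + cmod (f y) * ?N)"
        unfolding eq using c d G by (intro ell2_comb)
      also have "\<dots> \<le> 2 * (c * l1_norm Y f + cmod (f y) * ?N)"
        using c by (intro mult_left_mono add_mono) auto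
      also have "\<dots> \<le> 2 * ((c + ?N) * l1_norm Y f + (c + ?N) * cmod (f y))"
        using c N l1_norm_nonneg[of Y f] by (simp add: algebra_simps)
      also have "\<dots> = ?c * l1_norm (insert y Y) f"
        using insert by (simp add: l1_norm_def algebra_simps)
      finally show "ell2_norm G (\<lambda>x. \<Sum>y\<in>insert y Y. f y * U (delta_fun y) x)
          \<le> ?c * l1_norm (insert y Y) f" .
    qed
  qed
  from this[OF W subset_refl] obtain c where "c \<ge> 0"
    "\<And>f. ell2_norm G (\<lambda>x. \<Sum>y\<in>W. f y * U (delta_fun y) x) \<le> c * l1_norm W f" by auto
  moreover have "U f = (\<lambda>x. \<Sum>y\<in>W. f y * U (delta_fun y) x)" if "f \<in> supp_funs W" for f
    using lin_on_expand[OF W lin that] by auto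
  ultimately show ?thesis by auto
qed

section \<open>The Laplacian is bounded\<close>

lemma infsum_restrict:
  fixes f :: "'v \<Rightarrow> 'b :: {comm_monoid_add, t2_space}"
  assumes "finite Y" "Y \<subseteq> V" "\<And>y. y \<in> V \<Longrightarrow> y \<notin> Y \<Longrightarrow> f y = 0"
  shows "infsum f V = sum f Y"
proof -
  have "infsum f V = infsum f Y" using assms by (intro infsum_cong_neutral) auto
  then show ?thesis using assms by simp
qed

text \<open>Cauchy-Schwarz after splitting each weight into two factors
  \<open>sqrt (a y)\<close>.\<close>

lemma cmod_weighted_sum_squared:
  assumes "\<And>y. y \<in> Y \<Longrightarrow> a y \<ge> 0"
  shows "(cmod (\<Sum>y\<in>Y. of_real (a y) * f y))\<^sup>2 \<le> (\<Sum>y\<in>Y. a y) * (\<Sum>y\<in>Y. a y * (cmod (f y))\<^sup>2)"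
proof -
  have "cmod (\<Sum>y\<in>Y. of_real (a y) * f y) \<le> (\<Sum>y\<in>Y. sqrt (a y) * (sqrt (a y) * cmod (f y)))"
  proof (rule order.trans[OF norm_sum], rule sum_mono)
    fix y assume "y \<in> Y"
    then have "a y = sqrt (a y) * sqrt (a y)" "a y \<ge> 0" using assms by auto
    then show "cmod (of_real (a y) * f y) \<le> sqrt (a y) * (sqrt (a y) * cmod (f y))"
      by (simp add: norm_mult flip: mult.assoc)
  qed
  then have "(cmod (\<Sum>y\<in>Y. of_real (a y) * f y))\<^sup>2
      \<le> (\<Sum>y\<in>Y. sqrt (a y) * (sqrt (a y) * cmod (f y)))\<^sup>2"
    by (intro power_mono) auto
  also have "\<dots> \<le> (\<Sum>y\<in>Y. (sqrt (a y))\<^sup>2) * (\<Sum>y\<in>Y. (sqrt (a y) * cmod (f y))\<^sup>2)"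
    by (rule Cauchy_Schwarz_ineq_sum)
  also have "\<dots> = (\<Sum>y\<in>Y. a y) * (\<Sum>y\<in>Y. a y * (cmod (f y))\<^sup>2)"
    using assms by (simp add: power_mult_distrib)
  finally show ?thesis .
qed

locale wdigraph =
  fixes G :: "'v wgraph"
  assumes weighted_digraph: "weighted_digraph G"
begin

abbreviation "V \<equiv> verts G"
abbreviation "m \<equiv> mass G"
abbreviation "a \<equiv> weight G"

lemma mass_pos: "v \<in> V \<Longrightarrow> m v > 0"
  using weighted_digraph by (auto simp: weighted_digraph_def)

lemma nonneg_mass: "nonneg_mass G"
  using mass_pos by (auto simp: nonneg_mass_def less_imp_le)

lemma edges_verts: "(v, w) \<in> edges G \<Longrightarrow> v \<in> V \<and> w \<in> V"
  using weighted_digraph by (auto simp: weighted_digraph_def)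

lemma weight_nonneg: "v \<in> V \<Longrightarrow> w \<in> V \<Longrightarrow> a v w \<ge> 0"
  using weighted_digraph by (auto simp: weighted_digraph_def)

lemma weight_pos: "(v, w) \<in> edges G \<Longrightarrow> a v w > 0"
  using weighted_digraph edges_verts[of v w] by (auto simp: weighted_digraph_def)

lemma weight_zero:
  assumes "v \<in> V" "w \<in> V" "(v, w) \<notin> edges G" shows "a v w = 0"
proof -
  have "\<not> a v w > 0" using assms weighted_digraph by (auto simp: weighted_digraph_def)
  then show ?thesis using weight_nonneg[OF assms(1,2)] by simp
qed

lemma finite_preds: "v \<in> V \<Longrightarrow> finite {w. (v, w) \<in> edges G}"
  using weighted_digraph by (auto simp: weighted_digraph_def)

lemma finite_succs: "v \<in> V \<Longrightarrow> finite {w. (w, v) \<in> edges G}"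
  using weighted_digraph by (auto simp: weighted_digraph_def)

text \<open>Any finite set containing the relevant neighbours is allowed, so that one common
  \<open>Y\<close> can serve all vertices of a double sum.\<close>

lemma in_deg_eq:
  assumes "x \<in> V" "finite Y" "Y \<subseteq> V" "\<And>y. (x, y) \<in> edges G \<Longrightarrow> y \<in> Y"
  shows "in_deg G x = (\<Sum>y\<in>Y. a x y)"
  unfolding in_deg_def using assms weight_zero by (intro infsum_restrict) auto

lemma out_deg_eq:
  assumes "x \<in> V" "finite Y" "Y \<subseteq> V" "\<And>y. (y, x) \<in> edges G \<Longrightarrow> y \<in> Y"
  shows "out_deg G x = (\<Sum>y\<in>Y. a y x)"
  unfolding out_deg_def using assms weight_zero by (intro infsum_restrict) auto

lemma weight_sum_eq:
  fixes f :: "'v \<Rightarrow> complex"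
  assumes "x \<in> V" "finite Y" "Y \<subseteq> V" "\<And>y. (x, y) \<in> edges G \<Longrightarrow> y \<in> Y"
  shows "(\<Sum>\<^sub>\<infinity>y\<in>V. of_real (a x y) * f y) = (\<Sum>y\<in>Y. of_real (a x y) * f y)"
  using assms weight_zero by (intro infsum_restrict) auto

lemma sum_weight_le_out_deg:
  assumes "x \<in> V" "finite F" "F \<subseteq> V"
  shows "(\<Sum>y\<in>F. a y x) \<le> out_deg G x"
proof -
  have "out_deg G x = (\<Sum>y\<in>F \<union> {w. (w, x) \<in> edges G}. a y x)"
    using assms finite_succs edges_verts by (intro out_deg_eq) auto
  moreover have "(\<Sum>y\<in>F. a y x) \<le> (\<Sum>y\<in>F \<union> {w. (w, x) \<in> edges G}. a y x)"
    using assms finite_succs edges_verts by (intro sum_mono2) (auto intro!: weight_nonneg)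
  ultimately show ?thesis by simp
qed

lemma out_deg_nonneg: "x \<in> V \<Longrightarrow> out_deg G x \<ge> 0"
  using sum_weight_le_out_deg[of x "{}"] by simp

text \<open>Schur test: the bound on in-degrees controls the rows of the weight matrix through
  Cauchy-Schwarz, and the bound on out-degrees controls its columns once the order of summation is
  exchanged. The degree term and the weight term each contribute \<open>2 * K\<^sup>2\<close>,
  whence the factor \<open>2 * K\<close>.\<close>

lemma lap_out_bounded: "ell2_bounded G G (lap_out G)"
proof -
  obtain K where K: "K > 0" "\<And>v. v \<in> V \<Longrightarrow> in_deg G v \<le> K * m v" "\<And>v. v \<in> V \<Longrightarrow> out_deg G v \<le> K * m v"
    using weighted_digraph by (auto simp: weighted_digraph_def)
  have main: "(\<Sum>x\<in>F. (cmod (lap_out G f x))\<^sup>2 * m x) \<le> (2 * K * ell2_norm G f)\<^sup>2"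
    if f: "f \<in> ell2 G" and F: "finite F" "F \<subseteq> V" for f F
  proof -
    define Y where "Y = (\<Union>x\<in>F. {y. (x, y) \<in> edges G})"
    have Y: "finite Y" "Y \<subseteq> V" unfolding Y_def using F finite_preds edges_verts by auto
    have bound: "(cmod (lap_out G f x))\<^sup>2 * m x
        \<le> 2 * K\<^sup>2 * ((cmod (f x))\<^sup>2 * m x) + 2 * K * (\<Sum>y\<in>Y. a x y * (cmod (f y))\<^sup>2)"
      if xF: "x \<in> F" for x
    proof -
      have x: "x \<in> V" using F xF by auto
      have mx: "m x > 0" using mass_pos x by blast
      define s where "s = (\<Sum>y\<in>Y. of_real (a x y) * f y)"
      define d where "d = out_deg G x"
      have s: "(\<Sum>\<^sub>\<infinity>y\<in>V. of_real (a x y) * f y) = s"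
        unfolding s_def using x Y xF by (intro weight_sum_eq) (auto simp: Y_def)
      have inY: "in_deg G x = (\<Sum>y\<in>Y. a x y)"
        using x Y xF by (intro in_deg_eq) (auto simp: Y_def)
      have q: "0 \<le> (\<Sum>y\<in>Y. a x y * (cmod (f y))\<^sup>2)"
        using x Y by (intro sum_nonneg mult_nonneg_nonneg) (auto intro: weight_nonneg)
      have "(cmod s)\<^sup>2 \<le> (\<Sum>y\<in>Y. a x y) * (\<Sum>y\<in>Y. a x y * (cmod (f y))\<^sup>2)"
        unfolding s_def using x Y by (intro cmod_weighted_sum_squared) (auto intro: weight_nonneg)
      also have "\<dots> \<le> (K * m x) * (\<Sum>y\<in>Y. a x y * (cmod (f y))\<^sup>2)"
        using K(2)[OF x] q unfolding inY by (intro mult_right_mono)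
      finally have s2: "(cmod s)\<^sup>2 \<le> (K * m x) * (\<Sum>y\<in>Y. a x y * (cmod (f y))\<^sup>2)" .
      have d: "0 \<le> d" "d \<le> K * m x" using out_deg_nonneg[OF x] K(3)[OF x] by (auto simp: d_def)
      have d2: "(d * cmod (f x))\<^sup>2 \<le> (K * m x * cmod (f x))\<^sup>2"
        using d by (intro power_mono mult_right_mono) auto
      have "cmod (of_real d * f x - s) \<le> d * cmod (f x) + cmod s"
        using norm_triangle_ineq4[of "of_real d * f x" s] d by (simp add: norm_mult)
      then have "(cmod (of_real d * f x - s))\<^sup>2 \<le> (d * cmod (f x) + cmod s)\<^sup>2"
        by (intro power_mono) auto
      also have "\<dots> \<le> 2 * (d * cmod (f x))\<^sup>2 + 2 * (cmod s)\<^sup>2"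
        using sum_squares_bound[of "d * cmod (f x)" "cmod s"] by (simp add: power2_sum)
      also have "\<dots> \<le> 2 * (K * m x * cmod (f x))\<^sup>2
          + 2 * ((K * m x) * (\<Sum>y\<in>Y. a x y * (cmod (f y))\<^sup>2))"
        using d2 s2 by (intro add_mono mult_left_mono) auto
      finally have *: "(cmod (of_real d * f x - s))\<^sup>2 \<le> \<dots>" .
      have "(cmod (lap_out G f x))\<^sup>2 * m x = (cmod (of_real d * f x - s))\<^sup>2 / m x"
        using x mx s by (simp add: lap_out_def d_def norm_mult norm_divide power2_eq_square)
      also have "\<dots> \<le> (2 * (K * m x * cmod (f x))\<^sup>2
          + 2 * ((K * m x) * (\<Sum>y\<in>Y. a x y * (cmod (f y))\<^sup>2))) / m x"
        using * mx by (intro divide_right_mono) auto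
      also have "\<dots> = 2 * K\<^sup>2 * ((cmod (f x))\<^sup>2 * m x) + 2 * K * (\<Sum>y\<in>Y. a x y * (cmod (f y))\<^sup>2)"
        using mx by (simp add: field_simps power2_eq_square)
      finally show ?thesis .
    qed
    have col: "(\<Sum>x\<in>F. a x y) * (cmod (f y))\<^sup>2 \<le> K * ((cmod (f y))\<^sup>2 * m y)" if "y \<in> Y" for y
    proof -
      have "(\<Sum>x\<in>F. a x y) \<le> K * m y"
        using sum_weight_le_out_deg[of y F] K(3)[of y] F Y that by force
      then show ?thesis using mult_right_mono[of "\<Sum>x\<in>F. a x y" "K * m y" "(cmod (f y))\<^sup>2"] by (simp add: mult_ac)
    qed
    have "(\<Sum>x\<in>F. \<Sum>y\<in>Y. a x y * (cmod (f y))\<^sup>2) = (\<Sum>y\<in>Y. (\<Sum>x\<in>F. a x y) * (cmod (f y))\<^sup>2)"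
      by (subst sum.swap) (simp add: sum_distrib_right)
    also have "\<dots> \<le> (\<Sum>y\<in>Y. K * ((cmod (f y))\<^sup>2 * m y))"
      by (intro sum_mono col)
    also have "\<dots> \<le> K * (ell2_norm G f)\<^sup>2"
      using ell2_finite_sum_le[OF nonneg_mass f Y] K(1) by (simp flip: sum_distrib_left)
    finally have second: "(\<Sum>x\<in>F. \<Sum>y\<in>Y. a x y * (cmod (f y))\<^sup>2) \<le> K * (ell2_norm G f)\<^sup>2" .
    have "(\<Sum>x\<in>F. (cmod (lap_out G f x))\<^sup>2 * m x)
        \<le> (\<Sum>x\<in>F. 2 * K\<^sup>2 * ((cmod (f x))\<^sup>2 * m x) + 2 * K * (\<Sum>y\<in>Y. a x y * (cmod (f y))\<^sup>2))"
      by (intro sum_mono bound)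
    also have "\<dots> = 2 * K\<^sup>2 * (\<Sum>x\<in>F. (cmod (f x))\<^sup>2 * m x)
        + 2 * K * (\<Sum>x\<in>F. \<Sum>y\<in>Y. a x y * (cmod (f y))\<^sup>2)"
      by (simp add: sum.distrib sum_distrib_left)
    also have "\<dots> \<le> 2 * K\<^sup>2 * (ell2_norm G f)\<^sup>2 + 2 * K * (K * (ell2_norm G f)\<^sup>2)"
      using ell2_finite_sum_le[OF nonneg_mass f F] second K(1) by (intro add_mono mult_left_mono) auto
    also have "\<dots> = (2 * K * ell2_norm G f)\<^sup>2" by (simp add: power2_eq_square algebra_simps)
    finally show ?thesis .
  qed
  have B: "0 \<le> 2 * K * ell2_norm G f" for f using K(1) ell2_norm_nonneg[OF nonneg_mass] by simp
  have z: "lap_out G f x = 0" if "x \<notin> V" for f x using that by (simp add: lap_out_def)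
  show ?thesis
    using ell2I[OF nonneg_mass z main B] K(1) by (intro ell2_boundedI[of "2 * K"]) auto
qed

end

section \<open>Reaches\<close>

locale cluster_graph = wdigraph G for G :: "'v wgraph" +
  fixes Et :: "('v \<times> 'v) set"
  assumes finite_Et: "finite Et" and Et_edges: "Et \<subseteq> edges G"
begin

abbreviation "W \<equiv> Field Et"
abbreviation "reachables \<equiv> reachable_set V (Et\<inverse>)"
abbreviation "Reaches \<equiv> reaches V (Et\<inverse>)"
abbreviation "exclusive \<equiv> exclusive_part V (Et\<inverse>)"

text \<open>
  In the transposed graph, \<open>j\<close> is reachable from \<open>i\<close> iff \<open>i\<close> is reachable from \<open>j\<close> along \<open>Et\<close>.
  Hence the reaches are the basins of the recurrent classes of the random walk that jumps along
  the edges of \<open>Et\<close>.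
\<close>

definition recurrent :: "'v \<Rightarrow> bool" where
  "recurrent i \<longleftrightarrow> i \<in> V \<and> (\<forall>k. (k, i) \<in> Et\<^sup>* \<longrightarrow> (i, k) \<in> Et\<^sup>*)"

text \<open>The recurrent class that generates the reach \<open>R\<close>: an absorbing class of the
  walk, which will carry the right kernel vector.\<close>

definition roots :: "'v set \<Rightarrow> 'v set" where
  "roots R = {i. recurrent i \<and> reachables i = R}"

lemma finite_W: "finite W"
  using finite_Et by (rule finite_Field)

lemma Et_verts:
  assumes "(x, y) \<in> Et" shows "x \<in> V \<and> y \<in> V"
  using Et_edges assms by (intro edges_verts) blast

lemma W_verts: "W \<subseteq> V"
proof
  fix x assume "x \<in> W"
  then obtain y where "(x, y) \<in> Et \<or> (y, x) \<in> Et" unfolding Field_def by blast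
  then show "x \<in> V" using Et_verts by blast
qed

lemma W_mem:
  assumes "(x, y) \<in> Et" shows "x \<in> W \<and> y \<in> W"
  using FieldI1[OF assms] FieldI2[OF assms] by simp

lemma rtrancl_verts: "(x, y) \<in> Et\<^sup>* \<Longrightarrow> x \<in> V \<longleftrightarrow> y \<in> V"
proof (induction rule: rtrancl_induct)
  case (step y z)
  then show ?case using Et_verts[of y z] by auto
qed simp

lemma rtrancl_W: "(x, y) \<in> Et\<^sup>* \<Longrightarrow> x = y \<or> (x \<in> W \<and> y \<in> W)"
proof (induction rule: rtrancl_induct)
  case (step y z)
  then show ?case using W_mem[of y z] by auto
qed simp

lemma mem_reachables: "i \<in> V \<Longrightarrow> j \<in> reachables i \<longleftrightarrow> (i, j) \<in> Et\<^sup>*"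
  using rtrancl_verts[of i j] by (auto simp: reachable_set_def)

lemma reachables_subset: "reachables i \<subseteq> insert i W"
proof
  fix j assume "j \<in> reachables i"
  then have "(i, j) \<in> Et\<^sup>*" by (auto simp: reachable_set_def)
  then show "j \<in> insert i W" using rtrancl_W[of i j] by auto
qed

lemma finite_reachables: "finite (reachables i)"
  using finite_subset[OF reachables_subset] finite_W by simp

lemma reachables_mono_iff:
  assumes "i \<in> V" "j \<in> V"
  shows "reachables i \<subseteq> reachables j \<longleftrightarrow> (j, i) \<in> Et\<^sup>*"
  using assms by (auto simp: subset_iff mem_reachables)

text \<open>One reachable set contains another iff its generator reaches the generator of the other.
  Maximality of \<open>reachables i\<close> therefore says that whatever reaches \<open>i\<close> is
  reached back from \<open>i\<close>, which is recurrence.\<close>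

lemma Reaches_eq: "Reaches = reachables ` {i. recurrent i}"
proof
  show "Reaches \<subseteq> reachables ` {i. recurrent i}"
  proof
    fix R assume "R \<in> Reaches"
    then obtain i where i: "i \<in> V" "R = reachables i"
      and max: "\<And>j. j \<in> V \<Longrightarrow> R \<subseteq> reachables j \<Longrightarrow> R = reachables j"
      by (auto simp: reaches_def)
    have "recurrent i"
      unfolding recurrent_def
    proof (intro conjI allI impI i(1))
      fix k assume k: "(k, i) \<in> Et\<^sup>*"
      then have kV: "k \<in> V" using i(1) rtrancl_verts by blast
      then have "R \<subseteq> reachables k" using k i by (simp add: reachables_mono_iff)
      then have "R = reachables k" using max kV by blast
      then have "reachables k \<subseteq> reachables i" using i by blast
      then show "(i, k) \<in> Et\<^sup>*" using reachables_mono_iff[OF kV i(1)] by blast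
    qed
    then show "R \<in> reachables ` {i. recurrent i}" using i by blast
  qed
  show "reachables ` {i. recurrent i} \<subseteq> Reaches"
  proof
    fix R assume "R \<in> reachables ` {i. recurrent i}"
    then obtain i where i: "recurrent i" "R = reachables i" by blast
    have iV: "i \<in> V" using i by (simp add: recurrent_def)
    have "R = reachables j" if "j \<in> V" "R \<subseteq> reachables j" for j
      using that i iV reachables_mono_iff[of i j] reachables_mono_iff[of j i]
      by (auto simp: recurrent_def)
    then show "R \<in> Reaches" using i iV by (auto simp: reaches_def)
  qed
qed

section \<open>Root classes and exclusive parts of the reaches\<close>

lemma roots_nonempty:
  assumes "R \<in> Reaches" shows "roots R \<noteq> {}"
proof -
  obtain i where "recurrent i" "R = reachables i" using assms unfolding Reaches_eq by blast
  then have "i \<in> roots R" by (simp add: roots_def)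
  then show ?thesis by blast
qed

lemma finite_reach:
  assumes "R \<in> Reaches" shows "finite R"
proof -
  obtain i where "R = reachables i" using assms unfolding Reaches_eq by blast
  then show ?thesis by (simp add: finite_reachables)
qed

lemma reach_verts:
  assumes "R \<in> Reaches" "x \<in> R" shows "x \<in> V"
proof -
  obtain i where "R = reachables i" using assms unfolding Reaches_eq by blast
  then show ?thesis using assms(2) by (simp add: reachable_set_def)
qed

lemma roots_mem:
  assumes "x \<in> roots R" shows "x \<in> R \<and> x \<in> V"
proof -
  have "x \<in> V" "reachables x = R" using assms by (simp_all add: roots_def recurrent_def)
  then show ?thesis using mem_reachables[of x x] by simp
qed

lemma recurrent_roots:
  assumes "recurrent x" shows "x \<in> roots (reachables x)" "reachables x \<in> Reaches"
proof -
  show "x \<in> roots (reachables x)" using assms by (simp add: roots_def)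
  show "reachables x \<in> Reaches" unfolding Reaches_eq using assms by blast
qed

lemma root_path:
  assumes "r \<in> roots R" "x \<in> R" shows "(r, x) \<in> Et\<^sup>*"
proof -
  have "r \<in> V" "reachables r = R" using assms by (simp_all add: roots_def recurrent_def)
  then show ?thesis using mem_reachables[of r x] assms(2) by simp
qed

lemma reach_closed: "R \<in> Reaches \<Longrightarrow> y \<in> R \<Longrightarrow> (y, x) \<in> Et\<^sup>* \<Longrightarrow> x \<in> R"
proof -
  assume *: "R \<in> Reaches" "y \<in> R" "(y, x) \<in> Et\<^sup>*"
  then obtain i where i: "i \<in> V" "R = reachables i" by (auto simp: Reaches_eq recurrent_def)
  then have "(i, x) \<in> Et\<^sup>*" using * by (simp add: mem_reachables)
  then show ?thesis using i by (simp add: mem_reachables)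
qed

text \<open>The walk moves from \<open>x\<close> to \<open>y\<close> along an edge
  \<open>(y, x)\<close>; it cannot leave a recurrent class, since recurrence supplies a way
  back.\<close>

lemma roots_closed:
  assumes "x \<in> roots R" "(y, x) \<in> Et\<^sup>*" shows "y \<in> roots R"
proof -
  have x: "x \<in> V" "recurrent x" "reachables x = R" using assms by (auto simp: roots_def recurrent_def)
  have y: "y \<in> V" using assms(2) x(1) rtrancl_verts by blast
  have xy: "(x, y) \<in> Et\<^sup>*" using x assms(2) by (auto simp: recurrent_def)
  have "recurrent y"
    using x(2) y xy assms(2) unfolding recurrent_def by (meson rtrancl_trans)
  moreover have "reachables y = reachables x"
    using reachables_mono_iff[OF x(1) y] reachables_mono_iff[OF y x(1)] xy assms(2) by blast
  ultimately show ?thesis using x by (simp add: roots_def)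
qed

text \<open>The generator of \<open>R\<close> reaches \<open>x\<close> and, by recurrence of
  \<open>x\<close>, is reached back, so both generate the same reach. As a consequence the right
  kernel vectors of different reaches have disjoint supports.\<close>

lemma root_unique_reach:
  assumes "x \<in> roots S" "R \<in> Reaches" "x \<in> R" shows "R = S"
proof -
  obtain i where i: "recurrent i" "R = reachables i" using assms(2) by (auto simp: Reaches_eq)
  have iV: "i \<in> V" using i by (simp add: recurrent_def)
  have x: "x \<in> V" "recurrent x" "reachables x = S" using assms by (auto simp: roots_def recurrent_def)
  have "(i, x) \<in> Et\<^sup>*" using assms(3) i iV by (simp add: mem_reachables)
  moreover from this have "(x, i) \<in> Et\<^sup>*" using x by (auto simp: recurrent_def)
  ultimately show ?thesis
    using reachables_mono_iff[OF iV x(1)] reachables_mono_iff[OF x(1) iV] x i by blast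
qed

lemma roots_exclusive:
  assumes "R \<in> Reaches" "x \<in> roots R" shows "x \<in> exclusive R"
proof -
  have "S = R" if "S \<in> Reaches" "x \<in> S" for S using root_unique_reach[OF assms(2) that] .
  then show ?thesis using roots_mem[OF assms(2)] by (simp add: exclusive_part_def)
qed

lemma exclusive_subset: "exclusive R \<subseteq> R"
  by (auto simp: exclusive_part_def)

text \<open>From every vertex the walk can get to an absorbing class: among the finitely many
  vertices ahead of \<open>v\<close>, one with the fewest vertices ahead of it is recurrent.\<close>

lemma ex_recurrent:
  assumes "v \<in> V" shows "\<exists>i. recurrent i \<and> (i, v) \<in> Et\<^sup>*"
proof -
  define fwd where "fwd = (\<lambda>k. {l. (l, k) \<in> Et\<^sup>*})"
  have fin: "finite (fwd k)" for k
  proof (rule finite_subset)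
    show "fwd k \<subseteq> insert k W"
    proof
      fix l assume "l \<in> fwd k"
      then show "l \<in> insert k W" using rtrancl_W[of l k] by (auto simp: fwd_def)
    qed
  qed (simp add: finite_W)
  have "\<exists>k. k \<in> fwd v \<and> (\<forall>l. l \<in> fwd v \<longrightarrow> card (fwd k) \<le> card (fwd l))"
    by (rule ex_has_least_nat[of _ v]) (simp add: fwd_def)
  then obtain k where k: "k \<in> fwd v" and min: "\<And>l. l \<in> fwd v \<Longrightarrow> card (fwd k) \<le> card (fwd l)"
    by blast
  have "recurrent k"
    unfolding recurrent_def
  proof (intro conjI allI impI)
    show "k \<in> V" using k assms rtrancl_verts by (auto simp: fwd_def)
    fix l assume l: "(l, k) \<in> Et\<^sup>*"
    then have sub: "fwd l \<subseteq> fwd k" by (auto simp: fwd_def)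
    have "l \<in> fwd v" using l k by (auto simp: fwd_def)
    then have "fwd l = fwd k" using min sub fin by (intro card_seteq) auto
    then show "(k, l) \<in> Et\<^sup>*" by (auto simp: fwd_def)
  qed
  then show ?thesis using k by (auto simp: fwd_def)
qed

lemma vertex_in_reach: "v \<in> V \<Longrightarrow> \<exists>R\<in>Reaches. v \<in> R"
proof -
  assume "v \<in> V"
  then obtain i where i: "recurrent i" "(i, v) \<in> Et\<^sup>*" using ex_recurrent by metis
  then have "v \<in> reachables i" by (simp add: mem_reachables recurrent_def)
  then show ?thesis using recurrent_roots[OF i(1)] by blast
qed

text \<open>Every reach containing the next position \<open>y\<close> also contains
  \<open>x\<close>, so a step of the walk from an exclusive vertex leads to an exclusive
  vertex.\<close>

lemma exclusive_closed:
  assumes "R \<in> Reaches" "x \<in> exclusive R" "(y, x) \<in> Et" shows "y \<in> exclusive R"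
proof -
  have *: "S = R" if "S \<in> Reaches" "y \<in> S" for S
  proof -
    have "x \<in> S" using reach_closed[OF that] assms(3) by blast
    then show ?thesis using that assms(2) by (simp add: exclusive_part_def)
  qed
  have "y \<in> V" using Et_verts assms(3) by blast
  then obtain S where S: "S \<in> Reaches" "y \<in> S" using vertex_in_reach by metis
  then have "y \<in> R" using * by metis
  then show ?thesis using * unfolding exclusive_part_def by blast
qed

section \<open>Reaches inside the clusters and singleton reaches off the clusters\<close>

lemma outside_W_reach:
  assumes "R \<in> Reaches" "x \<in> R" "x \<notin> W" shows "R = {x}"
proof -
  obtain i where i: "recurrent i" "R = reachables i" using assms(1) by (auto simp: Reaches_eq)
  have iV: "i \<in> V" using i by (simp add: recurrent_def)
  have "i = x" using assms i iV rtrancl_W by (auto simp: mem_reachables)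
  then have "y = x" if "y \<in> R" for y
    using that i iV assms(3) rtrancl_W[of x y] by (auto simp: mem_reachables)
  then show ?thesis using assms by blast
qed

lemma reach_cases:
  assumes "R \<in> Reaches"
  shows "R \<subseteq> W \<or> (\<exists>x. x \<in> V \<and> x \<notin> W \<and> R = {x})"
proof (cases "R \<subseteq> W")
  case False
  then obtain x where x: "x \<in> R" "x \<notin> W" by blast
  then show ?thesis using outside_W_reach[OF assms x] reach_verts[OF assms x(1)] by metis
qed simp

lemma finite_inner_reaches: "finite {R \<in> Reaches. R \<subseteq> W}"
  using finite_subset[of "{R \<in> Reaches. R \<subseteq> W}" "Pow W"] finite_W by auto

lemma reach_meeting_W:
  assumes "R \<in> Reaches" "x \<in> R" "x \<in> W" shows "R \<subseteq> W"
proof (rule ccontr)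
  assume "\<not> R \<subseteq> W"
  then obtain y where "y \<in> V" "y \<notin> W" "R = {y}" using reach_cases[OF assms(1)] by blast
  then show False using assms by simp
qed

lemma reaches_at_subset: "x \<in> V \<Longrightarrow> {R \<in> Reaches. x \<in> R} \<subseteq> insert {x} {R \<in> Reaches. R \<subseteq> W}"
proof
  fix R assume R: "R \<in> {R \<in> Reaches. x \<in> R}"
  then show "R \<in> insert {x} {R \<in> Reaches. R \<subseteq> W}"
    using outside_W_reach[of R x] reach_meeting_W[of R x] by (cases "x \<in> W") auto
qed

lemma finite_reaches_at: "finite {R \<in> Reaches. x \<in> R}"
proof (cases "x \<in> V")
  case True
  then show ?thesis using finite_subset[OF reaches_at_subset] finite_inner_reaches by simp
next
  case False
  then have empty: "{R \<in> Reaches. x \<in> R} = {}" using reach_verts[of _ x] by auto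
  show ?thesis unfolding empty by simp
qed

section \<open>The maximum principle\<close>

text \<open>Up to the mass at \<open>x\<close>, \<open>cw y x\<close> is the rate of the jump from
  \<open>x\<close> to \<open>y\<close>. Rates vanish off \<open>Et\<close>, so sums over neighbours
  may range over the fixed finite set \<open>W\<close>.\<close>

definition cw :: "'v \<Rightarrow> 'v \<Rightarrow> real" where
  "cw x y = (if (x, y) \<in> Et then a x y else 0)"

lemma cw_nonneg: "cw x y \<ge> 0"
  using Et_verts weight_nonneg by (simp add: cw_def)

lemma cw_pos: "(x, y) \<in> Et \<Longrightarrow> cw x y > 0"
  using Et_edges weight_pos by (auto simp: cw_def)

lemma cw_zero: "(x, y) \<notin> Et \<Longrightarrow> cw x y = 0"
  by (simp add: cw_def)

text \<open>At a point of \<open>Z\<close> the value of \<open>g\<close> is at most a weighted mean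
  of the values one step ahead. A positive maximum hence propagates along the walk until it leaves
  \<open>Z\<close>, where \<open>g\<close> is not positive.\<close>

lemma max_principle:
  fixes g :: "'v \<Rightarrow> real"
  assumes Z: "finite Z"
    and sub: "\<And>x. x \<in> Z \<Longrightarrow> (\<Sum>y\<in>W. cw y x * (g x - g y)) \<le> 0"
    and exit: "\<And>x. x \<in> Z \<Longrightarrow> \<exists>y. y \<notin> Z \<and> (y, x) \<in> Et\<^sup>*"
    and out: "\<And>x. x \<notin> Z \<Longrightarrow> g x \<le> 0"
  shows "g x \<le> 0"
proof (rule ccontr)
  assume "\<not> g x \<le> 0"
  then have pos: "g x > 0" and xZ: "x \<in> Z" using out by force+
  define M where "M = Max (g ` Z)"
  have ZM: "g y \<le> M" if "y \<in> Z" for y unfolding M_def using Z that by simp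
  then have M: "M > 0" using pos xZ by force
  have le: "g y \<le> M" for y using ZM[of y] out[of y] M by (cases "y \<in> Z") auto
  have "M \<in> g ` Z" unfolding M_def using Z xZ by (intro Max_in) auto
  then obtain v where v: "v \<in> Z" "g v = M" by auto
  have *: "g y = M" if "(y, v) \<in> Et\<^sup>*" for y
    using that
  proof (induction rule: converse_rtrancl_induct)
    case base
    then show ?case using v by simp
  next
    case (step y u)
    have u: "u \<in> Z" using step.IH M out[of u] by force
    \<comment> \<open>At a maximum all terms are nonnegative while their sum is not positive, so
      each single term vanishes.\<close>
    have t: "0 \<le> cw w u * (g u - g w)" for w
      using cw_nonneg[of w u] le[of w] step.IH by simp
    have "cw y u * (g u - g y) \<le> (\<Sum>w\<in>W. cw w u * (g u - g w))"
      using t finite_W W_mem[OF step.hyps(1)] by (intro member_le_sum) auto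
    then have "cw y u * (g u - g y) \<le> 0" using sub[OF u] by linarith
    then have "g u - g y \<le> 0" using cw_pos[OF step.hyps(1)] by (simp add: mult_le_0_iff)
    then show ?case using step.IH le[of y] by simp
  qed
  obtain y where "y \<notin> Z" "(y, v) \<in> Et\<^sup>*" using exit v by blast
  then show False using * out M by fastforce
qed

lemma harmonic_zero:
  fixes g :: "'v \<Rightarrow> real"
  assumes Z: "finite Z"
    and harm: "\<And>x. x \<in> Z \<Longrightarrow> (\<Sum>y\<in>W. cw y x * (g x - g y)) = 0"
    and exit: "\<And>x. x \<in> Z \<Longrightarrow> \<exists>y. y \<notin> Z \<and> (y, x) \<in> Et\<^sup>*"
    and out: "\<And>x. x \<notin> Z \<Longrightarrow> g x = 0"
  shows "g x = 0"
proof (rule antisym)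
  show "g x \<le> 0" by (rule max_principle[where g = g, OF Z _ exit]) (simp_all add: harm out)
  have "(\<Sum>y\<in>W. cw y x * (- g x - - g y)) = - (\<Sum>y\<in>W. cw y x * (g x - g y))" for x
    by (simp add: sum_negf[symmetric] algebra_simps)
  note neg = this
  have "- g x \<le> 0"
  proof (rule max_principle[where g = "\<lambda>x. - g x", OF Z _ exit])
    show "(\<Sum>y\<in>W. cw y x * (- g x - - g y)) \<le> 0" if "x \<in> Z" for x
      unfolding neg using harm[OF that] by simp
  qed (simp_all add: out)
  then show "0 \<le> g x" by simp
qed

lemma harmonic_zero_complex:
  fixes f :: "'v \<Rightarrow> complex"
  assumes Z: "finite Z"
    and harm: "\<And>x. x \<in> Z \<Longrightarrow> (\<Sum>y\<in>W. of_real (cw y x) * (f x - f y)) = 0"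
    and exit: "\<And>x. x \<in> Z \<Longrightarrow> \<exists>y. y \<notin> Z \<and> (y, x) \<in> Et\<^sup>*"
    and out: "\<And>x. x \<notin> Z \<Longrightarrow> f x = 0"
  shows "f x = 0"
proof (rule complex_eqI)
  have "(\<Sum>y\<in>W. cw y x * (Re (f x) - Re (f y))) = Re (\<Sum>y\<in>W. of_real (cw y x) * (f x - f y))" for x
    by simp
  note part = this
  have "Re (f x) = 0"
  proof (rule harmonic_zero[where g = "\<lambda>x. Re (f x)", OF Z _ exit])
    show "(\<Sum>y\<in>W. cw y x * (Re (f x) - Re (f y))) = 0" if "x \<in> Z" for x
      unfolding part harm[OF that] by simp
  qed (simp_all add: out)
  then show "Re (f x) = Re 0" by simp
  have "(\<Sum>y\<in>W. cw y x * (Im (f x) - Im (f y))) = Im (\<Sum>y\<in>W. of_real (cw y x) * (f x - f y))" for x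
    by simp
  note part = this
  have "Im (f x) = 0"
  proof (rule harmonic_zero[where g = "\<lambda>x. Im (f x)", OF Z _ exit])
    show "(\<Sum>y\<in>W. cw y x * (Im (f x) - Im (f y))) = 0" if "x \<in> Z" for x
      unfolding part harm[OF that] by simp
  qed (simp_all add: out)
  then show "Im (f x) = Im 0" by simp
qed

section \<open>The left kernel vectors\<close>

text \<open>Up to the factor \<open>1 / m x\<close> this is the in-degree Laplacian of the
  transposed cluster graph. By \<open>T_pairing\<close> it is also the transpose of the cluster
  Laplacian, in the bilinear pairing weighted with the masses.\<close>

definition harmonic_sum :: "('v \<Rightarrow> complex) \<Rightarrow> 'v \<Rightarrow> complex" where
  "harmonic_sum f x = (\<Sum>y\<in>W. of_real (cw y x) * (f x - f y))"

lemma cw_infsum_left: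
  fixes g :: "'v \<Rightarrow> 'b :: {real_normed_algebra_1}"
  shows "(\<Sum>\<^sub>\<infinity>y\<in>V. of_real (cw y x) * g y) = (\<Sum>y\<in>W. of_real (cw y x) * g y)"
  using finite_W W_verts W_mem by (intro infsum_restrict) (auto simp: cw_def)

lemma cw_infsum_right:
  fixes g :: "'v \<Rightarrow> 'b :: {real_normed_algebra_1}"
  shows "(\<Sum>\<^sub>\<infinity>y\<in>V. of_real (cw x y) * g y) = (\<Sum>y\<in>W. of_real (cw x y) * g y)"
  using finite_W W_verts W_mem by (intro infsum_restrict) (auto simp: cw_def)

lemma lap_in_transpose:
  "lap_in (transpose_graph (restrict_graph G Et)) f x
     = (if x \<in> V then 1 / of_real (m x) * harmonic_sum f x else 0)"
proof -
  have "in_deg (transpose_graph (restrict_graph G Et)) x = (\<Sum>\<^sub>\<infinity>i\<in>V. of_real (cw i x) * 1)"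
    by (simp add: in_deg_def transpose_graph_def restrict_graph_def cw_def)
  also have "\<dots> = (\<Sum>i\<in>W. cw i x)" unfolding cw_infsum_left by simp
  finally have d: "in_deg (transpose_graph (restrict_graph G Et)) x = (\<Sum>i\<in>W. cw i x)" .
  have "(\<Sum>\<^sub>\<infinity>y\<in>V. of_real (if (y, x) \<in> Et then a y x else 0) * f y)
      = (\<Sum>\<^sub>\<infinity>y\<in>V. of_real (cw y x) * f y)" by (simp add: cw_def)
  also have "\<dots> = (\<Sum>y\<in>W. of_real (cw y x) * f y)" by (rule cw_infsum_left)
  finally have s: "(\<Sum>\<^sub>\<infinity>y\<in>V. of_real (if (y, x) \<in> Et then a y x else 0) * f y)
      = (\<Sum>y\<in>W. of_real (cw y x) * f y)" .
  show ?thesis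
    unfolding lap_in_def d
    by (simp add: transpose_graph_def restrict_graph_def s harmonic_sum_def
        sum_subtractf right_diff_distrib sum_distrib_right)
qed

abbreviation "common R \<equiv> R - exclusive R"

lemma common_W: assumes "R \<in> Reaches" shows "common R \<subseteq> W"
proof
  fix x assume x: "x \<in> common R"
  show "x \<in> W"
  proof (rule ccontr)
    assume "x \<notin> W"
    then have "S = {x}" if "S \<in> Reaches" "x \<in> S" for S using that outside_W_reach by blast
    then show False using x assms by (auto simp: exclusive_part_def)
  qed
qed

lemma common_exit:
  assumes "R \<in> Reaches" "x \<in> common R" shows "\<exists>y. y \<notin> common R \<and> (y, x) \<in> Et\<^sup>*"
proof -
  obtain r where r: "r \<in> roots R" using roots_nonempty[OF assms(1)] by blast
  then have "(r, x) \<in> Et\<^sup>*" using root_path assms by blast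
  moreover have "r \<notin> common R" using roots_exclusive r assms by blast
  ultimately show ?thesis by blast
qed

text \<open>A Dirichlet problem on the common part with boundary values 1 on the exclusive part and
  0 outside \<open>R\<close>; the boundary data go to the right-hand side, and uniqueness from the
  maximum principle gives existence. At exclusive vertices and outside \<open>R\<close> the equation
  holds term by term, because the walk stays where the function is constant.\<close>

lemma ex_left_kernel:
  assumes R: "R \<in> Reaches"
  shows "\<exists>f. (\<forall>x. harmonic_sum f x = 0) \<and> (\<forall>x\<in>exclusive R. f x = 1) \<and> (\<forall>x. x \<notin> R \<longrightarrow> f x = 0)"
proof -
  define Z where "Z = common R"
  have Z: "finite Z" "Z \<subseteq> W" using common_W[OF R] finite_W finite_subset by (auto simp: Z_def)
  define ch where "ch = char_fun (exclusive R)"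
  define U where "U = (\<lambda>f x. if x \<in> Z then harmonic_sum f x else 0)"
  have "bij_betw U (supp_funs Z) (supp_funs Z)"
  proof (rule lin_inj_bij[OF Z(1)])
    show "lin_on (supp_funs Z) U"
      unfolding lin_on_def U_def harmonic_sum_def
      by (auto simp: fun_eq_iff sum_distrib_left sum.distrib[symmetric] algebra_simps intro!: sum.cong)
    show "U f \<in> supp_funs Z" for f by (simp add: U_def supp_funs_def)
    fix f assume f: "f \<in> supp_funs Z" "U f = (\<lambda>x. 0)"
    have "f x = 0" for x
    proof (rule harmonic_zero_complex[where f = f, OF Z(1)])
      fix x assume "x \<in> Z"
      then show "(\<Sum>y\<in>W. of_real (cw y x) * (f x - f y)) = 0"
        using fun_cong[OF f(2), of x] by (simp add: U_def harmonic_sum_def)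
      show "\<exists>y. y \<notin> Z \<and> (y, x) \<in> Et\<^sup>*" using \<open>x \<in> Z\<close> common_exit[OF R] by (simp add: Z_def)
    qed (use f in \<open>auto simp: supp_funs_def\<close>)
    then show "f = (\<lambda>x. 0)" ..
  qed
  moreover have "(\<lambda>x. if x \<in> Z then \<Sum>y\<in>W. of_real (cw y x) * ch y else 0) \<in> supp_funs Z"
    by (simp add: supp_funs_def)
  ultimately obtain f where f: "f \<in> supp_funs Z"
    "U f = (\<lambda>x. if x \<in> Z then \<Sum>y\<in>W. of_real (cw y x) * ch y else 0)"
    unfolding bij_betw_def by (metis (no_types, lifting) imageE)
  define h where "h = (\<lambda>x. f x + ch x)"
  have one: "h x = 1" if "x \<in> exclusive R" for x
    using that f(1) by (auto simp: h_def ch_def char_fun_def supp_funs_def Z_def)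
  have zero: "h x = 0" if "x \<notin> R" for x
    using that f(1) exclusive_subset by (auto simp: h_def ch_def char_fun_def supp_funs_def Z_def)
  have "harmonic_sum h x = 0" for x
  proof -
    consider "x \<in> Z" | "x \<in> exclusive R" | "x \<notin> R" by (auto simp: Z_def)
    then show ?thesis
    proof cases
      case 1
      then have "ch x = 0" by (simp add: ch_def char_fun_def Z_def)
      then have "harmonic_sum h x = harmonic_sum f x - (\<Sum>y\<in>W. of_real (cw y x) * ch y)"
        by (simp add: harmonic_sum_def h_def sum_subtractf[symmetric] algebra_simps)
      also have "\<dots> = 0" using fun_cong[OF f(2), of x] 1 by (simp add: U_def)
      finally show ?thesis .
    next
      case 2
      have "of_real (cw y x) * (h x - h y) = 0" for y
        using 2 exclusive_closed[OF R 2, of y] one[of x] one[of y] by (cases "(y, x) \<in> Et") (auto simp: cw_zero)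
      then show ?thesis by (simp only: harmonic_sum_def sum.neutral_const)
    next
      case 3
      have "of_real (cw y x) * (h x - h y) = 0" for y
        using 3 reach_closed[OF R, of y x] zero[of x] zero[of y] by (cases "(y, x) \<in> Et") (auto simp: cw_zero)
      then show ?thesis by (simp only: harmonic_sum_def sum.neutral_const)
    qed
  qed
  then show ?thesis using one zero by blast
qed

lemma left_kernel_unique:
  assumes R: "R \<in> Reaches"
    and f: "\<And>x. x \<in> V \<Longrightarrow> harmonic_sum f x = 0" "\<And>x. x \<in> exclusive R \<Longrightarrow> f x = 1" "\<And>x. x \<notin> R \<Longrightarrow> f x = 0"
    and g: "\<And>x. x \<in> V \<Longrightarrow> harmonic_sum g x = 0" "\<And>x. x \<in> exclusive R \<Longrightarrow> g x = 1" "\<And>x. x \<notin> R \<Longrightarrow> g x = 0"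
  shows "f = g"
proof
  fix x
  have "f x - g x = 0"
  proof (rule harmonic_zero_complex[where f = "\<lambda>x. f x - g x" and Z = "common R"])
    show "finite (common R)" using finite_reach[OF R] by simp
    fix x assume x: "x \<in> common R"
    have "(\<Sum>y\<in>W. of_real (cw y x) * ((f x - g x) - (f y - g y))) = harmonic_sum f x - harmonic_sum g x"
      by (simp add: harmonic_sum_def sum_subtractf[symmetric] algebra_simps)
    also have "\<dots> = 0" using f(1) g(1) reach_verts[OF R] x by simp
    finally show "(\<Sum>y\<in>W. of_real (cw y x) * ((f x - g x) - (f y - g y))) = 0" .
    show "\<exists>y. y \<notin> common R \<and> (y, x) \<in> Et\<^sup>*" using common_exit[OF R x] .
  next
    fix x assume "x \<notin> common R"
    then show "f x - g x = 0" using f(2,3) g(2,3) by (cases "x \<in> exclusive R") auto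
  qed
  then show "f x = g x" by simp
qed

lemma gamma_left_spec:
  assumes R: "R \<in> Reaches"
  shows "\<And>x. harmonic_sum (gamma_left G Et R) x = 0"
    and "\<And>x. x \<in> exclusive R \<Longrightarrow> gamma_left G Et R x = 1"
    and "\<And>x. x \<notin> R \<Longrightarrow> gamma_left G Et R x = 0"
proof -
  obtain f where f: "\<And>x. harmonic_sum f x = 0" "\<And>x. x \<in> exclusive R \<Longrightarrow> f x = 1" "\<And>x. x \<notin> R \<Longrightarrow> f x = 0"
    using ex_left_kernel[OF R] by blast
  have "gamma_left G Et R = f"
    unfolding gamma_left_def
  proof (rule the_equality)
    have "f \<in> ell2 G"
      using finite_reach[OF R] reach_verts[OF R] f(3)
      by (intro supp_funs_ell2[of R]) (auto simp: supp_funs_def)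
    then show "f \<in> ell2 G \<and> lap_in (transpose_graph (restrict_graph G Et)) f = (\<lambda>x. 0) \<and>
      (\<forall>v\<in>exclusive R. f v = 1) \<and> (\<forall>v. v \<notin> R \<longrightarrow> f v = 0)"
      using f by (auto simp: lap_in_transpose)
    fix g assume g: "g \<in> ell2 G \<and> lap_in (transpose_graph (restrict_graph G Et)) g = (\<lambda>x. 0) \<and>
      (\<forall>v\<in>exclusive R. g v = 1) \<and> (\<forall>v. v \<notin> R \<longrightarrow> g v = 0)"
    have "harmonic_sum g x = 0" if "x \<in> V" for x
    proof -
      have "lap_in (transpose_graph (restrict_graph G Et)) g x = 0" using g by simp
      then show ?thesis using that mass_pos[OF that] by (simp add: lap_in_transpose)
    qed
    moreover have "\<And>x. x \<in> exclusive R \<Longrightarrow> g x = 1" "\<And>x. x \<notin> R \<Longrightarrow> g x = 0" using g by blast+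
    ultimately show "g = f" using left_kernel_unique[OF R, of g f] f by blast
  qed
  then show "\<And>x. harmonic_sum (gamma_left G Et R) x = 0"
    and "\<And>x. x \<in> exclusive R \<Longrightarrow> gamma_left G Et R x = 1"
    and "\<And>x. x \<notin> R \<Longrightarrow> gamma_left G Et R x = 0" using f by auto
qed

text \<open>By \<open>gamma_left_real\<close> the real part loses nothing; order arguments and
  Cauchy-Schwarz need real weights.\<close>

definition lf :: "'v set \<Rightarrow> 'v \<Rightarrow> real" where
  "lf R x = Re (gamma_left G Et R x)"

lemma lf_harmonic:
  assumes "R \<in> Reaches" shows "(\<Sum>y\<in>W. cw y x * (lf R x - lf R y)) = 0"
proof -
  have "(\<Sum>y\<in>W. cw y x * (lf R x - lf R y)) = Re (harmonic_sum (gamma_left G Et R) x)"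
    by (simp add: lf_def harmonic_sum_def)
  then show ?thesis using gamma_left_spec(1)[OF assms] by simp
qed

lemma lf_exclusive: "R \<in> Reaches \<Longrightarrow> x \<in> exclusive R \<Longrightarrow> lf R x = 1"
  by (simp add: lf_def gamma_left_spec)

lemma lf_outside: "R \<in> Reaches \<Longrightarrow> x \<notin> R \<Longrightarrow> lf R x = 0"
  by (simp add: lf_def gamma_left_spec)

lemma gamma_left_real:
  assumes R: "R \<in> Reaches" shows "gamma_left G Et R x = of_real (lf R x)"
proof -
  have "Im (gamma_left G Et R x) = 0"
  proof (rule harmonic_zero[where g = "\<lambda>x. Im (gamma_left G Et R x)" and Z = "common R"])
    show "finite (common R)" using finite_reach[OF R] by simp
    fix x
    have "(\<Sum>y\<in>W. cw y x * (Im (gamma_left G Et R x) - Im (gamma_left G Et R y)))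
        = Im (harmonic_sum (gamma_left G Et R) x)"
      by (simp add: harmonic_sum_def)
    then show "(\<Sum>y\<in>W. cw y x * (Im (gamma_left G Et R x) - Im (gamma_left G Et R y))) = 0"
      using gamma_left_spec(1)[OF R] by simp
    show "\<exists>y. y \<notin> common R \<and> (y, x) \<in> Et\<^sup>*" if "x \<in> common R" using common_exit[OF R that] .
    show "Im (gamma_left G Et R x) = 0" if "x \<notin> common R"
      using that gamma_left_spec(2,3)[OF R, of x] by (cases "x \<in> exclusive R") auto
  qed
  then show ?thesis by (simp add: lf_def complex_eq_iff)
qed

lemma lf_nonneg:
  assumes R: "R \<in> Reaches" shows "lf R x \<ge> 0"
proof -
  have "- lf R x \<le> 0"
  proof (rule max_principle[where g = "\<lambda>x. - lf R x" and Z = "common R"])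
    show "finite (common R)" using finite_reach[OF R] by simp
    fix x
    have "(\<Sum>y\<in>W. cw y x * (- lf R x - - lf R y)) = - (\<Sum>y\<in>W. cw y x * (lf R x - lf R y))"
      by (simp add: sum_negf[symmetric] algebra_simps)
    then show "(\<Sum>y\<in>W. cw y x * (- lf R x - - lf R y)) \<le> 0" using lf_harmonic[OF R] by simp
    show "\<exists>y. y \<notin> common R \<and> (y, x) \<in> Et\<^sup>*" if "x \<in> common R" using common_exit[OF R that] .
    show "- lf R x \<le> 0" if "x \<notin> common R"
      using that lf_exclusive[OF R, of x] lf_outside[OF R, of x] by (cases "x \<in> exclusive R") auto
  qed
  then show ?thesis by simp
qed

text \<open>Absorption is certain: the defect \<open>1 - sum\<close> is harmonic on the union of all
  common parts and vanishes elsewhere, hence it is zero.\<close>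

lemma lf_sum:
  assumes x: "x \<in> V" shows "(\<Sum>R\<in>{R\<in>Reaches. x \<in> R}. lf R x) = 1"
proof -
  have excl: "(\<Sum>S\<in>{S\<in>Reaches. x \<in> S}. lf S x) = 1" if "R \<in> Reaches" "x \<in> exclusive R" for R x
  proof -
    have "{S \<in> Reaches. x \<in> S} = {R}" using that unfolding exclusive_part_def by blast
    then show ?thesis using lf_exclusive[OF that] by simp
  qed
  define F where "F = {R \<in> Reaches. R \<subseteq> W}"
  define Z where "Z = (\<Union>R\<in>Reaches. common R)"
  have Z: "Z \<subseteq> W" using common_W by (auto simp: Z_def)
  have FW: "(\<Sum>R\<in>{R\<in>Reaches. x \<in> R}. lf R x) = (\<Sum>R\<in>F. lf R x)" if "x \<in> W" for x
    unfolding F_def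
  proof (rule sum.mono_neutral_left[OF finite_inner_reaches])
    show "{R \<in> Reaches. x \<in> R} \<subseteq> {R \<in> Reaches. R \<subseteq> W}" using that reach_meeting_W by blast
    show "\<forall>R\<in>{R \<in> Reaches. R \<subseteq> W} - {R \<in> Reaches. x \<in> R}. lf R x = 0" using lf_outside by blast
  qed
  have notZ: "(\<Sum>R\<in>{R\<in>Reaches. x \<in> R}. lf R x) = 1" if xZ: "x \<notin> Z" and xV: "x \<in> V" for x
  proof -
    obtain R where "R \<in> Reaches" "x \<in> R" using vertex_in_reach[OF xV] by blast
    then have "x \<in> exclusive R" using xZ unfolding Z_def by blast
    then show ?thesis using excl \<open>R \<in> Reaches\<close> by blast
  qed
  \<comment> \<open>The family \<open>F\<close> contains only the reaches inside \<open>W\<close>,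
    so off \<open>W\<close> the expression \<open>1 - sum\<close> would be 1; the case distinction
    restores the value 0 of the defect.\<close>
  define h where "h = (\<lambda>x. if x \<in> Z then 1 - (\<Sum>R\<in>F. lf R x) else 0)"
  have h: "h x = 1 - (\<Sum>R\<in>F. lf R x)" if "x \<in> W" for x
  proof -
    have "x \<in> V" using that W_verts by blast
    then show ?thesis using notZ[of x] FW[OF that] by (simp add: h_def)
  qed
  have h0: "h x = 0" for x
  proof (rule harmonic_zero[where Z = Z])
    show "finite Z" using Z finite_W finite_subset by blast
    fix x assume xZ: "x \<in> Z"
    have "(\<Sum>y\<in>W. cw y x * (h x - h y)) = (\<Sum>y\<in>W. \<Sum>R\<in>F. - (cw y x * (lf R x - lf R y)))"
    proof (rule sum.cong[OF refl])
      fix y assume y: "y \<in> W"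
      have "x \<in> W" using xZ Z by blast
      then have "h x - h y = (\<Sum>R\<in>F. - (lf R x - lf R y))"
        using y by (simp add: h sum_subtractf)
      then show "cw y x * (h x - h y) = (\<Sum>R\<in>F. - (cw y x * (lf R x - lf R y)))"
        by (simp only: sum_distrib_left) (simp add: algebra_simps)
    qed
    also have "\<dots> = (\<Sum>R\<in>F. - (\<Sum>y\<in>W. cw y x * (lf R x - lf R y)))"
      by (subst sum.swap) (simp only: sum_negf)
    also have "\<dots> = 0" using lf_harmonic unfolding F_def by simp
    finally show "(\<Sum>y\<in>W. cw y x * (h x - h y)) = 0" .
    have "x \<in> V" using xZ Z W_verts by blast
    then obtain r where r: "recurrent r" "(r, x) \<in> Et\<^sup>*" using ex_recurrent[of x] by blast
    have "r \<notin> Z"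
    proof
      assume "r \<in> Z"
      then obtain R where R: "R \<in> Reaches" "r \<in> R" "r \<notin> exclusive R" unfolding Z_def by blast
      have rr: "r \<in> roots (reachables r)" using recurrent_roots[OF r(1)] by blast
      then have "R = reachables r" using root_unique_reach[OF _ R(1,2)] by blast
      then show False using roots_exclusive[OF R(1)] rr R(3) by blast
    qed
    then show "\<exists>y. y \<notin> Z \<and> (y, x) \<in> Et\<^sup>*" using r by blast
  qed (simp add: h_def)
  show ?thesis
  proof (cases "x \<in> Z")
    case True
    then have "x \<in> W" using Z by blast
    then show ?thesis using h0[of x] h[of x] FW[of x] by simp
  next
    case False
    then show ?thesis using notZ x by blast
  qed
qed

end

section \<open>Spanning trees and the right kernel vectors\<close>

lemma spanning_out_treesD:
  assumes "\<tau> \<in> spanning_out_trees E R i"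
  shows "\<tau> \<subseteq> E" "\<tau> \<subseteq> R \<times> R" "i \<in> R" "\<And>x. (i, x) \<notin> \<tau>"
    "\<And>v. v \<in> R \<Longrightarrow> v \<noteq> i \<Longrightarrow> \<exists>!x. (v, x) \<in> \<tau>" "\<And>v. v \<in> R \<Longrightarrow> (v, i) \<in> \<tau>\<^sup>*"
  using assms by (auto simp: spanning_out_trees_def rtrancl_converse)

lemma spanning_out_treesI:
  assumes "\<tau> \<subseteq> E" "\<tau> \<subseteq> R \<times> R" "i \<in> R" "\<And>x. (i, x) \<notin> \<tau>"
    "\<And>v. v \<in> R \<Longrightarrow> v \<noteq> i \<Longrightarrow> \<exists>!x. (v, x) \<in> \<tau>" "\<And>v. v \<in> R \<Longrightarrow> (v, i) \<in> \<tau>\<^sup>*"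
  shows "\<tau> \<in> spanning_out_trees E R i"
  using assms by (auto simp: spanning_out_trees_def rtrancl_converse)

text \<open>
  Read along the converse edges, a tree rooted at \<open>i\<close> assigns to every other vertex a successor
  closer to \<open>i\<close>. Adding an edge \<open>(i, x)\<close> closes exactly one cycle; removing its last edge
  \<open>(k, i)\<close> instead yields a tree rooted at \<open>k\<close>.
\<close>

lemma spanning_out_trees_rotate:
  assumes \<tau>: "\<tau> \<in> spanning_out_trees E R i" and x: "x \<in> R" "x \<noteq> i" "(i, x) \<in> E"
    and k: "(k, i) \<in> \<tau>" "(x, k) \<in> \<tau>\<^sup>*"
  shows "insert (i, x) \<tau> - {(k, i)} \<in> spanning_out_trees E R k"
proof -
  note t = spanning_out_treesD[OF \<tau>]
  let ?s = "insert (i, x) \<tau> - {(k, i)}"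
  have ki: "k \<noteq> i" using k(1) t(4) by blast
  have kR: "k \<in> R" using k(1) t(2) by blast
  have step: "(v, w) \<in> ?s" if "(v, w) \<in> \<tau>" "v \<noteq> k" for v w using that by blast
  have toK: "(v, k) \<in> ?s\<^sup>*" if "(v, k) \<in> \<tau>\<^sup>*" for v
    using that
  proof (induction rule: converse_rtrancl_induct)
    case (step v w)
    then show ?case
      using converse_rtrancl_into_rtrancl[of v w ?s k] by (cases "v = k") auto
  qed simp
  have ik: "(i, k) \<in> ?s\<^sup>*"
    using toK[OF k(2)] ki converse_rtrancl_into_rtrancl[of i x ?s k] by blast
  have viaI: "(v, k) \<in> ?s\<^sup>*" if "(v, i) \<in> \<tau>\<^sup>*" for v
    using that
  proof (induction rule: converse_rtrancl_induct)
    case base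
    then show ?case by (rule ik)
  next
    case (step v w)
    then show ?case
      using converse_rtrancl_into_rtrancl[of v w ?s k] by (cases "v = k") auto
  qed
  have uni: "(k, w) \<in> \<tau> \<Longrightarrow> w = i" for w using t(5)[OF kR ki] k(1) by blast
  show ?thesis
  proof (rule spanning_out_treesI)
    show "?s \<subseteq> E" using t(1) x(3) by blast
    show "?s \<subseteq> R \<times> R" using t(2,3) x(1) by blast
    show "k \<in> R" by (rule kR)
    show "(k, w) \<notin> ?s" for w using uni[of w] ki by blast
    show "\<exists>!w. (v, w) \<in> ?s" if vR: "v \<in> R" and vk: "v \<noteq> k" for v
    proof (cases "v = i")
      case True
      then show ?thesis using t(4) ki by blast
    next
      case False
      then obtain w where w: "(v, w) \<in> \<tau>" "\<And>u. (v, u) \<in> \<tau> \<Longrightarrow> u = w"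
        using t(5)[OF vR False] by blast
      show ?thesis
      proof (rule ex1I[of _ w])
        show "(v, w) \<in> ?s" using w(1) vk by simp
        show "u = w" if "(v, u) \<in> ?s" for u using that w(2)[of u] False by simp
      qed
    qed
    show "(v, k) \<in> ?s\<^sup>*" if "v \<in> R" for v using viaI[OF t(6)[OF that]] .
  qed
qed

section \<open>Balance of weighted tree counts under a change of root\<close>

definition tree_sum :: "('v \<times> 'v) set \<Rightarrow> ('v \<Rightarrow> 'v \<Rightarrow> real) \<Rightarrow> 'v set \<Rightarrow> 'v \<Rightarrow> real" where
  "tree_sum E c R i = (\<Sum>\<tau>\<in>spanning_out_trees E R i. \<Prod>(x, y)\<in>\<tau>. c x y)"

lemma finite_spanning_out_trees: "finite E \<Longrightarrow> finite (spanning_out_trees E R i)"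
  by (rule finite_subset[of _ "Pow E"]) (auto simp: spanning_out_trees_def)

lemma tree_sum_nonneg:
  assumes "\<And>x y. (x, y) \<in> E \<Longrightarrow> c x y \<ge> 0" shows "tree_sum E c R i \<ge> 0"
  unfolding tree_sum_def
  using assms by (intro sum_nonneg prod_nonneg) (auto dest!: spanning_out_treesD(1))

text \<open>A tree rooted at \<open>i\<close> with an extra edge \<open>(i, x)\<close> is a graph
  with one cycle, and so is a tree rooted at \<open>k\<close> with an extra edge
  \<open>(k, i)\<close>. \<open>\<phi>\<close> passes from the first reading to the second and
  preserves the product of the weights. It is injective: adding \<open>(k, i)\<close> back restores
  the graph, and there \<open>(i, x)\<close> is the only edge with first component
  \<open>i\<close>.\<close>

lemma tree_sum_exchange_le:
  assumes E: "finite E" and R: "finite R" and c: "\<And>x y. (x, y) \<in> E \<Longrightarrow> c x y \<ge> 0"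
  shows "(\<Sum>x\<in>R - {i}. (if (i, x) \<in> E then c i x else 0) * tree_sum E c R i)
       \<le> (\<Sum>k\<in>R - {i}. (if (k, i) \<in> E then c k i else 0) * tree_sum E c R k)"
proof -
  define P where "P = (\<lambda>\<tau>. \<Prod>(x, y)\<in>\<tau>. c x y)"
  define S where "S = spanning_out_trees E R"
  define X where "X = {x \<in> R - {i}. (i, x) \<in> E}"
  define Y where "Y = {k \<in> R - {i}. (k, i) \<in> E}"
  \<comment> \<open>\<open>kf\<close> is the last vertex before \<open>i\<close> on the tree path
    from \<open>x\<close>; removing its edge to \<open>i\<close> opens the cycle.\<close>
  define kf where "kf = (\<lambda>(x, \<tau>). SOME k. (k, i) \<in> \<tau> \<and> (x, k) \<in> \<tau>\<^sup>*)"
  define \<phi> where "\<phi> = (\<lambda>(x, \<tau>). (kf (x, \<tau>), insert (i, x) \<tau> - {(kf (x, \<tau>), i)}))"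
  have finS: "finite (S j)" for j unfolding S_def using E by (rule finite_spanning_out_trees)
  have kf: "(kf (x, \<tau>), i) \<in> \<tau> \<and> (x, kf (x, \<tau>)) \<in> \<tau>\<^sup>*" if "x \<in> X" "\<tau> \<in> S i" for x \<tau>
  proof -
    have "(x, i) \<in> \<tau>\<^sup>*" "x \<noteq> i" using that spanning_out_treesD(6)[of \<tau> E R i x] by (auto simp: X_def S_def)
    then obtain k where "(x, k) \<in> \<tau>\<^sup>*" "(k, i) \<in> \<tau>" by (metis rtranclE)
    then have "\<exists>k. (k, i) \<in> \<tau> \<and> (x, k) \<in> \<tau>\<^sup>*" by blast
    then show ?thesis unfolding kf_def prod.case by (rule someI_ex)
  qed
  have notin: "(i, x) \<notin> \<tau>" if "\<tau> \<in> S i" for x \<tau> using that spanning_out_treesD(4)[of \<tau> E R i x] unfolding S_def by blast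
  have into: "\<phi> (x, \<tau>) \<in> Sigma Y S" if x: "x \<in> X" and \<tau>: "\<tau> \<in> S i" for x \<tau>
  proof -
    define k where "k = kf (x, \<tau>)"
    have k: "(k, i) \<in> \<tau>" "(x, k) \<in> \<tau>\<^sup>*" using kf[OF x \<tau>] by (simp_all add: k_def)
    have "\<tau> \<subseteq> E" "\<tau> \<subseteq> R \<times> R" using \<tau> spanning_out_treesD(1,2)[of \<tau> E R i] by (simp_all add: S_def)
    moreover have "k \<noteq> i" using k(1) notin[OF \<tau>] by blast
    ultimately have "k \<in> Y" using k(1) unfolding Y_def by blast
    moreover have "insert (i, x) \<tau> - {(k, i)} \<in> S k"
      using spanning_out_trees_rotate[of \<tau> E R i x k] x \<tau> k by (auto simp: X_def S_def)
    ultimately show ?thesis by (simp add: \<phi>_def k_def)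
  qed
  have weight: "c i x * P \<tau> = (case \<phi> (x, \<tau>) of (k, \<sigma>) \<Rightarrow> c k i * P \<sigma>)"
    if x: "x \<in> X" and \<tau>: "\<tau> \<in> S i" for x \<tau>
  proof -
    have fin: "finite \<tau>"
      using spanning_out_treesD(1)[of \<tau> E R i] \<tau> E by (simp add: S_def finite_subset)
    have "c i x * P \<tau> = P (insert (i, x) \<tau>)" unfolding P_def using fin notin[OF \<tau>] by simp
    also have "\<dots> = c (kf (x, \<tau>)) i * P (insert (i, x) \<tau> - {(kf (x, \<tau>), i)})"
      unfolding P_def using fin kf[OF x \<tau>]
      by (subst prod.remove[of _ "(kf (x, \<tau>), i)"]) auto
    finally show ?thesis by (simp add: \<phi>_def)
  qed
  have inj: "inj_on \<phi> (X \<times> S i)"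
  proof (rule inj_onI, clarify)
    fix x1 \<tau>1 x2 \<tau>2
    assume a: "x1 \<in> X" "\<tau>1 \<in> S i" "x2 \<in> X" "\<tau>2 \<in> S i" "\<phi> (x1, \<tau>1) = \<phi> (x2, \<tau>2)"
    define k where "k = kf (x1, \<tau>1)"
    have "kf (x1, \<tau>1) = kf (x2, \<tau>2)
      \<and> insert (i, x1) \<tau>1 - {(kf (x1, \<tau>1), i)} = insert (i, x2) \<tau>2 - {(kf (x2, \<tau>2), i)}"
      using a(5) unfolding \<phi>_def prod.case prod.inject .
    note pr = conjunct1[OF this] conjunct2[OF this]
    have k2: "k = kf (x2, \<tau>2)" unfolding k_def by (rule pr(1))
    have s: "insert (i, x1) \<tau>1 - {(k, i)} = insert (i, x2) \<tau>2 - {(k, i)}"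
      using pr(2) unfolding k_def pr(1) .
    have k: "(k, i) \<in> \<tau>1" "(k, i) \<in> \<tau>2" using kf[OF a(1,2)] kf[OF a(3,4)] k2 by (simp_all add: k_def)
    have ki: "k \<noteq> i" using k(1) notin[OF a(2)] by blast
    have "(i, x1) \<in> insert (i, x2) \<tau>2" using s ki by blast
    then have xx: "x1 = x2" using notin[OF a(4)] by blast
    have "\<tau>1 = insert (k, i) (insert (i, x1) \<tau>1 - {(k, i)} - {(i, x1)})"
      using k(1) notin[OF a(2), of x1] ki by blast
    also have "\<dots> = insert (k, i) (insert (i, x2) \<tau>2 - {(k, i)} - {(i, x2)})" unfolding s unfolding xx ..
    also have "\<dots> = \<tau>2" using k(2) notin[OF a(4), of x2] ki by blast
    finally show "x1 = x2 \<and> \<tau>1 = \<tau>2" using xx by blast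
  qed
  have finX: "finite X" "finite Y" using R by (auto simp: X_def Y_def)
  have "(\<Sum>x\<in>R - {i}. (if (i, x) \<in> E then c i x else 0) * tree_sum E c R i)
      = (\<Sum>x\<in>X. c i x * tree_sum E c R i)"
    using R by (intro sum.mono_neutral_cong_right) (auto simp: X_def)
  also have "\<dots> = (\<Sum>(x, \<tau>)\<in>X \<times> S i. c i x * P \<tau>)"
    using finX finS by (simp add: tree_sum_def sum_distrib_left sum.cartesian_product S_def P_def)
  also have "\<dots> = (\<Sum>p\<in>X \<times> S i. case \<phi> p of (k, \<sigma>) \<Rightarrow> c k i * P \<sigma>)"
    using weight by (intro sum.cong) auto
  also have "\<dots> = (\<Sum>(k, \<sigma>)\<in>\<phi> ` (X \<times> S i). c k i * P \<sigma>)"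
    using inj by (simp add: sum.reindex)
  also have "\<dots> \<le> (\<Sum>(k, \<sigma>)\<in>Sigma Y S. c k i * P \<sigma>)"
  proof (rule sum_mono2)
    show "finite (Sigma Y S)" using finX finS by auto
    show "\<phi> ` (X \<times> S i) \<subseteq> Sigma Y S"
    proof (rule image_subsetI)
      fix p assume "p \<in> X \<times> S i"
      then obtain x \<tau> where "p = (x, \<tau>)" "x \<in> X" "\<tau> \<in> S i" by blast
      then show "\<phi> p \<in> Sigma Y S" using into by metis
    qed
    fix p assume "p \<in> Sigma Y S - \<phi> ` (X \<times> S i)"
    then obtain k \<sigma> where p: "p = (k, \<sigma>)" "k \<in> Y" "\<sigma> \<in> S k" by auto
    have "0 \<le> P \<sigma>"
      unfolding P_def using p(3) c by (intro prod_nonneg) (auto simp: S_def dest!: spanning_out_treesD(1))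
    then show "0 \<le> (case p of (k, \<sigma>) \<Rightarrow> c k i * P \<sigma>)" using p c by (auto simp: Y_def)
  qed
  also have "\<dots> = (\<Sum>k\<in>Y. \<Sum>\<sigma>\<in>S k. c k i * P \<sigma>)"
    using finX finS by (simp add: sum.Sigma)
  also have "\<dots> = (\<Sum>k\<in>Y. c k i * tree_sum E c R k)"
    by (simp add: tree_sum_def sum_distrib_left S_def P_def)
  also have "\<dots> = (\<Sum>k\<in>R - {i}. (if (k, i) \<in> E then c k i else 0) * tree_sum E c R k)"
    using R by (intro sum.mono_neutral_cong_left) (auto simp: Y_def)
  finally show ?thesis .
qed

text \<open>
  Both sides of \<open>tree_sum_exchange_le\<close> have the same sum over \<open>i\<close>, so the inequalities are
  equalities.
\<close>

lemma tree_sum_balance: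
  assumes E: "finite E" and R: "finite R" and c: "\<And>x y. (x, y) \<in> E \<Longrightarrow> c x y \<ge> 0" and i: "i \<in> R"
  shows "(\<Sum>x\<in>R - {i}. (if (i, x) \<in> E then c i x else 0) * tree_sum E c R i)
       = (\<Sum>k\<in>R - {i}. (if (k, i) \<in> E then c k i else 0) * tree_sum E c R k)"
proof -
  \<comment> \<open>Setting the diagonal to 0 lets both sides be sums over all of \<open>R\<close>,
    so that their totals agree by exchange of summation.\<close>
  define b where "b = (\<lambda>i x. if i = x then 0 else (if (i, x) \<in> E then c i x else 0) * tree_sum E c R i)"
  have l: "(\<Sum>x\<in>R - {i}. (if (i, x) \<in> E then c i x else 0) * tree_sum E c R i) = (\<Sum>x\<in>R. b i x)" for i
    using R by (intro sum.mono_neutral_cong_left) (auto simp: b_def)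
  have r: "(\<Sum>k\<in>R - {i}. (if (k, i) \<in> E then c k i else 0) * tree_sum E c R k) = (\<Sum>k\<in>R. b k i)" for i
    using R by (intro sum.mono_neutral_cong_left) (auto simp: b_def)
  have le: "(\<Sum>x\<in>R. b i x) \<le> (\<Sum>k\<in>R. b k i)" for i
    using tree_sum_exchange_le[of E R c i] E R c by (simp only: l r)
  have eq: "(\<Sum>i\<in>R. \<Sum>x\<in>R. b i x) = (\<Sum>i\<in>R. \<Sum>k\<in>R. b k i)" by (rule sum.swap)
  show ?thesis unfolding l r using sum_mono_inv[OF eq le i R] .
qed

section \<open>Right kernel vectors as normalised tree weights\<close>

context cluster_graph
begin

abbreviation "tw \<equiv> tree_weight G Et"

lemma tw_eq: "tw R i = tree_sum (Et\<inverse>) (\<lambda>x y. a y x) R i"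
  by (simp add: tree_weight_def tree_sum_def transpose_graph_def)

lemma tw_nonneg: "tw R i \<ge> 0"
  unfolding tw_eq using weight_pos Et_edges by (intro tree_sum_nonneg) (auto intro: less_imp_le)

text \<open>A spanning tree rooted at \<open>x\<close> contains a path joining \<open>x\<close> with
  a root of \<open>R\<close>, so \<open>x\<close> reaches that root and belongs to the root
  class.\<close>

lemma tw_zero:
  assumes R: "R \<in> Reaches" and x: "x \<notin> roots R" shows "tw R x = 0"
proof -
  have "spanning_out_trees (Et\<inverse>) R x = {}"
  proof (rule ccontr)
    assume "spanning_out_trees (Et\<inverse>) R x \<noteq> {}"
    then obtain \<tau> where \<tau>: "\<tau> \<in> spanning_out_trees (Et\<inverse>) R x" by blast
    obtain r where r: "r \<in> roots R" using roots_nonempty[OF R] by blast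
    then have "(r, x) \<in> \<tau>\<^sup>*" using spanning_out_treesD(6)[OF \<tau>] roots_mem by blast
    then have "(r, x) \<in> (Et\<inverse>)\<^sup>*" using rtrancl_mono[OF spanning_out_treesD(1)[OF \<tau>]] by blast
    then have "(x, r) \<in> Et\<^sup>*" by (simp add: rtrancl_converse)
    then show False using roots_closed[OF r] x by blast
  qed
  then show ?thesis by (simp add: tree_weight_def)
qed

text \<open>Breadth-first tree: \<open>n v\<close> is the distance of \<open>v\<close> from the
  root, and \<open>s v\<close> is a neighbour that is strictly closer.\<close>

lemma ex_spanning_tree:
  assumes R: "R \<in> Reaches" and r: "r \<in> roots R"
  shows "spanning_out_trees (Et\<inverse>) R r \<noteq> {}"
proof -
  define n where "n = (\<lambda>v. LEAST n. (r, v) \<in> Et ^^ n)"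
  have n: "(r, v) \<in> Et ^^ n v" if "v \<in> R" for v
    unfolding n_def
  proof (rule LeastI_ex)
    show "\<exists>n. (r, v) \<in> Et ^^ n" using root_path[OF r that] by (simp add: rtrancl_power)
  qed
  have ex: "\<exists>y. y \<in> R \<and> (y, v) \<in> Et \<and> n y < n v" if v: "v \<in> R" "v \<noteq> r" for v
  proof -
    obtain l where l: "n v = Suc l" using n[OF v(1)] v(2) by (cases "n v") simp_all
    then have "(r, v) \<in> Et ^^ Suc l" using n[OF v(1)] by simp
    then obtain y where y: "(r, y) \<in> Et ^^ l" "(y, v) \<in> Et" by (rule relpow_Suc_E)
    have "n y \<le> l" unfolding n_def using y(1) by (rule Least_le)
    moreover have "y \<in> R" using reach_closed[OF R, of r y] r roots_mem y(1)
      by (meson relpow_imp_rtrancl)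
    ultimately show ?thesis using y(2) l by auto
  qed
  define s where "s = (\<lambda>v. SOME y. y \<in> R \<and> (y, v) \<in> Et \<and> n y < n v)"
  have s: "s v \<in> R" "(s v, v) \<in> Et" "n (s v) < n v" if "v \<in> R" "v \<noteq> r" for v
    using someI_ex[OF ex[OF that]] unfolding s_def by blast+
  define \<tau> where "\<tau> = {(v, s v) | v. v \<in> R \<and> v \<noteq> r}"
  have path: "(v, r) \<in> \<tau>\<^sup>*" if "v \<in> R" for v
    using that
  proof (induction "n v" arbitrary: v rule: less_induct)
    case less
    show ?case
    proof (cases "v = r")
      case False
      then have "(s v, r) \<in> \<tau>\<^sup>*" using less s by blast
      moreover have "(v, s v) \<in> \<tau>" using less False by (auto simp: \<tau>_def)
      ultimately show ?thesis by (rule converse_rtrancl_into_rtrancl[rotated])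
    qed simp
  qed
  have "\<tau> \<in> spanning_out_trees (Et\<inverse>) R r"
    using s path roots_mem[OF r] by (intro spanning_out_treesI) (auto simp: \<tau>_def)
  then show ?thesis by blast
qed

lemma tw_pos:
  assumes R: "R \<in> Reaches" and r: "r \<in> roots R" shows "tw R r > 0"
  unfolding tw_eq tree_sum_def
proof (rule sum_pos)
  show "finite (spanning_out_trees (Et\<inverse>) R r)"
    using finite_Et by (intro finite_spanning_out_trees) simp
  show "spanning_out_trees (Et\<inverse>) R r \<noteq> {}" using ex_spanning_tree[OF R r] .
  fix \<tau> assume "\<tau> \<in> spanning_out_trees (Et\<inverse>) R r"
  then have "\<tau> \<subseteq> Et\<inverse>" by (rule spanning_out_treesD(1))
  then show "0 < (\<Prod>(x, y)\<in>\<tau>. a y x)"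
    using Et_edges weight_pos by (intro prod_pos) auto
qed

text \<open>Stationarity of the tree weights. \<open>tree_sum_balance\<close> gives it with the sums
  restricted to \<open>R - {x}\<close>; the diagonal terms agree, and nothing flows across the
  boundary of \<open>R\<close>, because the weights live on the root class and that class is
  closed.\<close>

lemma tw_balance:
  assumes R: "R \<in> Reaches"
  shows "(\<Sum>y\<in>W. cw y x * tw R x) = (\<Sum>y\<in>W. cw x y * tw R y)"
proof (cases "x \<in> R")
  case False
  have "cw x y * tw R y = 0" for y
  proof (cases "(x, y) \<in> Et \<and> y \<in> roots R")
    case True
    then have "x \<in> R" using roots_closed[of y R x] roots_mem by blast
    then show ?thesis using False by blast
  next
    case no: False
    then show ?thesis using cw_zero[of x y] tw_zero[OF R, of y] by auto
  qed
  moreover have "tw R x = 0" using tw_zero[OF R] False roots_mem by blast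
  ultimately show ?thesis by (simp only: mult_zero_right)
next
  case True
  have sumR: "(\<Sum>y\<in>W. b y) = (\<Sum>y\<in>R - {x}. b y) + b x"
    if b: "\<And>y. y \<notin> R \<Longrightarrow> b y = 0" "\<And>y. y \<notin> W \<Longrightarrow> b y = 0" for b :: "'v \<Rightarrow> real"
  proof -
    have "(\<Sum>y\<in>W. b y) = (\<Sum>y\<in>R \<union> W. b y)"
      using finite_W finite_reach[OF R] b by (intro sum.mono_neutral_left) auto
    also have "\<dots> = (\<Sum>y\<in>R. b y)"
      using finite_W finite_reach[OF R] b by (intro sum.mono_neutral_right) auto
    also have "\<dots> = (\<Sum>y\<in>R - {x}. b y) + b x"
      using finite_reach[OF R] True by (simp add: sum.remove)
    finally show ?thesis .
  qed
  have out: "cw y x * tw R x = 0" if "y \<notin> R" for y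
  proof (cases "(y, x) \<in> Et \<and> x \<in> roots R")
    case True
    then show ?thesis using roots_closed[of x R y] roots_mem that by blast
  next
    case False
    then show ?thesis using cw_zero[of y x] tw_zero[OF R, of x] by auto
  qed
  have inn: "cw x y * tw R y = 0" if "y \<notin> R" for y
    using that tw_zero[OF R, of y] roots_mem by auto
  have W0: "cw y x = 0" "cw x y = 0" if "y \<notin> W" for y
    using that W_mem cw_zero by blast+
  have "(\<Sum>y\<in>R - {x}. cw y x * tw R x) = (\<Sum>y\<in>R - {x}. cw x y * tw R y)"
    using tree_sum_balance[of "Et\<inverse>" R "\<lambda>x y. a y x" x] finite_Et finite_reach[OF R] True
      weight_pos Et_edges unfolding tw_eq cw_def by (auto intro: less_imp_le)
  then show ?thesis
    using sumR[of "\<lambda>y. cw y x * tw R x"] sumR[of "\<lambda>y. cw x y * tw R y"] out inn W0 by simp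
qed

abbreviation "rf \<equiv> gamma_right G Et"

lemma rf_total_pos:
  assumes "R \<in> Reaches" shows "(\<Sum>j\<in>R. tw R j * m j) > 0"
proof -
  obtain r where r: "r \<in> roots R" using roots_nonempty[OF assms] by blast
  show ?thesis
  proof (rule sum_pos2[of _ r])
    show "0 < tw R r * m r" using tw_pos[OF assms r] mass_pos roots_mem[OF r] by simp
    show "0 \<le> tw R j * m j" if "j \<in> R" for j
      using tw_nonneg mass_pos reach_verts[OF assms that] by (simp add: less_imp_le)
  qed (use finite_reach[OF assms] roots_mem[OF r] in auto)
qed

lemma rf_zero: "R \<in> Reaches \<Longrightarrow> x \<notin> roots R \<Longrightarrow> rf R x = 0"
  by (simp add: gamma_right_def tw_zero)

lemma rf_balance: "R \<in> Reaches \<Longrightarrow> (\<Sum>y\<in>W. cw y x * rf R x) = (\<Sum>y\<in>W. cw x y * rf R y)"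
  using tw_balance[of R x] by (simp add: gamma_right_def sum_divide_distrib[symmetric])

lemma rf_mass:
  assumes "R \<in> Reaches" shows "(\<Sum>x\<in>R. rf R x * m x) = 1"
proof -
  have "(\<Sum>x\<in>R. rf R x * m x) = (\<Sum>x\<in>R. tw R x * m x) / (\<Sum>j\<in>R. tw R j * m j)"
    by (simp add: gamma_right_def flip: sum_divide_distrib)
  then show ?thesis using rf_total_pos[OF assms] by simp
qed

end

section \<open>The spectral projection of the cluster Laplacian\<close>

definition cut :: "'v set \<Rightarrow> ('v \<Rightarrow> complex) \<Rightarrow> 'v \<Rightarrow> complex" where
  "cut W f x = (if x \<in> W then f x else 0)"

lemma cut_supp: "cut W f \<in> supp_funs W"
  by (simp add: cut_def supp_funs_def)

lemma l1_norm_cut: "l1_norm W (cut W f) = l1_norm W f"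
  by (simp add: l1_norm_def cut_def)

lemma supp_funs_mono: "W \<subseteq> V \<Longrightarrow> f \<in> supp_funs W \<Longrightarrow> f \<in> supp_funs V"
  by (auto simp: supp_funs_def)

lemma lin_on_mono: "lin_on X A \<Longrightarrow> Y \<subseteq> X \<Longrightarrow> lin_on Y A"
  by (auto simp: lin_on_def)

lemma ell2_supp: "f \<in> ell2 G \<Longrightarrow> f \<in> supp_funs (verts G)"
  by (simp add: ell2_def supp_funs_def)

context cluster_graph
begin

abbreviation "T \<equiv> lap_out (restrict_graph G Et)"

lemma T_eq:
  "T f x = (if x \<in> V then (\<Sum>y\<in>W. of_real (cw y x) * f x - of_real (cw x y) * f y) / of_real (m x) else 0)"
proof -
  have "out_deg (restrict_graph G Et) x = (\<Sum>\<^sub>\<infinity>i\<in>V. of_real (cw i x) * 1)"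
    by (simp add: out_deg_def restrict_graph_def cw_def)
  also have "\<dots> = (\<Sum>i\<in>W. cw i x)" unfolding cw_infsum_left by simp
  finally have d: "out_deg (restrict_graph G Et) x = (\<Sum>i\<in>W. cw i x)" .
  have "(\<Sum>\<^sub>\<infinity>y\<in>V. of_real (if (x, y) \<in> Et then a x y else 0) * f y)
      = (\<Sum>\<^sub>\<infinity>y\<in>V. of_real (cw x y) * f y)" by (simp add: cw_def)
  also have "\<dots> = (\<Sum>y\<in>W. of_real (cw x y) * f y)" by (rule cw_infsum_right)
  finally have s: "(\<Sum>\<^sub>\<infinity>y\<in>V. of_real (if (x, y) \<in> Et then a x y else 0) * f y)
      = (\<Sum>y\<in>W. of_real (cw x y) * f y)" .
  show ?thesis
    unfolding lap_out_def d
    by (simp add: restrict_graph_def s sum_subtractf sum_distrib_right)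
qed

lemma cw_outside_W: "x \<notin> W \<Longrightarrow> cw x y = 0" "x \<notin> W \<Longrightarrow> cw y x = 0"
  using W_mem[of x y] W_mem[of y x] cw_zero by blast+

lemma T_supp: "T f \<in> supp_funs W"
  by (simp add: supp_funs_def T_eq cw_outside_W)

lemma T_mass:
  assumes "x \<in> V"
  shows "T f x * of_real (m x) = (\<Sum>y\<in>W. of_real (cw y x) * f x - of_real (cw x y) * f y)"
  using mass_pos[OF assms] assms by (simp add: T_eq)

lemma T_lin: "T (\<lambda>x. f x + c * g x) = (\<lambda>x. T f x + c * T g x)"
proof
  fix x
  have "(\<Sum>y\<in>W. of_real (cw y x) * (f x + c * g x) - of_real (cw x y) * (f y + c * g y))
     = (\<Sum>y\<in>W. of_real (cw y x) * f x - of_real (cw x y) * f y)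
       + c * (\<Sum>y\<in>W. of_real (cw y x) * g x - of_real (cw x y) * g y)"
    by (simp add: sum_distrib_left sum.distrib[symmetric] algebra_simps)
  then show "T (\<lambda>x. f x + c * g x) x = T f x + c * T g x"
    by (simp add: T_eq add_divide_distrib)
qed

text \<open>
  Up to the reduced masses, \<open>D0\<close> and \<open>J0\<close> are the transfer operators \<open>J_down\<close> and \<open>J_up\<close>.
\<close>

definition D0 :: "('v \<Rightarrow> complex) \<Rightarrow> 'v set \<Rightarrow> complex" where
  "D0 f R = (if R \<in> Reaches then \<Sum>y\<in>R. of_real (lf R y * m y) * f y else 0)"

definition J0 :: "('v set \<Rightarrow> complex) \<Rightarrow> 'v \<Rightarrow> complex" where
  "J0 g x = (\<Sum>R\<in>{R \<in> Reaches. x \<in> R}. of_real (rf R x) * g R)"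

lemma D0_lin: "D0 (\<lambda>x. f x + c * g x) = (\<lambda>R. D0 f R + c * D0 g R)"
  by (auto simp: D0_def fun_eq_iff sum_distrib_left sum.distrib[symmetric] algebra_simps)

lemma J0_lin: "J0 (\<lambda>x. f x + c * g x) = (\<lambda>R. J0 f R + c * J0 g R)"
  by (auto simp: J0_def fun_eq_iff sum_distrib_left sum.distrib[symmetric] algebra_simps)

lemma D0_zero: "D0 (\<lambda>x. 0) = (\<lambda>R. 0)"
  by (simp add: D0_def fun_eq_iff)

lemma J0_zero: "J0 (\<lambda>x. 0) = (\<lambda>R. 0)"
  by (simp add: J0_def fun_eq_iff)

lemma lf_root: "R \<in> Reaches \<Longrightarrow> x \<in> roots R \<Longrightarrow> lf R x = 1"
  by (simp add: lf_exclusive roots_exclusive)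

text \<open>Biorthogonality holds pointwise: \<open>rf R\<close> lives on \<open>roots R\<close>,
  where \<open>lf R\<close> is 1 and the left kernel vector of any other reach is 0.\<close>

lemma lf_rf:
  assumes R: "R \<in> Reaches" and S: "S \<in> Reaches"
  shows "lf S x * rf R x = (if R = S then rf S x else 0)"
proof (cases "x \<in> roots R")
  case True
  show ?thesis
  proof (cases "R = S")
    case True
    then show ?thesis using lf_root[OF S] \<open>x \<in> roots R\<close> by simp
  next
    case False
    then have "x \<notin> S" using root_unique_reach[OF True S] by blast
    then show ?thesis using lf_outside[OF S] False by simp
  qed
next
  case False
  then show ?thesis using rf_zero[OF R] by auto
qed

lemma rf_outside: "R \<in> Reaches \<Longrightarrow> x \<notin> R \<Longrightarrow> rf R x = 0"
  using rf_zero[of R x] roots_mem[of x R] by blast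

lemma lf_J0:
  assumes S: "S \<in> Reaches"
  shows "of_real (lf S x) * J0 g x = of_real (rf S x) * g S"
proof -
  have "of_real (lf S x) * J0 g x
      = (\<Sum>R\<in>{R \<in> Reaches. x \<in> R}. of_real (lf S x * rf R x) * g R)"
    by (simp add: J0_def sum_distrib_left mult.assoc)
  also have "\<dots> = (\<Sum>R\<in>{R \<in> Reaches. x \<in> R}. if R = S then of_real (rf S x) * g S else 0)"
    using S by (intro sum.cong) (auto simp: lf_rf)
  also have "\<dots> = of_real (rf S x) * g S"
    using finite_reaches_at S rf_outside[OF S, of x] by (simp add: sum.delta)
  finally show ?thesis .
qed

lemma D0_J0:
  assumes "R \<in> Reaches" shows "D0 (J0 g) R = g R"
proof -
  have "D0 (J0 g) R = (\<Sum>y\<in>R. of_real (m y) * (of_real (lf R y) * J0 g y))"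
    using assms by (simp add: D0_def mult_ac)
  also have "\<dots> = (\<Sum>y\<in>R. of_real (m y) * (of_real (rf R y) * g R))"
    by (simp only: lf_J0[OF assms])
  also have "\<dots> = of_real (\<Sum>y\<in>R. rf R y * m y) * g R"
    by (simp add: sum_distrib_left mult_ac)
  finally show ?thesis using rf_mass[OF assms] by simp
qed

lemma J0_cong: "(\<And>R. R \<in> Reaches \<Longrightarrow> g R = h R) \<Longrightarrow> J0 g = J0 h"
  by (auto simp: J0_def fun_eq_iff intro!: sum.cong)

lemma J0_delta:
  assumes R: "R \<in> Reaches" shows "J0 (\<lambda>S. if S = R then 1 else 0) x = of_real (rf R x)"
proof -
  have "J0 (\<lambda>S. if S = R then 1 else 0) x
      = (\<Sum>S\<in>{S \<in> Reaches. x \<in> S}. if S = R then of_real (rf R x) else 0)"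
    unfolding J0_def by (intro sum.cong) auto
  also have "\<dots> = of_real (rf R x)"
    using finite_reaches_at R rf_outside[OF R, of x] by (simp add: sum.delta)
  finally show ?thesis .
qed

lemma J0_outside: "x \<notin> V \<Longrightarrow> J0 g x = 0"
proof -
  assume "x \<notin> V"
  then have empty: "{R \<in> Reaches. x \<in> R} = {}" using reach_verts[of _ x] by auto
  show ?thesis unfolding J0_def empty by simp
qed

lemma J0_on_W:
  assumes "x \<in> W"
  shows "J0 g x = (\<Sum>R\<in>{R \<in> Reaches. R \<subseteq> W}. of_real (rf R x) * g R)"
  unfolding J0_def
proof (rule sum.mono_neutral_left[OF finite_inner_reaches])
  show "{R \<in> Reaches. x \<in> R} \<subseteq> {R \<in> Reaches. R \<subseteq> W}" using assms reach_meeting_W by blast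
  show "\<forall>R\<in>{R \<in> Reaches. R \<subseteq> W} - {R \<in> Reaches. x \<in> R}. of_real (rf R x) * g R = 0"
    using rf_outside by simp
qed

text \<open>Summation by parts moves \<open>T\<close> onto the left kernel vector, which is
  harmonic.\<close>

lemma D0_T: "D0 (T f) = (\<lambda>R. 0)"
proof
  fix R
  show "D0 (T f) R = 0"
  proof (cases "R \<in> Reaches")
    case R: True
    have "D0 (T f) R = (\<Sum>x\<in>R. of_real (lf R x) * (T f x * of_real (m x)))"
      using R by (simp add: D0_def mult_ac)
    also have "\<dots> = (\<Sum>x\<in>R \<union> W. of_real (lf R x) * (T f x * of_real (m x)))"
      using lf_outside[OF R] finite_reach[OF R] finite_W by (intro sum.mono_neutral_left) auto
    also have "\<dots> = (\<Sum>x\<in>W. of_real (lf R x) * (T f x * of_real (m x)))"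
      using T_supp[of f] finite_reach[OF R] finite_W
      by (intro sum.mono_neutral_right) (auto simp: supp_funs_def)
    also have "\<dots> = (\<Sum>x\<in>W. of_real (lf R x) *
        (\<Sum>y\<in>W. of_real (cw y x) * f x - of_real (cw x y) * f y))"
    proof (rule sum.cong[OF refl])
      fix x assume "x \<in> W"
      then have "x \<in> V" using W_verts by blast
      then show "of_real (lf R x) * (T f x * of_real (m x)) = of_real (lf R x) *
        (\<Sum>y\<in>W. of_real (cw y x) * f x - of_real (cw x y) * f y)" by (simp only: T_mass)
    qed
    also have "\<dots> = (\<Sum>x\<in>W. \<Sum>y\<in>W. of_real (lf R x * cw y x) * f x)
        - (\<Sum>x\<in>W. \<Sum>y\<in>W. of_real (lf R x * cw x y) * f y)"
      by (simp add: sum_distrib_left sum_subtractf algebra_simps)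
    also have "(\<Sum>x\<in>W. \<Sum>y\<in>W. of_real (lf R x * cw x y) * f y)
        = (\<Sum>x\<in>W. \<Sum>y\<in>W. of_real (lf R y * cw y x) * f x)"
      by (rule sum.swap)
    also have "(\<Sum>x\<in>W. \<Sum>y\<in>W. of_real (lf R x * cw y x) * f x)
        - (\<Sum>x\<in>W. \<Sum>y\<in>W. of_real (lf R y * cw y x) * f x)
        = (\<Sum>x\<in>W. of_real (\<Sum>y\<in>W. cw y x * (lf R x - lf R y)) * f x)"
      by (simp only: sum_subtractf[symmetric] of_real_sum sum_distrib_right)
        (simp add: algebra_simps)
    also have "\<dots> = 0" using lf_harmonic[OF R] by simp
    finally show ?thesis .
  qed (simp add: D0_def)
qed

text \<open>Stationarity of the right kernel vectors; on \<open>W\<close> only the finitely many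
  reaches inside \<open>W\<close> contribute, so the sums can be exchanged.\<close>

lemma T_J0: "T (J0 g) = (\<lambda>x. 0)"
proof
  fix x
  show "T (J0 g) x = 0"
  proof (cases "x \<in> W")
    case x: True
    then have xV: "x \<in> V" using W_verts by blast
    let ?F = "{R \<in> Reaches. R \<subseteq> W}"
    have "T (J0 g) x * of_real (m x)
        = (\<Sum>y\<in>W. \<Sum>R\<in>?F. of_real (cw y x * rf R x - cw x y * rf R y) * g R)"
      unfolding T_mass[OF xV]
      by (intro sum.cong) (simp_all add: J0_on_W x sum_distrib_left sum_subtractf[symmetric] algebra_simps)
    also have "\<dots> = (\<Sum>R\<in>?F. of_real (\<Sum>y\<in>W. cw y x * rf R x - cw x y * rf R y) * g R)"
      by (subst sum.swap) (simp add: sum_distrib_right)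
    also have "\<dots> = 0"
    proof (rule sum.neutral, rule ballI)
      fix R assume "R \<in> ?F"
      then have "R \<in> Reaches" by simp
      from rf_balance[OF this, of x]
      show "of_real (\<Sum>y\<in>W. cw y x * rf R x - cw x y * rf R y) * g R = 0"
        by (simp only: sum_subtractf) simp
    qed
    finally show ?thesis using mass_pos[OF xV] by simp
  next
    case False
    then show ?thesis using T_supp[of "J0 g"] by (simp add: supp_funs_def)
  qed
qed

lemma singleton_reach:
  assumes "x \<in> V" "x \<notin> W" shows "{R \<in> Reaches. x \<in> R} = {{x}}"
proof -
  obtain R where "R \<in> Reaches" "x \<in> R" using vertex_in_reach[OF assms(1)] by blast
  then show ?thesis using outside_W_reach[OF _ _ assms(2)] by blast
qed

text \<open>These values make \<open>J0\<close> after \<open>D0\<close> the identity off the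
  clusters, which is what confines the range of \<open>Q\<close> to
  \<open>supp_funs W\<close>.\<close>

lemma singleton_lf_rf:
  assumes "x \<in> V" "x \<notin> W" shows "{x} \<in> Reaches" "lf {x} x = 1" "rf {x} x * m x = 1"
proof -
  show R: "{x} \<in> Reaches" using singleton_reach[OF assms] by blast
  obtain r where "r \<in> roots {x}" using roots_nonempty[OF R] by blast
  then have "x \<in> roots {x}" using roots_mem by blast
  then show "lf {x} x = 1" by (rule lf_root[OF R])
  show "rf {x} x * m x = 1" using rf_mass[OF R] by simp
qed

lemma J0_D0_outside_W:
  assumes "f \<in> supp_funs V" "x \<notin> W" shows "J0 (D0 f) x = f x"
proof (cases "x \<in> V")
  case True
  note s = singleton_lf_rf[OF True assms(2)]
  have "J0 (D0 f) x = of_real (rf {x} x * m x) * f x"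
    unfolding J0_def singleton_reach[OF True assms(2)] using s(1,2) by (simp add: D0_def)
  then show ?thesis using s(3) by simp
next
  case False
  then show ?thesis using assms(1) by (simp add: J0_outside supp_funs_def)
qed

section \<open>The complementary projection and the inverse of the cluster Laplacian on its
  range\<close>

definition Q :: "('v \<Rightarrow> complex) \<Rightarrow> 'v \<Rightarrow> complex" where
  "Q f x = f x - J0 (D0 f) x"

lemma Q_supp: "f \<in> supp_funs V \<Longrightarrow> Q f \<in> supp_funs W"
  using J0_D0_outside_W by (simp add: supp_funs_def Q_def)

lemma Q_lin: "Q (\<lambda>x. f x + c * g x) = (\<lambda>x. Q f x + c * Q g x)"
  by (auto simp: Q_def D0_lin J0_lin fun_eq_iff algebra_simps)

lemma D0_eq_zeroI: "(\<And>R. R \<in> Reaches \<Longrightarrow> D0 f R = 0) \<Longrightarrow> D0 f = (\<lambda>R. 0)"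
  by (auto simp: fun_eq_iff D0_def)

lemma D0_Q: "D0 (Q f) = (\<lambda>R. 0)"
proof (rule D0_eq_zeroI)
  fix R assume R: "R \<in> Reaches"
  have "Q f = (\<lambda>x. f x + (-1) * J0 (D0 f) x)" by (simp add: Q_def fun_eq_iff)
  then have "D0 (Q f) R = D0 f R + (-1) * D0 (J0 (D0 f)) R" by (simp only: D0_lin)
  then show "D0 (Q f) R = 0" using D0_J0[OF R] by simp
qed

lemma Q_id: "D0 f = (\<lambda>R. 0) \<Longrightarrow> Q f = f"
proof -
  assume D: "D0 f = (\<lambda>R. 0)"
  have "J0 (D0 f) = (\<lambda>x. 0)" unfolding D by (rule J0_zero)
  then show ?thesis by (simp add: Q_def fun_eq_iff)
qed

lemma T_shift_lin: "lin_on X (\<lambda>f x. T f x + J0 (D0 f) x)"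
  by (auto simp: lin_on_def T_lin D0_lin J0_lin fun_eq_iff algebra_simps)

lemma T_pairing:
  fixes h :: "'v \<Rightarrow> complex"
  shows "(\<Sum>x\<in>W. h x * (T f x * of_real (m x))) = (\<Sum>x\<in>W. f x * harmonic_sum h x)"
proof -
  have "(\<Sum>x\<in>W. h x * (T f x * of_real (m x)))
      = (\<Sum>x\<in>W. h x * (\<Sum>y\<in>W. of_real (cw y x) * f x - of_real (cw x y) * f y))"
  proof (rule sum.cong[OF refl])
    fix x assume "x \<in> W"
    then have "x \<in> V" using W_verts by blast
    then show "h x * (T f x * of_real (m x))
        = h x * (\<Sum>y\<in>W. of_real (cw y x) * f x - of_real (cw x y) * f y)" by (simp only: T_mass)
  qed
  also have "\<dots> = (\<Sum>x\<in>W. \<Sum>y\<in>W. of_real (cw y x) * h x * f x)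
      - (\<Sum>x\<in>W. \<Sum>y\<in>W. of_real (cw x y) * h x * f y)"
    by (simp add: sum_distrib_left sum_subtractf algebra_simps)
  also have "(\<Sum>x\<in>W. \<Sum>y\<in>W. of_real (cw x y) * h x * f y)
      = (\<Sum>x\<in>W. \<Sum>y\<in>W. of_real (cw y x) * h y * f x)"
    by (rule sum.swap)
  also have "(\<Sum>x\<in>W. \<Sum>y\<in>W. of_real (cw y x) * h x * f x)
      - (\<Sum>x\<in>W. \<Sum>y\<in>W. of_real (cw y x) * h y * f x)
      = (\<Sum>x\<in>W. f x * harmonic_sum h x)"
    by (simp add: harmonic_sum_def sum_subtractf sum_distrib_left algebra_simps)
  finally show ?thesis .
qed

text \<open>
  The adjoint of \<open>T + P\<close> is injective: its kernel consists of harmonic functions which are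
  orthogonal to all right kernel vectors, and a harmonic function is determined by its constant
  values on the recurrent classes.
\<close>

lemma T_shift_adjoint_injective:
  assumes g: "\<And>f. f \<in> supp_funs W \<Longrightarrow> (\<Sum>x\<in>W. g x * (T f x + J0 (D0 f) x)) = 0"
  shows "\<forall>x\<in>W. g x = 0"
proof -
  define F where "F = {R \<in> Reaches. R \<subseteq> W}"
  \<comment> \<open>\<open>g\<close> annihilates the range in the unweighted pairing; division by
    the mass passes to the weighted pairing of \<open>T_pairing\<close>.\<close>
  define h where "h = (\<lambda>x. if x \<in> W then g x / of_real (m x) else 0)"
  have gh: "g x = h x * of_real (m x)" if "x \<in> W" for x
    using that mass_pos[of x] W_verts by (auto simp: h_def)
  have orth: "(\<Sum>x\<in>W. g x * of_real (rf R x)) = 0" if R: "R \<in> F" for R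
  proof -
    define f where "f = J0 (\<lambda>S. if S = R then 1 else 0)"
    have RR: "R \<in> Reaches" "R \<subseteq> W" using R by (auto simp: F_def)
    have f: "f x = of_real (rf R x)" for x unfolding f_def by (rule J0_delta[OF RR(1)])
    have "f \<in> supp_funs W" using rf_outside[OF RR(1)] RR(2) by (auto simp: supp_funs_def f)
    moreover have "J0 (D0 f) = f" unfolding f_def by (rule J0_cong) (rule D0_J0)
    moreover have "T f = (\<lambda>x. 0)" unfolding f_def by (rule T_J0)
    ultimately show ?thesis using g[of f] by (simp add: f)
  qed
  have PF: "(\<Sum>x\<in>W. g x * J0 u x) = 0" for u
  proof -
    have "(\<Sum>x\<in>W. g x * J0 u x) = (\<Sum>x\<in>W. \<Sum>R\<in>F. u R * (g x * of_real (rf R x)))"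
      by (intro sum.cong) (auto simp: J0_on_W F_def sum_distrib_left mult_ac)
    also have "\<dots> = (\<Sum>R\<in>F. u R * (\<Sum>x\<in>W. g x * of_real (rf R x)))"
      by (subst sum.swap) (simp add: sum_distrib_left)
    also have "\<dots> = 0" using orth by simp
    finally show ?thesis .
  qed
  have harm: "harmonic_sum h z = 0" if z: "z \<in> W" for z
  proof -
    have "(\<Sum>x\<in>W. g x * T (delta_fun z) x) = 0"
      using g[OF delta_supp_funs[OF z]] PF[of "D0 (delta_fun z)"]
      by (simp add: distrib_left sum.distrib)
    moreover have "(\<Sum>x\<in>W. g x * T (delta_fun z) x)
        = (\<Sum>x\<in>W. h x * (T (delta_fun z) x * of_real (m x)))"
      by (intro sum.cong) (auto simp: gh)
    moreover have "(\<Sum>x\<in>W. delta_fun z x * harmonic_sum h x) = harmonic_sum h z"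
      using finite_W z by (simp add: delta_fun_def if_distrib[of "\<lambda>c. c * _"] sum.delta cong: if_cong)
    ultimately show ?thesis unfolding T_pairing by simp
  qed
  have root0: "h x = 0" if R: "R \<in> F" and x: "x \<in> roots R" for R x
  proof -
    have RR: "R \<in> Reaches" "R \<subseteq> W" using R by (auto simp: F_def)
    have rW: "y \<in> W" if "y \<in> roots R" for y using roots_mem[OF that] RR by blast
    have const: "h y = h x" if y: "y \<in> roots R" for y
    proof -
      \<comment> \<open>\<open>k\<close> is harmonic on the root class away from \<open>x\<close>,
        because the class is closed, and it vanishes at \<open>x\<close>; since \<open>x\<close> is
        reached from everywhere in the class, \<open>h\<close> is constant there.\<close>
      define k where "k = (\<lambda>v. if v \<in> roots R then h v - h x else 0)"
      have "k y = 0"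
      proof (rule harmonic_zero_complex[where f = k and Z = "roots R - {x}"])
        show "finite (roots R - {x})" using rW finite_subset[OF _ finite_W, of "roots R"] by auto
        fix v assume v: "v \<in> roots R - {x}"
        have "of_real (cw w v) * (k v - k w) = of_real (cw w v) * (h v - h w)" for w
        proof (cases "(w, v) \<in> Et")
          case True
          then have "w \<in> roots R" using roots_closed[of v R w] v by blast
          then show ?thesis using v by (simp add: k_def)
        qed (simp add: cw_zero)
        then have "(\<Sum>w\<in>W. of_real (cw w v) * (k v - k w)) = harmonic_sum h v"
          by (simp only: harmonic_sum_def)
        then show "(\<Sum>w\<in>W. of_real (cw w v) * (k v - k w)) = 0" using harm[OF rW] v by simp
        have "(x, v) \<in> Et\<^sup>*" using root_path[OF x] v roots_mem by blast
        then show "\<exists>w. w \<notin> roots R - {x} \<and> (w, v) \<in> Et\<^sup>*" by blast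
      qed (auto simp: k_def)
      then show ?thesis using y by (simp add: k_def)
    qed
    \<comment> \<open>Pairing with a right kernel vector of total mass 1 returns the constant value
      of \<open>h\<close> on the root class, and this pairing is zero.\<close>
    have "0 = (\<Sum>v\<in>W. g v * of_real (rf R v))" using orth[OF R] by simp
    also have "\<dots> = (\<Sum>v\<in>W. h x * of_real (rf R v * m v))"
    proof (rule sum.cong[OF refl])
      fix v assume v: "v \<in> W"
      show "g v * of_real (rf R v) = h x * of_real (rf R v * m v)"
        using const[of v] rf_zero[OF RR(1), of v] by (cases "v \<in> roots R") (auto simp: gh[OF v])
    qed
    also have "\<dots> = (\<Sum>v\<in>R. h x * of_real (rf R v * m v))"
      using finite_W RR rf_outside[OF RR(1)] by (intro sum.mono_neutral_right) auto
    also have "\<dots> = h x * of_real (\<Sum>v\<in>R. rf R v * m v)" by (simp add: sum_distrib_left)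
    also have "\<dots> = h x" using rf_mass[OF RR(1)] by simp
    finally show ?thesis by simp
  qed
  have "h x = 0" for x
  proof (rule harmonic_zero_complex[where f = h and Z = "{x \<in> W. \<not> recurrent x}"])
    show "finite {x \<in> W. \<not> recurrent x}" using finite_W by simp
    fix v assume v: "v \<in> {x \<in> W. \<not> recurrent x}"
    then show "(\<Sum>y\<in>W. of_real (cw y v) * (h v - h y)) = 0"
      using harm[of v] by (simp add: harmonic_sum_def)
    have "v \<in> V" using v W_verts by blast
    then show "\<exists>y. y \<notin> {x \<in> W. \<not> recurrent x} \<and> (y, v) \<in> Et\<^sup>*" using ex_recurrent by blast
  next
    fix v assume v: "v \<notin> {x \<in> W. \<not> recurrent x}"
    show "h v = 0"
    proof (cases "v \<in> W")
      case True
      then have "recurrent v" using v by blast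
      note r = recurrent_roots[OF this]
      then have "reachables v \<subseteq> W" using reach_meeting_W[OF r(2)] roots_mem[OF r(1)] True by blast
      then show ?thesis using root0[of "reachables v" v] r by (simp add: F_def)
    qed (simp add: h_def)
  qed
  then show ?thesis using gh by simp
qed

text \<open>Adding the projection fills the kernel: the sum is block diagonal, equal to
  \<open>T\<close> on the range of \<open>Q\<close> and to the identity on the range of the
  projection. The block on the range of \<open>Q\<close> can thus be inverted without choosing
  coordinates there.\<close>

lemma T_shift_bij:
  "bij_betw (\<lambda>f x. T f x + J0 (D0 f) x) (supp_funs W) (supp_funs W)"
proof (rule lin_transpose_inj_bij[OF finite_W T_shift_lin])
  fix f assume f: "f \<in> supp_funs W"
  have "J0 (D0 f) x = 0" if "x \<notin> W" for x
    using J0_D0_outside_W[OF supp_funs_mono[OF W_verts f] that] f that by (simp add: supp_funs_def)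
  then show "(\<lambda>x. T f x + J0 (D0 f) x) \<in> supp_funs W" using T_supp[of f] by (simp add: supp_funs_def)
qed (rule T_shift_adjoint_injective)

text \<open>The group inverse of \<open>T\<close>: it inverts \<open>T\<close> on the range of
  \<open>Q\<close> and annihilates the range of the spectral projection.\<close>

definition S :: "('v \<Rightarrow> complex) \<Rightarrow> 'v \<Rightarrow> complex" where
  "S h = (THE q. q \<in> supp_funs W \<and> D0 q = (\<lambda>R. 0) \<and> T q = Q h)"

text \<open>The bijective operator of \<open>T_shift_bij\<close> is solved for \<open>Q h\<close>;
  applying \<open>D0\<close> to the equation gives \<open>D0 q = 0\<close>, so the projection term
  drops out.\<close>

lemma S_ex1:
  assumes "h \<in> supp_funs V"
  shows "\<exists>!q. q \<in> supp_funs W \<and> D0 q = (\<lambda>R. 0) \<and> T q = Q h"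
proof -
  let ?N = "\<lambda>f x. T f x + J0 (D0 f) x"
  have "Q h \<in> ?N ` supp_funs W"
    using T_shift_bij Q_supp[OF assms] unfolding bij_betw_def by (metis (no_types, lifting))
  then obtain q where q: "q \<in> supp_funs W" "?N q = Q h" by (metis (no_types, lifting) imageE)
  have D: "D0 q = (\<lambda>R. 0)"
  proof (rule D0_eq_zeroI)
    fix R assume R: "R \<in> Reaches"
    have "D0 (Q h) = D0 (\<lambda>x. T q x + 1 * J0 (D0 q) x)" using q(2) by simp
    then have "0 = D0 (T q) R + 1 * D0 (J0 (D0 q)) R" unfolding D0_lin D0_Q by metis
    then show "D0 q R = 0" using D0_J0[OF R] by (simp add: D0_T)
  qed
  have P0: "J0 (D0 u) = (\<lambda>x. 0)" if "D0 u = (\<lambda>R. 0)" for u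
    unfolding that by (rule J0_zero)
  have Tq: "T q = Q h" using q(2) P0[OF D] by (simp add: fun_eq_iff)
  show ?thesis
  proof (rule ex1I[of _ q])
    show "q \<in> supp_funs W \<and> D0 q = (\<lambda>R. 0) \<and> T q = Q h" using q D Tq by blast
    fix p assume p: "p \<in> supp_funs W \<and> D0 p = (\<lambda>R. 0) \<and> T p = Q h"
    then have "?N p = ?N q" using P0[OF D] P0[of p] Tq by (simp add: fun_eq_iff)
    then show "p = q" using T_shift_bij p q(1) unfolding bij_betw_def inj_on_def by blast
  qed
qed

lemma S_spec:
  assumes "h \<in> supp_funs V"
  shows "S h \<in> supp_funs W" "D0 (S h) = (\<lambda>R. 0)" "T (S h) = Q h"
  using theI'[OF S_ex1[OF assms]] unfolding S_def by blast+

lemma S_unique: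
  assumes "h \<in> supp_funs V" "q \<in> supp_funs W" "D0 q = (\<lambda>R. 0)" "T q = Q h"
  shows "S h = q"
  unfolding S_def using assms by (intro the1_equality[OF S_ex1]) blast+

lemma S_lin: "lin_on (supp_funs V) S"
  unfolding lin_on_def
proof (intro ballI allI)
  fix f g c assume fg: "f \<in> supp_funs V" "g \<in> supp_funs V"
  note s = S_spec[OF fg(1)] S_spec[OF fg(2)]
  show "S (\<lambda>x. f x + c * g x) = (\<lambda>x. S f x + c * S g x)"
  proof (rule S_unique)
    show "(\<lambda>x. f x + c * g x) \<in> supp_funs V" using fg by (rule supp_funs_comb)
    show "(\<lambda>x. S f x + c * S g x) \<in> supp_funs W" using s(1,4) by (rule supp_funs_comb)
    show "D0 (\<lambda>x. S f x + c * S g x) = (\<lambda>R. 0)" unfolding D0_lin s by simp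
    show "T (\<lambda>x. S f x + c * S g x) = Q (\<lambda>x. f x + c * g x)" unfolding T_lin s Q_lin by simp
  qed
qed

text \<open>A reach meeting \<open>W\<close> lies inside \<open>W\<close>, so the values of
  \<open>f\<close> off \<open>W\<close> do not influence \<open>Q f\<close>.\<close>

lemma Q_cut:
  assumes f: "f \<in> supp_funs V" shows "Q (cut W f) = Q f"
proof
  fix x
  show "Q (cut W f) x = Q f x"
  proof (cases "x \<in> W")
    case True
    have "D0 (cut W f) R = D0 f R" if "R \<subseteq> W" for R
      using that by (auto simp: D0_def cut_def intro!: sum.cong)
    then have "J0 (D0 (cut W f)) x = J0 (D0 f) x"
      unfolding J0_on_W[OF True] by (intro sum.cong) auto
    then show ?thesis using True by (simp add: Q_def cut_def)
  next
    case False
    have "cut W f \<in> supp_funs V" using supp_funs_mono[OF W_verts cut_supp] .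
    then show ?thesis using Q_supp[of f] Q_supp[of "cut W f"] f False by (simp add: supp_funs_def)
  qed
qed

lemma S_cut:
  assumes f: "f \<in> supp_funs V" shows "S (cut W f) = S f"
  unfolding S_def Q_cut[OF f] ..

section \<open>Boundedness of operators that factor through the clusters\<close>

lemma supp_W_ell2: "f \<in> supp_funs W \<Longrightarrow> f \<in> ell2 G"
  by (rule supp_funs_ell2[OF finite_W W_verts])

text \<open>Such an operator factors through \<open>supp_funs W\<close>: restriction to a finite set
  of vertices of positive mass is bounded, and so is any linear map from a finite-dimensional
  space.\<close>

lemma cut_ell2_bounded:
  assumes lin: "lin_on (supp_funs W) A" and into: "\<And>f. f \<in> supp_funs W \<Longrightarrow> A f \<in> ell2 G"
    and cut: "\<And>f. f \<in> ell2 G \<Longrightarrow> A (cut W f) = A f"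
  shows "ell2_bounded G G A"
proof -
  obtain c where c: "c \<ge> 0" "\<And>f. f \<in> supp_funs W \<Longrightarrow> ell2_norm G (A f) \<le> c * l1_norm W f"
    using lin_ell2_bounded[OF nonneg_mass finite_W lin into] by blast
  obtain d where d: "d \<ge> 0" "\<And>f. f \<in> ell2 G \<Longrightarrow> l1_norm W f \<le> d * ell2_norm G f"
    using l1_norm_le_ell2_norm[OF nonneg_mass, of W] W_verts mass_pos by blast
  show ?thesis
  proof (rule ell2_boundedI[of "c * d"])
    fix f assume f: "f \<in> ell2 G"
    show "A f \<in> ell2 G" using into[OF cut_supp[of W f]] cut[OF f] by simp
    have "ell2_norm G (A f) \<le> c * l1_norm W f"
      using c(2)[OF cut_supp[of W f]] cut[OF f] by (simp add: l1_norm_cut)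
    also have "\<dots> \<le> c * (d * ell2_norm G f)" using c d f by (intro mult_left_mono) auto
    finally show "ell2_norm G (A f) \<le> c * d * ell2_norm G f" by (simp add: mult.assoc)
  qed (use c d in simp)
qed

lemma Q_bounded: "ell2_bounded G G Q"
proof (rule cut_ell2_bounded)
  show "lin_on (supp_funs W) Q" by (simp add: lin_on_def Q_lin)
  show "Q f \<in> ell2 G" if "f \<in> supp_funs W" for f
    using supp_W_ell2[OF Q_supp[OF supp_funs_mono[OF W_verts that]]] .
  show "Q (cut W f) = Q f" if "f \<in> ell2 G" for f using Q_cut[OF ell2_supp[OF that]] .
qed

lemma S_bounded: "ell2_bounded G G S"
proof (rule cut_ell2_bounded)
  have "supp_funs W \<subseteq> supp_funs V" using supp_funs_mono[OF W_verts] by blast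
  then show "lin_on (supp_funs W) S" by (rule lin_on_mono[OF S_lin])
  show "S f \<in> ell2 G" if "f \<in> supp_funs W" for f
    using supp_W_ell2[OF S_spec(1)[OF supp_funs_mono[OF W_verts that]]] .
  show "S (cut W f) = S f" if "f \<in> ell2 G" for f using S_cut[OF ell2_supp[OF that]] .
qed

lemma l1_ell2_bound:
  "\<exists>c\<ge>0. \<forall>f\<in>ell2 G. l1_norm W f \<le> c * ell2_norm G f"
  using W_verts mass_pos by (intro l1_norm_le_ell2_norm[OF nonneg_mass]) blast

end

section \<open>The Riesz projection and the reduced masses\<close>

lemma lin_on_inv_into:
  assumes M: "lin_on X M" "bij_betw M X X" and X: "\<And>f g c. f \<in> X \<Longrightarrow> g \<in> X \<Longrightarrow> (\<lambda>x. f x + c * g x) \<in> X"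
  shows "lin_on X (inv_into X M)"
  unfolding lin_on_def
proof (intro ballI allI)
  fix f g c assume fg: "f \<in> X" "g \<in> X"
  define u where "u = inv_into X M f"
  define v where "v = inv_into X M g"
  have im: "M ` X = X" and inj: "inj_on M X" using M(2) by (auto simp: bij_betw_def)
  have u: "u \<in> X" "M u = f" unfolding u_def using fg im inv_into_into[of f M X] f_inv_into_f[of f M X] by simp_all
  have v: "v \<in> X" "M v = g" unfolding v_def using fg im inv_into_into[of g M X] f_inv_into_f[of g M X] by simp_all
  have "M (\<lambda>x. u x + c * v x) = (\<lambda>x. f x + c * g x)" using lin_onD[OF M(1) u(1) v(1)] u v by simp
  from inv_into_f_eq[of M X, OF inj X[OF u(1) v(1), of c] this]
  show "inv_into X M (\<lambda>x. f x + c * g x) = (\<lambda>x. inv_into X M f x + c * inv_into X M g x)"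
    by (simp only: u_def v_def)
qed

text \<open>A bounded right inverse and injectivity determine the inverse. The identification with
  \<open>R\<close> is confined to \<open>ell2 G\<close>, because \<open>inv_into\<close> is
  arbitrary elsewhere.\<close>

lemma resolvent_setI:
  assumes G: "nonneg_mass G" and lin: "lin_on (ell2 G) (\<lambda>f x. A f x - z * f x)"
    and into: "\<And>f. f \<in> ell2 G \<Longrightarrow> A f \<in> ell2 G"
    and inj: "\<And>f. f \<in> ell2 G \<Longrightarrow> (\<lambda>x. A f x - z * f x) = (\<lambda>x. 0) \<Longrightarrow> f = (\<lambda>x. 0)"
    and R: "ell2_bounded G G R" "\<And>g. g \<in> ell2 G \<Longrightarrow> (\<lambda>x. A (R g) x - z * R g x) = g"
  shows "z \<in> resolvent_set G A" "\<And>g. g \<in> ell2 G \<Longrightarrow> resolvent G A z g = R g"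
proof -
  let ?A = "\<lambda>f x. A f x - z * f x"
  have inj_on: "inj_on ?A (ell2 G)"
  proof (rule inj_onI)
    fix f g assume fg: "f \<in> ell2 G" "g \<in> ell2 G" "?A f = ?A g"
    have "?A (\<lambda>x. f x - g x) = (\<lambda>x. ?A f x - ?A g x)" using lin_on_diff[OF lin fg(1,2)] by simp
    also have "\<dots> = (\<lambda>x. 0)" using fg(3) by (simp add: fun_eq_iff)
    finally have "(\<lambda>x. f x - g x) = (\<lambda>x. 0)" by (rule inj[OF ell2_diff[OF G fg(1,2)]])
    then show "f = g" by (simp add: fun_eq_iff)
  qed
  have RG: "R g \<in> ell2 G" if "g \<in> ell2 G" for g using ell2_bounded_mem[OF R(1) that] .
  have bij: "bij_betw ?A (ell2 G) (ell2 G)"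
    unfolding bij_betw_def
  proof (intro conjI inj_on equalityI subsetI)
    fix g assume "g \<in> ?A ` ell2 G"
    then show "g \<in> ell2 G" using into ell2_diff[OF G _ ell2_scale[OF G]] by auto
  next
    fix g assume g: "g \<in> ell2 G"
    show "g \<in> ?A ` ell2 G" by (rule image_eqI[of g ?A "R g", OF R(2)[OF g, symmetric] RG[OF g]])
  qed
  show res: "resolvent G A z g = R g" if "g \<in> ell2 G" for g
    unfolding resolvent_def op_inverse_def by (rule inv_into_f_eq[where f = ?A and x = "R g", OF inj_on RG[OF that] R(2)[OF that]])
  have "ell2_bounded G G (op_inverse G ?A)"
  proof -
    obtain c where c: "c \<ge> 0" "\<And>g. g \<in> ell2 G \<Longrightarrow> R g \<in> ell2 G"
      "\<And>g. g \<in> ell2 G \<Longrightarrow> ell2_norm G (R g) \<le> c * ell2_norm G g" using R(1) by (rule ell2_boundedE) blast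
    show ?thesis using c res by (intro ell2_boundedI[of c]) (simp_all add: resolvent_def)
  qed
  then show "z \<in> resolvent_set G A"
    unfolding resolvent_set_def op_norm_finite_iff using bij by blast
qed

context cluster_graph
begin

lemma T_ell2: "T f \<in> ell2 G"
  using T_supp by (rule supp_W_ell2)

lemma T_shift_linear: "lin_on X (\<lambda>f x. T f x - z * f x)"
  by (auto simp: lin_on_def T_lin fun_eq_iff algebra_simps)

lemma J0_D0_ell2: "f \<in> ell2 G \<Longrightarrow> J0 (D0 f) \<in> ell2 G"
proof -
  assume f: "f \<in> ell2 G"
  have "J0 (D0 f) = (\<lambda>x. f x - Q f x)" by (simp add: Q_def)
  then show ?thesis using ell2_diff[OF nonneg_mass f ell2_bounded_mem[OF Q_bounded f]] by simp
qed

lemma S_W: "lin_on (supp_funs W) S" "f \<in> supp_funs W \<Longrightarrow> S f \<in> supp_funs W"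
proof -
  have "supp_funs W \<subseteq> supp_funs V" using supp_funs_mono[OF W_verts] by blast
  then show "lin_on (supp_funs W) S" by (rule lin_on_mono[OF S_lin])
  show "f \<in> supp_funs W \<Longrightarrow> S f \<in> supp_funs W"
    using S_spec(1)[OF supp_funs_mono[OF W_verts]] .
qed

lemma D0_scale: "D0 (\<lambda>x. c * f x) = (\<lambda>R. c * D0 f R)"
  using D0_lin[of "\<lambda>x. 0" c f] by (simp add: D0_zero)

text \<open>On the range of the projection, \<open>T - \<zeta>\<close> is multiplication by
  \<open>- \<zeta>\<close>; on the range of \<open>Q\<close> it is \<open>T\<close> applied after
  \<open>1 - \<zeta> S\<close>. Hence the inverse is \<open>- 1 / \<zeta>\<close> times the
  projection plus the inverse of \<open>1 - \<zeta> S\<close> applied after \<open>S\<close>, which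
  exists for \<open>cmod \<zeta> \<le> 1 / c\<close>.\<close>

lemma T_resolvent_near_zero:
  "\<exists>\<epsilon>>0. \<forall>\<zeta>. \<zeta> \<noteq> 0 \<and> cmod \<zeta> \<le> \<epsilon> \<longrightarrow> \<zeta> \<in> resolvent_set G T"
proof -
  obtain c where c: "c > 0" and bij: "\<And>\<kappa>. cmod \<kappa> * c \<le> 1 \<Longrightarrow>
      bij_betw (\<lambda>q x. q x + \<kappa> * S q x) (supp_funs W) (supp_funs W)"
    using small_perturbation_bij[OF finite_W S_W] by blast
  have "\<zeta> \<in> resolvent_set G T" if \<zeta>: "\<zeta> \<noteq> 0" "cmod \<zeta> \<le> 1 / c" for \<zeta>
  proof -
    define M where "M = (\<lambda>q x. q x + (- \<zeta>) * S q x)"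
    define I where "I = inv_into (supp_funs W) M"
    have bM: "bij_betw M (supp_funs W) (supp_funs W)"
      unfolding M_def using \<zeta>(2) c by (intro bij) (simp add: field_simps)
    have linM: "lin_on (supp_funs W) M"
      unfolding M_def lin_on_def using lin_onD[OF S_W(1)] by (auto simp: fun_eq_iff algebra_simps)
    have linI: "lin_on (supp_funs W) I"
      unfolding I_def using linM bM supp_funs_comb by (rule lin_on_inv_into)
    have I: "I h \<in> supp_funs W" "M (I h) = h" if "h \<in> supp_funs W" for h
    proof -
      have im: "h \<in> M ` supp_funs W" using that bM by (simp add: bij_betw_def)
      show "I h \<in> supp_funs W" "M (I h) = h"
        unfolding I_def by (rule inv_into_into[OF im]) (rule f_inv_into_f[OF im])
    qed
    have SW: "S g \<in> supp_funs W" if "g \<in> ell2 G" for g using S_spec(1)[OF ell2_supp[OF that]] .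
    define R where "R = (\<lambda>g x. I (S g) x + (- 1 / \<zeta>) * (g x - Q g x))"
    have IS: "ell2_bounded G G (\<lambda>g. I (S g))"
    proof (rule cut_ell2_bounded)
      show "lin_on (supp_funs W) (\<lambda>g. I (S g))"
        using linI S_W unfolding lin_on_def by simp
      show "I (S f) \<in> ell2 G" if "f \<in> supp_funs W" for f
        using supp_W_ell2[OF I(1)[OF S_W(2)[OF that]]] .
      show "I (S (cut W f)) = I (S f)" if "f \<in> ell2 G" for f using S_cut[OF ell2_supp[OF that]] by simp
    qed
    show ?thesis
    proof (rule resolvent_setI(1)[OF nonneg_mass T_shift_linear T_ell2])
      show "ell2_bounded G G R"
        unfolding R_def
        by (intro ell2_bounded_comb[OF nonneg_mass IS] ell2_bounded_diff[OF nonneg_mass] ell2_bounded_id Q_bounded)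
      fix g assume g: "g \<in> ell2 G"
      define q where "q = I (S g)"
      have q: "q \<in> supp_funs W" "M q = S g" unfolding q_def using I[OF SW[OF g]] by auto
      have qV: "q \<in> supp_funs V" using supp_funs_mono[OF W_verts q(1)] .
      have qe: "q = (\<lambda>x. S g x + \<zeta> * S q x)" using q(2) by (auto simp: M_def fun_eq_iff algebra_simps)
      note Sg = S_spec[OF ell2_supp[OF g]] and Sq = S_spec[OF qV]
      have "D0 q = (\<lambda>R. D0 (S g) R + \<zeta> * D0 (S q) R)" by (subst qe) (rule D0_lin)
      then have "D0 q = (\<lambda>R. 0)" by (simp add: Sg Sq)
      then have Qq: "Q q = q" by (rule Q_id)
      have "T q = (\<lambda>x. T (S g) x + \<zeta> * T (S q) x)" by (subst qe) (rule T_lin)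
      then have Tq: "T q = (\<lambda>x. Q g x + \<zeta> * q x)" by (simp only: Sg Sq Qq)
      have Rg: "R g = (\<lambda>x. q x + (- 1 / \<zeta>) * J0 (D0 g) x)" by (simp add: R_def q_def Q_def)
      have "T (R g) = (\<lambda>x. T q x + (- 1 / \<zeta>) * T (J0 (D0 g)) x)" unfolding Rg by (rule T_lin)
      then have "T (R g) = T q" by (simp add: T_J0)
      then show "(\<lambda>x. T (R g) x - \<zeta> * R g x) = g"
        using \<zeta>(1) by (simp add: Rg Tq Q_def fun_eq_iff algebra_simps)
    next
      fix f assume f: "f \<in> ell2 G" "(\<lambda>x. T f x - \<zeta> * f x) = (\<lambda>x. 0)"
      then have Tf: "T f = (\<lambda>x. \<zeta> * f x)" by (simp add: fun_eq_iff)
      have "(\<lambda>R. 0) = (\<lambda>R. \<zeta> * D0 f R)" using D0_T[of f] unfolding Tf D0_scale by simp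
      then have D0f: "D0 f = (\<lambda>R. 0)" using \<zeta>(1) by (simp add: fun_eq_iff)
      have fW: "f \<in> supp_funs W" using Q_supp[OF ell2_supp[OF f(1)]] Q_id[OF D0f] by simp
      have sc: "(\<lambda>x. \<zeta> * f x) \<in> supp_funs V" using ell2_supp[OF f(1)] by (simp add: supp_funs_def)
      have D0sc: "D0 (\<lambda>x. \<zeta> * f x) = (\<lambda>R. 0)" unfolding D0_scale D0f by simp
      have "S (\<lambda>x. \<zeta> * f x) = f"
        using Tf Q_id[OF D0sc] by (intro S_unique[OF sc fW D0f]) simp
      moreover have "S (\<lambda>x. \<zeta> * f x) = (\<lambda>x. \<zeta> * S f x)"
        using S_W(1) fW zero_supp_funs by (rule lin_on_scale)
      ultimately have "M f = (\<lambda>x. 0)" by (simp add: M_def fun_eq_iff)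
      moreover have "M (\<lambda>x. 0) = (\<lambda>x. 0)" using linM zero_supp_funs by (rule lin_on_zero)
      ultimately show "f = (\<lambda>x. 0)"
        using bM fW zero_supp_funs unfolding bij_betw_def inj_on_def by metis
    qed
  qed
  then show ?thesis using c by (intro exI[of _ "1 / c"]) simp
qed

lemma zero_in_spectrum:
  assumes R: "R \<in> Reaches" shows "0 \<in> spectrum G T"
proof -
  define f where "f = J0 (\<lambda>S. if S = R then 1 else 0)"
  have f: "f x = of_real (rf R x)" for x unfolding f_def by (rule J0_delta[OF R])
  have "f \<in> supp_funs R" using rf_outside[OF R] by (auto simp: supp_funs_def f)
  then have fl: "f \<in> ell2 G" using supp_funs_ell2[of R] finite_reach[OF R] reach_verts[OF R] by blast
  have Tf: "T f = (\<lambda>x. 0)" unfolding f_def by (rule T_J0)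
  have T0: "T (\<lambda>x. 0) = (\<lambda>x. 0)" by (simp add: T_eq fun_eq_iff)
  have "D0 f R = 1" unfolding f_def using D0_J0[OF R] by simp
  then have "f \<noteq> (\<lambda>x. 0)" by (metis D0_zero zero_neq_one)
  have eq: "(\<lambda>x. T f x - 0 * f x) = (\<lambda>x. T (\<lambda>x. 0) x - 0 * (\<lambda>x. 0) x)" by (simp add: Tf T0)
  have "\<not> inj_on (\<lambda>f x. T f x - 0 * f x) (ell2 G)"
  proof
    assume "inj_on (\<lambda>f x. T f x - 0 * f x) (ell2 G)"
    from inj_onD[OF this eq fl zero_ell2] show False using \<open>f \<noteq> (\<lambda>x. 0)\<close> by simp
  qed
  then show ?thesis by (auto simp: spectrum_def resolvent_set_def bij_betw_def)
qed

text \<open>The reach guarantees a nonempty vertex set. On an empty one the spectrum would be empty,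
  and no radius would satisfy the condition under \<open>SOME\<close>.\<close>

lemma riesz_radius_spec:
  assumes "R \<in> Reaches"
  shows "riesz_radius G T > 0" "\<And>\<zeta>. \<zeta> \<noteq> 0 \<Longrightarrow> cmod \<zeta> \<le> riesz_radius G T \<Longrightarrow> \<zeta> \<in> resolvent_set G T"
proof -
  obtain \<epsilon> where e: "\<epsilon> > 0" "\<And>\<zeta>. \<zeta> \<noteq> 0 \<Longrightarrow> cmod \<zeta> \<le> \<epsilon> \<Longrightarrow> \<zeta> \<in> resolvent_set G T"
    using T_resolvent_near_zero by blast
  have "\<epsilon> > 0 \<and> spectrum G T \<inter> cball 0 \<epsilon> = {0}"
  proof (intro conjI e(1) equalityI subsetI)
    fix x assume x: "x \<in> spectrum G T \<inter> cball 0 \<epsilon>"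
    then have "x \<notin> resolvent_set G T" "cmod x \<le> \<epsilon>" by (simp_all add: spectrum_def)
    then have "x = 0" using e(2)[of x] by blast
    then show "x \<in> {0}" by simp
  next
    fix x :: complex assume "x \<in> {0}"
    then show "x \<in> spectrum G T \<inter> cball 0 \<epsilon>" using zero_in_spectrum[OF assms] e(1) by simp
  qed
  then have s: "riesz_radius G T > 0 \<and> spectrum G T \<inter> cball 0 (riesz_radius G T) = {0}"
    unfolding riesz_radius_def by (rule someI)
  then show "riesz_radius G T > 0" by blast
  show "\<zeta> \<in> resolvent_set G T" if "\<zeta> \<noteq> 0" "cmod \<zeta> \<le> riesz_radius G T" for \<zeta>
  proof (rule ccontr)
    assume "\<zeta> \<notin> resolvent_set G T"
    then have "\<zeta> \<in> spectrum G T \<inter> cball 0 (riesz_radius G T)" using that(2) by (simp add: spectrum_def)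
    then show False using s that(1) by blast
  qed
qed

text \<open>
  On the range of \<open>Q\<close>, which lies in a finite-dimensional space, the resolvent of \<open>T\<close> extends
  holomorphically to \<open>0\<close>; it is denoted by \<open>sol\<close>.
\<close>

definition is_sol :: "complex \<Rightarrow> ('v \<Rightarrow> complex) \<Rightarrow> ('v \<Rightarrow> complex) \<Rightarrow> bool" where
  "is_sol \<zeta> h u \<longleftrightarrow> u \<in> supp_funs W \<and> D0 u = (\<lambda>R. 0) \<and> (\<lambda>x. \<zeta> * u x - T u x) = Q h"

text \<open>The points at which the block of \<open>\<zeta> - T\<close> on the range of
  \<open>Q\<close> is invertible; by \<open>regular_zero\<close> they include 0, although
  \<open>T\<close> itself may have a kernel.\<close>

definition regular :: "complex \<Rightarrow> bool" where
  "regular \<zeta> \<longleftrightarrow> (\<forall>h\<in>supp_funs V. \<exists>!u. is_sol \<zeta> h u)"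

definition sol :: "complex \<Rightarrow> ('v \<Rightarrow> complex) \<Rightarrow> ('v \<Rightarrow> complex)" where
  "sol \<zeta> h = (THE u. is_sol \<zeta> h u)"

lemma sol_is_sol:
  assumes "regular \<zeta>" "h \<in> supp_funs V" shows "is_sol \<zeta> h (sol \<zeta> h)"
proof -
  have "\<exists>!u. is_sol \<zeta> h u" using assms unfolding regular_def by (rule bspec)
  then show ?thesis unfolding sol_def by (rule theI')
qed

lemma sol_eq:
  assumes "regular \<zeta>" "h \<in> supp_funs V" "is_sol \<zeta> h u" shows "sol \<zeta> h = u"
proof -
  have "\<exists>!u. is_sol \<zeta> h u" using assms(1,2) unfolding regular_def by (rule bspec)
  from the1_equality[where P = "is_sol \<zeta> h" and a = u, OF this assms(3)] show ?thesis by (simp add: sol_def)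
qed

lemma is_sol_comb:
  assumes u: "is_sol \<zeta> f u" and v: "is_sol \<zeta> g v"
  shows "is_sol \<zeta> (\<lambda>x. f x + c * g x) (\<lambda>x. u x + c * v x)"
  unfolding is_sol_def
proof (intro conjI)
  have U: "u \<in> supp_funs W" "D0 u = (\<lambda>R. 0)" "\<And>x. Q f x = \<zeta> * u x - T u x"
    using u unfolding is_sol_def by (simp_all add: fun_eq_iff)
  have V': "v \<in> supp_funs W" "D0 v = (\<lambda>R. 0)" "\<And>x. Q g x = \<zeta> * v x - T v x"
    using v unfolding is_sol_def by (simp_all add: fun_eq_iff)
  show "(\<lambda>x. u x + c * v x) \<in> supp_funs W" using U(1) V'(1) by (rule supp_funs_comb)
  show "D0 (\<lambda>x. u x + c * v x) = (\<lambda>R. 0)" unfolding D0_lin U(2) V'(2) by simp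
  show "(\<lambda>x. \<zeta> * (u x + c * v x) - T (\<lambda>x. u x + c * v x) x) = Q (\<lambda>x. f x + c * g x)"
    unfolding T_lin Q_lin U(3) V'(3) by (simp add: fun_eq_iff algebra_simps)
qed

lemma sol_lin:
  assumes "regular \<zeta>" shows "lin_on (supp_funs V) (sol \<zeta>)"
  unfolding lin_on_def
proof (intro ballI allI)
  fix f g c assume f: "f \<in> supp_funs V" and g: "g \<in> supp_funs V"
  show "sol \<zeta> (\<lambda>x. f x + c * g x) = (\<lambda>x. sol \<zeta> f x + c * sol \<zeta> g x)"
    using sol_eq[OF assms supp_funs_comb[OF f g]
        is_sol_comb[OF sol_is_sol[OF assms f] sol_is_sol[OF assms g]]] .
qed

lemma regular_zero: "regular 0"
  unfolding regular_def
proof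
  fix h assume h: "h \<in> supp_funs V"
  have neg: "(\<lambda>x. - h x) \<in> supp_funs V" using h by (simp add: supp_funs_def)
  have "Q (\<lambda>x. 0) = (\<lambda>x. 0)" by (rule Q_id) (rule D0_zero)
  then have Qneg: "Q (\<lambda>x. - h x) = (\<lambda>x. - Q h x)" using Q_lin[of "\<lambda>x. 0" "-1" h] by simp
  have "is_sol 0 h u \<longleftrightarrow> u \<in> supp_funs W \<and> D0 u = (\<lambda>R. 0) \<and> T u = Q (\<lambda>x. - h x)" for u
    unfolding is_sol_def Qneg by (auto simp: fun_eq_iff minus_equation_iff)
  then show "\<exists>!u. is_sol 0 h u" using S_ex1[OF neg] by simp
qed

text \<open>Applying \<open>D0\<close> to the equation gives \<open>\<zeta> * D0 u = 0\<close>, so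
  the solution found in \<open>ell2 G\<close> already lies in the range of \<open>Q\<close>.\<close>

lemma regular_resolvent:
  assumes z: "\<zeta> \<noteq> 0" "\<zeta> \<in> resolvent_set G T" shows "regular \<zeta>"
  unfolding regular_def
proof
  fix h assume h: "h \<in> supp_funs V"
  let ?A = "\<lambda>f x. T f x - \<zeta> * f x"
  have bij: "bij_betw ?A (ell2 G) (ell2 G)" using z by (simp add: resolvent_set_def)
  have "(\<lambda>x. - Q h x) \<in> supp_funs W" using Q_supp[OF h] by (simp add: supp_funs_def)
  then have "(\<lambda>x. - Q h x) \<in> ?A ` ell2 G" using bij supp_W_ell2 unfolding bij_betw_def by blast
  then obtain u where u: "u \<in> ell2 G" "?A u = (\<lambda>x. - Q h x)" by auto
  have eq: "(\<lambda>x. \<zeta> * u x - T u x) = Q h" using u(2) by (auto simp: fun_eq_iff algebra_simps)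
  have "Q h = (\<lambda>x. \<zeta> * u x + (-1) * T u x)" using eq by (simp add: fun_eq_iff)
  then have "D0 (Q h) = (\<lambda>R. D0 (\<lambda>x. \<zeta> * u x) R + (-1) * D0 (T u) R)" by (simp only: D0_lin)
  then have "D0 (\<lambda>x. \<zeta> * u x) = (\<lambda>R. 0)" by (simp add: D0_Q D0_T)
  then have D: "D0 u = (\<lambda>R. 0)" using z(1) unfolding D0_scale by (simp add: fun_eq_iff)
  have "u \<in> supp_funs W" using Q_supp[OF ell2_supp[OF u(1)]] Q_id[OF D] by simp
  then have "is_sol \<zeta> h u" using D eq by (simp add: is_sol_def)
  moreover have "v = u" if v: "is_sol \<zeta> h v" for v
  proof -
    have "v \<in> ell2 G" using v supp_W_ell2 by (simp add: is_sol_def)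
    moreover have "?A v = ?A u" using v eq by (auto simp: is_sol_def fun_eq_iff algebra_simps)
    ultimately show ?thesis using bij u(1) unfolding bij_betw_def inj_on_def by blast
  qed
  ultimately show "\<exists>!u. is_sol \<zeta> h u" by blast
qed

text \<open>By the first resolvent identity, called \<open>step\<close> below, the difference
  quotient at \<open>\<zeta>0\<close> is minus \<open>sol \<zeta>0\<close> applied to
  \<open>sol \<zeta> h\<close>, so continuity in \<open>\<zeta>\<close> suffices. The derivative is
  taken within \<open>X\<close> because regularity is known only there, later on a closed
  disc.\<close>

lemma sol_has_derivative:
  assumes X: "\<And>\<zeta>. \<zeta> \<in> X \<Longrightarrow> regular \<zeta>" and \<zeta>0: "\<zeta>0 \<in> X" and h: "h \<in> supp_funs V"
  shows "((\<lambda>\<zeta>. sol \<zeta> h x) has_field_derivative - sol \<zeta>0 (sol \<zeta>0 h) x) (at \<zeta>0 within X)"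
proof -
  define K where "K = sol \<zeta>0"
  define u where "u = (\<lambda>\<zeta>. sol \<zeta> h)"
  have reg: "regular \<zeta>0" using X \<zeta>0 by blast
  have WV: "f \<in> supp_funs V" if "f \<in> supp_funs W" for f using supp_funs_mono[OF W_verts that] .
  have linV: "lin_on (supp_funs V) K" unfolding K_def using sol_lin[OF reg] .
  have linW: "lin_on (supp_funs W) K" using lin_on_mono[OF linV] WV by blast
  have KW: "K f \<in> supp_funs W" if "f \<in> supp_funs V" for f
    using sol_is_sol[OF reg that] by (simp add: is_sol_def K_def)
  have uW: "u \<zeta> \<in> supp_funs W" "D0 (u \<zeta>) = (\<lambda>R. 0)" "\<And>x. \<zeta> * u \<zeta> x - T (u \<zeta>) x = Q h x" if "\<zeta> \<in> X" for \<zeta>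
    using sol_is_sol[OF X[OF that] h] by (simp_all add: is_sol_def u_def fun_eq_iff)
  have u0: "u \<zeta>0 = K h" by (simp add: u_def K_def)
  have step: "u \<zeta> = (\<lambda>x. K h x + (\<zeta>0 - \<zeta>) * K (u \<zeta>) x)" if \<zeta>: "\<zeta> \<in> X" for \<zeta>
  proof -
    let ?g = "\<lambda>x. h x + (\<zeta>0 - \<zeta>) * u \<zeta> x"
    note v = uW[OF \<zeta>]
    have g: "?g \<in> supp_funs V" using h WV[OF v(1)] by (rule supp_funs_comb)
    have "is_sol \<zeta>0 ?g (u \<zeta>)"
    proof -
      have "\<zeta>0 * u \<zeta> x - T (u \<zeta>) x = Q h x + (\<zeta>0 - \<zeta>) * u \<zeta> x" for x
        using v(3)[of x] by (simp add: algebra_simps)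
      then show ?thesis using v(1,2) Q_id[OF v(2)] by (simp add: is_sol_def Q_lin)
    qed
    then have "u \<zeta> = K ?g" unfolding K_def using sol_eq[OF reg g] by simp
    also have "\<dots> = (\<lambda>x. K h x + (\<zeta>0 - \<zeta>) * K (u \<zeta>) x)" using lin_onD[OF linV h WV[OF v(1)]] .
    finally show ?thesis .
  qed
  obtain c where c: "c > 0" "\<And>\<kappa> q. cmod \<kappa> * c \<le> 1 \<Longrightarrow> q \<in> supp_funs W \<Longrightarrow>
      l1_norm W q \<le> 2 * l1_norm W (\<lambda>x. q x + \<kappa> * K q x)"
    using small_perturbation_bij[OF finite_W linW KW[OF WV]] by blast
  \<comment> \<open>The identity \<open>step\<close> reads
    \<open>u \<zeta> + (\<zeta> - \<zeta>0) K (u \<zeta>) = K h\<close>, so the perturbation bound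
    controls \<open>u\<close> uniformly near \<open>\<zeta>0\<close>.\<close>
  have bound: "l1_norm W (u \<zeta>) \<le> 2 * l1_norm W (K h)" if \<zeta>: "\<zeta> \<in> X" "dist \<zeta> \<zeta>0 < 1 / c" for \<zeta>
  proof -
    have "cmod (\<zeta> - \<zeta>0) * c \<le> 1" using \<zeta>(2) c(1) by (simp add: dist_norm field_simps)
    then have "l1_norm W (u \<zeta>) \<le> 2 * l1_norm W (\<lambda>x. u \<zeta> x + (\<zeta> - \<zeta>0) * K (u \<zeta>) x)"
      using c(2) uW(1)[OF \<zeta>(1)] by blast
    moreover have "(\<lambda>x. u \<zeta> x + (\<zeta> - \<zeta>0) * K (u \<zeta>) x) = K h"
      using fun_cong[OF step[OF \<zeta>(1)]] by (simp add: fun_eq_iff algebra_simps)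
    ultimately show ?thesis by simp
  qed
  have near: "\<forall>\<^sub>F \<zeta> in at \<zeta>0 within X. \<zeta> \<in> X \<and> dist \<zeta> \<zeta>0 < 1 / c"
    unfolding eventually_at using c(1) by (intro exI[of _ "1 / c"]) auto
  have cont: "((\<lambda>\<zeta>. u \<zeta> y) \<longlongrightarrow> u \<zeta>0 y) (at \<zeta>0 within X)" for y
  proof -
    obtain d where d: "d > 0" "\<And>f. f \<in> supp_funs W \<Longrightarrow> l1_norm {y} (K f) \<le> d * l1_norm W f"
      using lin_l1_bounded[OF finite_W linW] by blast
    have "cmod (u \<zeta> y - u \<zeta>0 y) \<le> cmod (\<zeta> - \<zeta>0) * (d * (2 * l1_norm W (K h)))"
      if \<zeta>: "\<zeta> \<in> X \<and> dist \<zeta> \<zeta>0 < 1 / c" for \<zeta>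
    proof -
      have "u \<zeta> y - u \<zeta>0 y = (\<zeta>0 - \<zeta>) * K (u \<zeta>) y"
        using fun_cong[OF step[of \<zeta>], of y] \<zeta> u0 by simp
      then have "cmod (u \<zeta> y - u \<zeta>0 y) = cmod (\<zeta> - \<zeta>0) * cmod (K (u \<zeta>) y)"
        by (simp add: norm_mult norm_minus_commute)
      also have "cmod (K (u \<zeta>) y) \<le> d * l1_norm W (u \<zeta>)"
        using d(2)[OF uW(1)[of \<zeta>]] \<zeta> by (simp add: l1_norm_def)
      also have "\<dots> \<le> d * (2 * l1_norm W (K h))"
        using bound[of \<zeta>] \<zeta> d(1) by (intro mult_left_mono) auto
      finally show ?thesis by (simp add: mult_left_mono)
    qed
    then have ev: "\<forall>\<^sub>F \<zeta> in at \<zeta>0 within X. norm (u \<zeta> y - u \<zeta>0 y) \<le> cmod (\<zeta> - \<zeta>0) * (d * (2 * l1_norm W (K h)))"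
      using near by (auto elim: eventually_mono)
    have "((\<lambda>\<zeta>. cmod (\<zeta> - \<zeta>0) * (d * (2 * l1_norm W (K h)))) \<longlongrightarrow> cmod (\<zeta>0 - \<zeta>0) * (d * (2 * l1_norm W (K h)))) (at \<zeta>0 within X)"
      by (intro tendsto_intros)
    then have "((\<lambda>\<zeta>. u \<zeta> y - u \<zeta>0 y) \<longlongrightarrow> 0) (at \<zeta>0 within X)"
      using Lim_null_comparison[OF ev] by simp
    then show ?thesis by (simp add: LIM_zero_iff)
  qed
  have "((\<lambda>\<zeta>. - (\<Sum>y\<in>W. u \<zeta> y * K (delta_fun y) x)) \<longlongrightarrow> - (\<Sum>y\<in>W. u \<zeta>0 y * K (delta_fun y) x))
      (at \<zeta>0 within X)"
    by (intro tendsto_intros cont)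
  then have lim: "((\<lambda>\<zeta>. - (\<Sum>y\<in>W. u \<zeta> y * K (delta_fun y) x)) \<longlongrightarrow> - K (u \<zeta>0) x) (at \<zeta>0 within X)"
    using lin_on_expand[OF finite_W linW uW(1)[OF \<zeta>0]] by simp
  have ev: "\<forall>\<^sub>F \<zeta> in at \<zeta>0 within X.
      - (\<Sum>y\<in>W. u \<zeta> y * K (delta_fun y) x) = (u \<zeta> x - u \<zeta>0 x) / (\<zeta> - \<zeta>0)"
    unfolding eventually_at_filter
  proof (rule always_eventually, intro allI impI)
    fix \<zeta> assume \<zeta>: "\<zeta> \<noteq> \<zeta>0" "\<zeta> \<in> X"
    have "u \<zeta> x - u \<zeta>0 x = (\<zeta>0 - \<zeta>) * K (u \<zeta>) x"
      using fun_cong[OF step[OF \<zeta>(2)], of x] u0 by simp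
    then have "(u \<zeta> x - u \<zeta>0 x) / (\<zeta> - \<zeta>0) = - K (u \<zeta>) x"
      using \<zeta>(1) by (simp add: field_simps)
    then show "- (\<Sum>y\<in>W. u \<zeta> y * K (delta_fun y) x) = (u \<zeta> x - u \<zeta>0 x) / (\<zeta> - \<zeta>0)"
      using lin_on_expand[OF finite_W linW uW(1)[OF \<zeta>(2)]] by simp
  qed
  from Lim_transform_eventually[OF lim ev]
  have "((\<lambda>\<zeta>. (u \<zeta> x - u \<zeta>0 x) / (\<zeta> - \<zeta>0)) \<longlongrightarrow> - K (u \<zeta>0) x) (at \<zeta>0 within X)" .
  then show ?thesis unfolding has_field_derivative_iff u_def K_def .
qed

text \<open>On the circle the inverse of \<open>\<zeta> - T\<close> applied to \<open>f\<close> is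
  \<open>sol \<zeta> f\<close> plus \<open>1 / \<zeta>\<close> times \<open>J0 (D0 f)\<close>, that
  is \<open>F \<zeta> / \<zeta>\<close> at the point \<open>x\<close>. As \<open>F\<close> is
  holomorphic on the whole disc, Cauchy's formula returns \<open>F 0\<close>, the
  projection.\<close>

lemma riesz_projection_eq:
  assumes R: "R \<in> Reaches" and f: "f \<in> ell2 G"
  shows "riesz_projection G T f x = J0 (D0 f) x"
proof -
  define \<rho> where "\<rho> = riesz_radius G T"
  have \<rho>: "\<rho> > 0" "\<And>\<zeta>. \<zeta> \<noteq> 0 \<Longrightarrow> cmod \<zeta> \<le> \<rho> \<Longrightarrow> \<zeta> \<in> resolvent_set G T"
    unfolding \<rho>_def using riesz_radius_spec[OF R] by blast+
  have fV: "f \<in> supp_funs V" using f by (rule ell2_supp)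
  have reg: "regular \<zeta>" if "\<zeta> \<in> cball 0 \<rho>" for \<zeta>
  proof (cases "\<zeta> = 0")
    case True
    then show ?thesis by (simp add: regular_zero)
  next
    case False
    have "cmod \<zeta> \<le> \<rho>" using that by simp
    then show ?thesis using regular_resolvent[OF False] \<rho>(2)[OF False] by blast
  qed
  define F where "F = (\<lambda>\<zeta>. J0 (D0 f) x + \<zeta> * sol \<zeta> f x)"
  have "(\<lambda>\<zeta>. sol \<zeta> f x) holomorphic_on cball 0 \<rho>"
    unfolding holomorphic_on_def
  proof
    fix \<zeta> :: complex assume z: "\<zeta> \<in> cball 0 \<rho>"
    have "((\<lambda>\<zeta>. sol \<zeta> f x) has_field_derivative - sol \<zeta> (sol \<zeta> f) x) (at \<zeta> within cball 0 \<rho>)"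
      by (rule sol_has_derivative) (use reg z fV in blast)+
    then show "(\<lambda>\<zeta>. sol \<zeta> f x) field_differentiable at \<zeta> within cball 0 \<rho>"
      unfolding field_differentiable_def by blast
  qed
  then have "F holomorphic_on cball 0 \<rho>" unfolding F_def by (intro holomorphic_intros)
  from Cauchy_integral_circlepath_simple[OF this, of 0]
  have int: "((\<lambda>\<zeta>. F \<zeta> / \<zeta>) has_contour_integral (2 * of_real pi * \<i> * J0 (D0 f) x)) (circlepath 0 \<rho>)"
    using \<rho>(1) by (simp add: F_def)
  have inv: "op_inverse G (\<lambda>g y. \<zeta> * g y - T g y) f x = F \<zeta> / \<zeta>" if \<zeta>: "cmod \<zeta> = \<rho>" for \<zeta>
  proof -
    have z0: "\<zeta> \<noteq> 0" using \<zeta> \<rho>(1) by auto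
    have rg: "regular \<zeta>" using reg \<zeta> by simp
    have "bij_betw (\<lambda>f x. T f x - \<zeta> * f x) (ell2 G) (ell2 G)"
      using \<rho>(2)[OF z0] \<zeta> by (simp add: resolvent_set_def)
    then have injT: "inj_on (\<lambda>f x. T f x - \<zeta> * f x) (ell2 G)" by (simp add: bij_betw_def)
    have inj: "inj_on (\<lambda>g y. \<zeta> * g y - T g y) (ell2 G)"
    proof (rule inj_onI)
      fix g k assume gk: "g \<in> ell2 G" "k \<in> ell2 G" "(\<lambda>y. \<zeta> * g y - T g y) = (\<lambda>y. \<zeta> * k y - T k y)"
      have "T g y - \<zeta> * g y = T k y - \<zeta> * k y" for y
        using fun_cong[OF gk(3), of y] by (simp add: algebra_simps)
      then have "(\<lambda>y. T g y - \<zeta> * g y) = (\<lambda>y. T k y - \<zeta> * k y)" ..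
      then show "g = k" using injT gk(1,2) unfolding inj_on_def by blast
    qed
    have s: "is_sol \<zeta> f (sol \<zeta> f)" using sol_is_sol[OF rg fV] .
    define w where "w = (\<lambda>x. sol \<zeta> f x + (1 / \<zeta>) * J0 (D0 f) x)"
    have wl: "w \<in> ell2 G"
      unfolding w_def using s J0_D0_ell2[OF f] supp_W_ell2
      by (intro ell2_comb[OF nonneg_mass]) (auto simp: is_sol_def)
    have "T w = (\<lambda>y. T (sol \<zeta> f) y + (1 / \<zeta>) * T (J0 (D0 f)) y)" unfolding w_def by (rule T_lin)
    then have Tw: "T w = T (sol \<zeta> f)" by (simp add: T_J0)
    have "\<zeta> * w y - T w y = f y" for y
    proof -
      have "\<zeta> * sol \<zeta> f y - T (sol \<zeta> f) y = Q f y" using s unfolding is_sol_def by metis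
      then show ?thesis using z0 unfolding Tw by (simp add: w_def Q_def algebra_simps)
    qed
    then have "op_inverse G (\<lambda>g y. \<zeta> * g y - T g y) f = w"
      unfolding op_inverse_def by (intro inv_into_f_eq[where x = w, OF inj wl]) simp
    then show ?thesis using z0 by (simp add: w_def F_def add_divide_distrib)
  qed
  have "contour_integral (circlepath 0 \<rho>) (\<lambda>\<zeta>. op_inverse G (\<lambda>g y. \<zeta> * g y - T g y) f x)
      = contour_integral (circlepath 0 \<rho>) (\<lambda>\<zeta>. F \<zeta> / \<zeta>)"
    using \<rho>(1) inv by (intro contour_integral_eq) (auto simp: path_image_circlepath)
  also have "\<dots> = 2 * of_real pi * \<i> * J0 (D0 f) x" using int by (rule contour_integral_unique)
  finally show ?thesis unfolding riesz_projection_def \<rho>_def by simp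
qed

lemma char_fun_ell2: "R \<in> Reaches \<Longrightarrow> char_fun R \<in> ell2 G"
  using supp_funs_ell2[of R G "char_fun R"] finite_reach[of R] reach_verts[of R]
  by (auto simp: char_fun_def supp_funs_def)

section \<open>The reduced masses as masses of the left kernel vectors\<close>

abbreviation "rm \<equiv> red_mass G Et"

text \<open>At points of \<open>R\<close> the right kernel vectors of all other reaches vanish, so
  only the \<open>R\<close> component of the projected indicator survives. The normalisation
  \<open>rf_mass\<close> then removes \<open>rf R\<close>.\<close>

lemma red_mass_eq:
  assumes R: "R \<in> Reaches" shows "rm R = (\<Sum>x\<in>R. lf R x * m x)"
proof -
  define P where "P = J0 (D0 (char_fun R))"
  have "ell2_inner G (char_fun R) (riesz_projection G T (char_fun R))
      = (\<Sum>\<^sub>\<infinity>x\<in>V. cnj (char_fun R x) * P x * of_real (m x))"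
    by (simp add: ell2_inner_def riesz_projection_eq[OF R char_fun_ell2[OF R]] P_def)
  also have "\<dots> = (\<Sum>x\<in>R. cnj (char_fun R x) * P x * of_real (m x))"
    using finite_reach[OF R] reach_verts[OF R] by (intro infsum_restrict) (auto simp: char_fun_def)
  also have "\<dots> = (\<Sum>x\<in>R. of_real (rf R x * m x) * D0 (char_fun R) R)"
  proof (rule sum.cong[OF refl])
    fix x assume x: "x \<in> R"
    have "of_real (rf S x) * D0 (char_fun R) S = 0" if "S \<in> Reaches" "x \<in> S" "S \<noteq> R" for S
      using rf_zero[OF that(1), of x] root_unique_reach[OF _ R x, of S] that by auto
    then have "P x = (\<Sum>S\<in>{S \<in> Reaches. x \<in> S}. if S = R then of_real (rf R x) * D0 (char_fun R) R else 0)"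
      unfolding P_def J0_def by (intro sum.cong) auto
    then have "P x = of_real (rf R x) * D0 (char_fun R) R"
      using finite_reaches_at R x by (simp add: sum.delta)
    then show "cnj (char_fun R x) * P x * of_real (m x) = of_real (rf R x * m x) * D0 (char_fun R) R"
      using x by (simp add: char_fun_def)
  qed
  also have "\<dots> = of_real (\<Sum>x\<in>R. rf R x * m x) * D0 (char_fun R) R" by (simp add: sum_distrib_right)
  also have "\<dots> = D0 (char_fun R) R" using rf_mass[OF R] by simp
  also have "\<dots> = of_real (\<Sum>x\<in>R. lf R x * m x)" using R by (simp add: D0_def char_fun_def)
  finally show ?thesis by (simp add: red_mass_def)
qed

lemma red_mass_pos:
  assumes R: "R \<in> Reaches" shows "rm R > 0"
proof -
  obtain r where r: "r \<in> roots R" using roots_nonempty[OF R] by blast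
  have "0 < (\<Sum>x\<in>R. lf R x * m x)"
  proof (rule sum_pos2[of _ r])
    show "0 < lf R r * m r" using lf_root[OF R r] mass_pos roots_mem[OF r] by simp
    show "0 \<le> lf R x * m x" if "x \<in> R" for x
      using lf_nonneg[OF R] mass_pos[OF reach_verts[OF R that]] by (simp add: less_imp_le)
  qed (use finite_reach[OF R] roots_mem[OF r] in auto)
  then show ?thesis by (simp add: red_mass_eq[OF R])
qed

end

section \<open>The transfer operators\<close>

context cluster_graph
begin

abbreviation "red \<equiv> reduced_graph G Et"

lemma red_simps: "verts red = Reaches" "mass red = rm" "weight red = red_weight G Et"
  by (simp_all add: reduced_graph_def Let_def)

lemma nonneg_mass_red: "nonneg_mass red"
  using red_mass_pos by (auto simp: nonneg_mass_def red_simps less_imp_le)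

lemma J_down_eq: "J_down G Et f R = D0 f R / of_real (rm R)"
proof (cases "R \<in> Reaches")
  case R: True
  have "ell2_inner G (gamma_left G Et R) f = (\<Sum>x\<in>R. cnj (gamma_left G Et R x) * f x * of_real (m x))"
    unfolding ell2_inner_def using finite_reach[OF R] reach_verts[OF R] gamma_left_spec(3)[OF R]
    by (intro infsum_restrict) auto
  also have "\<dots> = D0 f R" using R by (simp add: D0_def gamma_left_real[OF R] mult_ac)
  finally show ?thesis using R by (simp add: J_down_def red_simps)
qed (simp add: J_down_def red_simps D0_def)

lemma J_up_eq: "J_up G Et g = J0 (\<lambda>R. of_real (rm R) * g R)"
proof
  fix x
  have "J_up G Et g x = (\<Sum>\<^sub>\<infinity>R\<in>Reaches. of_real (rm R) * g R * of_real (rf R x))"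
    by (simp add: J_up_def red_simps)
  also have "\<dots> = (\<Sum>R\<in>{R \<in> Reaches. x \<in> R}. of_real (rm R) * g R * of_real (rf R x))"
    using rf_outside by (intro infsum_restrict finite_reaches_at) auto
  finally show "J_up G Et g x = J0 (\<lambda>R. of_real (rm R) * g R) x" by (simp add: J0_def mult_ac)
qed

lemma J_up_J_down: "J_up G Et (J_down G Et f) = J0 (D0 f)"
  unfolding J_up_eq J_down_eq
proof (rule J0_cong)
  fix R assume "R \<in> Reaches"
  then have "rm R \<noteq> 0" using red_mass_pos[of R] by simp
  then show "of_real (rm R) * (D0 f R / of_real (rm R)) = D0 f R" by simp
qed

lemma J_down_J_up:
  assumes "R \<in> Reaches" shows "J_down G Et (J_up G Et g) R = g R"
  using red_mass_pos[OF assms] by (simp add: J_down_eq J_up_eq D0_J0[OF assms])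

lemma J_down_lin: "J_down G Et (\<lambda>x. f x + c * g x) = (\<lambda>R. J_down G Et f R + c * J_down G Et g R)"
  by (simp add: fun_eq_iff J_down_eq D0_lin add_divide_distrib)

lemma J_up_lin: "J_up G Et (\<lambda>x. f x + c * g x) = (\<lambda>x. J_up G Et f x + c * J_up G Et g x)"
proof -
  have "(\<lambda>R. of_real (rm R) * (f R + c * g R)) = (\<lambda>R. of_real (rm R) * f R + c * (of_real (rm R) * g R))"
    by (simp add: fun_eq_iff algebra_simps)
  then show ?thesis unfolding J_up_eq by (simp only: J0_lin)
qed

lemma lf_sum_le:
  assumes "finite F" "F \<subseteq> Reaches" "x \<in> V" shows "(\<Sum>R\<in>F. lf R x) \<le> 1"
proof -
  have "(\<Sum>R\<in>F. lf R x) \<le> (\<Sum>R\<in>F \<union> {R \<in> Reaches. x \<in> R}. lf R x)"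
    using assms finite_reaches_at lf_nonneg by (intro sum_mono2) auto
  also have "\<dots> = (\<Sum>R\<in>{R \<in> Reaches. x \<in> R}. lf R x)"
    using assms finite_reaches_at lf_outside by (intro sum.mono_neutral_right) auto
  also have "\<dots> = 1" using lf_sum assms by simp
  finally show ?thesis .
qed

text \<open>Since the left kernel vectors sum to 1, \<open>J_down\<close> is a contraction.\<close>

lemma J_down_bounded: "ell2_bounded G red (J_down G Et)"
proof -
  have main: "(\<Sum>R\<in>F. (cmod (J_down G Et f R))\<^sup>2 * rm R) \<le> (ell2_norm G f)\<^sup>2"
    if f: "f \<in> ell2 G" and F: "finite F" "F \<subseteq> Reaches" for f F
  proof -
    define X where "X = \<Union>F"
    have X: "finite X" "X \<subseteq> V" unfolding X_def using F finite_reach reach_verts by auto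
    have one: "(cmod (J_down G Et f R))\<^sup>2 * rm R \<le> (\<Sum>x\<in>X. lf R x * (m x * (cmod (f x))\<^sup>2))"
      if RF: "R \<in> F" for R
    proof -
      have R: "R \<in> Reaches" using F RF by blast
      have pos: "rm R > 0" using red_mass_pos[OF R] .
      \<comment> \<open>The total weight in Cauchy-Schwarz is \<open>rm R\<close>, which cancels
        against the normalisation of \<open>J_down\<close>.\<close>
      have "(cmod (D0 f R))\<^sup>2 \<le> (\<Sum>x\<in>R. lf R x * m x) * (\<Sum>x\<in>R. lf R x * m x * (cmod (f x))\<^sup>2)"
        using R lf_nonneg[OF R] mass_pos reach_verts[OF R] unfolding D0_def
        by (simp del: of_real_mult) (intro cmod_weighted_sum_squared, simp add: less_imp_le)
      then have le: "(cmod (D0 f R))\<^sup>2 \<le> rm R * (\<Sum>x\<in>R. lf R x * m x * (cmod (f x))\<^sup>2)"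
        by (simp add: red_mass_eq[OF R])
      have "(cmod (J_down G Et f R))\<^sup>2 * rm R = (cmod (D0 f R))\<^sup>2 / rm R"
        using pos by (simp add: J_down_eq norm_divide power_divide power2_eq_square)
      also have "\<dots> \<le> rm R * (\<Sum>x\<in>R. lf R x * m x * (cmod (f x))\<^sup>2) / rm R"
        using le pos by (intro divide_right_mono) auto
      also have "\<dots> = (\<Sum>x\<in>R. lf R x * (m x * (cmod (f x))\<^sup>2))" using pos by (simp add: mult.assoc)
      also have "\<dots> = (\<Sum>x\<in>X. lf R x * (m x * (cmod (f x))\<^sup>2))"
        using X RF lf_outside[OF R] by (intro sum.mono_neutral_left) (auto simp: X_def)
      finally show ?thesis .
    qed
    have "(\<Sum>R\<in>F. (cmod (J_down G Et f R))\<^sup>2 * rm R) \<le> (\<Sum>R\<in>F. \<Sum>x\<in>X. lf R x * (m x * (cmod (f x))\<^sup>2))"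
      by (intro sum_mono one)
    also have "\<dots> = (\<Sum>x\<in>X. (\<Sum>R\<in>F. lf R x) * (m x * (cmod (f x))\<^sup>2))"
      by (subst sum.swap) (simp add: sum_distrib_right)
    also have "\<dots> \<le> (\<Sum>x\<in>X. 1 * (m x * (cmod (f x))\<^sup>2))"
    proof (intro sum_mono mult_right_mono)
      fix x assume "x \<in> X"
      then have xV: "x \<in> V" using X by blast
      show "(\<Sum>R\<in>F. lf R x) \<le> 1" using lf_sum_le[OF F xV] .
      show "0 \<le> m x * (cmod (f x))\<^sup>2" using mass_pos[OF xV] by simp
    qed
    also have "\<dots> = (\<Sum>x\<in>X. (cmod (f x))\<^sup>2 * m x)" by (simp add: mult.commute)
    also have "\<dots> \<le> (ell2_norm G f)\<^sup>2" using ell2_finite_sum_le[OF nonneg_mass f X] .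
    finally show ?thesis .
  qed
  have z: "J_down G Et f R = 0" if "R \<notin> verts red" for f R
    using that by (simp add: J_down_eq D0_def red_simps)
  have *: "(\<Sum>R\<in>F. (cmod (J_down G Et f R))\<^sup>2 * mass red R) \<le> (ell2_norm G f)\<^sup>2"
    if "f \<in> ell2 G" "finite F" "F \<subseteq> verts red" for f F
    using main[OF that(1,2)] that(3) by (simp add: red_simps)
  show ?thesis
    using ell2I[OF nonneg_mass_red z * ell2_norm_nonneg[OF nonneg_mass]]
    by (intro ell2_boundedI[of 1]) simp_all
qed

text \<open>At each vertex at most one summand of \<open>J0\<close> is nonzero, since the root
  classes are disjoint; no constant depending on the number of reaches arises.\<close>

lemma J0_sq_le: "(cmod (J0 h x))\<^sup>2 \<le> (\<Sum>R\<in>{R \<in> Reaches. x \<in> R}. (rf R x)\<^sup>2 * (cmod (h R))\<^sup>2)"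
proof (cases "\<exists>U\<in>Reaches. x \<in> roots U")
  case True
  then obtain U where U: "U \<in> Reaches" "x \<in> roots U" by blast
  have eq: "{R \<in> Reaches. x \<in> R} = {U}"
    using U root_unique_reach[OF U(2)] roots_mem[OF U(2)] by blast
  show ?thesis unfolding J0_def eq by (simp add: norm_mult power_mult_distrib)
next
  case False
  then have z: "rf R x = 0" if "R \<in> Reaches" for R using rf_zero[OF that] that by blast
  have "J0 h x = 0" unfolding J0_def by (rule sum.neutral) (simp add: z)
  then show ?thesis by (simp add: sum_nonneg)
qed

text \<open>For a singleton reach off the clusters the quantity is exactly 1, and only finitely many
  reaches remain; hence the supremum over possibly infinitely many reaches is finite.\<close>

lemma rf_sq_bound: "\<exists>B\<ge>0. \<forall>R\<in>Reaches. rm R * (\<Sum>x\<in>R. (rf R x)\<^sup>2 * m x) \<le> B"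
proof -
  define k where "k = (\<lambda>R. rm R * (\<Sum>x\<in>R. (rf R x)\<^sup>2 * m x))"
  have k0: "k R \<ge> 0" if R: "R \<in> Reaches" for R
    unfolding k_def using red_mass_pos[OF R] mass_pos reach_verts[OF R]
    by (intro mult_nonneg_nonneg sum_nonneg) (auto simp: less_imp_le)
  have s0: "0 \<le> (\<Sum>R\<in>{R \<in> Reaches. R \<subseteq> W}. k R)" using k0 by (intro sum_nonneg) auto
  have "k R \<le> 1 + (\<Sum>R\<in>{R \<in> Reaches. R \<subseteq> W}. k R)" if R: "R \<in> Reaches" for R
  proof (cases "R \<subseteq> W")
    case True
    then have "k R \<le> (\<Sum>R\<in>{R \<in> Reaches. R \<subseteq> W}. k R)"
      using R k0 finite_inner_reaches by (intro member_le_sum) auto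
    then show ?thesis by simp
  next
    case False
    then obtain x where x: "x \<in> V" "x \<notin> W" "R = {x}" using reach_cases[OF R] by blast
    note s = singleton_lf_rf[OF x(1,2)]
    have "k R = (rf {x} x * m x) * (rf {x} x * m x)"
      using red_mass_eq[OF R] s(2) by (simp add: k_def x(3) power2_eq_square)
    then show ?thesis using s(3) s0 by simp
  qed
  then show ?thesis unfolding k_def using s0 unfolding k_def
    by (intro exI[of _ "1 + (\<Sum>R\<in>{R \<in> Reaches. R \<subseteq> W}. rm R * (\<Sum>x\<in>R. (rf R x)\<^sup>2 * m x))"]) auto
qed

lemma J_up_bounded: "ell2_bounded red G (J_up G Et)"
proof -
  obtain B where B: "B \<ge> 0" "\<And>R. R \<in> Reaches \<Longrightarrow> rm R * (\<Sum>x\<in>R. (rf R x)\<^sup>2 * m x) \<le> B"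
    using rf_sq_bound by blast
  have main: "(\<Sum>x\<in>F. (cmod (J_up G Et g x))\<^sup>2 * m x) \<le> (sqrt B * ell2_norm red g)\<^sup>2"
    if g: "g \<in> ell2 red" and F: "finite F" "F \<subseteq> V" for g F
  proof -
    define N where "N = (\<Union>x\<in>F. {R \<in> Reaches. x \<in> R})"
    have N: "finite N" "N \<subseteq> Reaches" unfolding N_def using F finite_reaches_at by auto
    define h where "h = (\<lambda>R. of_real (rm R) * g R)"
    have pt: "(cmod (J0 h x))\<^sup>2 * m x \<le> (\<Sum>R\<in>N. (rf R x)\<^sup>2 * m x * (cmod (h R))\<^sup>2)" if x: "x \<in> F" for x
    proof -
      have mx: "m x \<ge> 0" using mass_pos[of x] F x by auto
      have "(cmod (J0 h x))\<^sup>2 * m x \<le> (\<Sum>R\<in>{R \<in> Reaches. x \<in> R}. (rf R x)\<^sup>2 * (cmod (h R))\<^sup>2) * m x"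
        using mx by (intro mult_right_mono J0_sq_le)
      also have "\<dots> = (\<Sum>R\<in>{R \<in> Reaches. x \<in> R}. (rf R x)\<^sup>2 * m x * (cmod (h R))\<^sup>2)"
        by (simp add: sum_distrib_left mult_ac)
      also have "\<dots> \<le> (\<Sum>R\<in>N. (rf R x)\<^sup>2 * m x * (cmod (h R))\<^sup>2)"
        using N x mx by (intro sum_mono2) (auto simp: N_def)
      finally show ?thesis .
    qed
    \<comment> \<open>\<open>h R\<close> contains \<open>rm R\<close>, which enters squared: one
      factor goes into \<open>rf_sq_bound\<close>, the other into the norm of
      \<open>ell2 red\<close>.\<close>
    have col: "(\<Sum>x\<in>F. (rf R x)\<^sup>2 * m x) * (cmod (h R))\<^sup>2 \<le> B * ((cmod (g R))\<^sup>2 * rm R)" if "R \<in> N" for R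
    proof -
      have R: "R \<in> Reaches" using N that by blast
      have pos: "rm R > 0" using red_mass_pos[OF R] .
      have "(\<Sum>x\<in>F. (rf R x)\<^sup>2 * m x) \<le> (\<Sum>x\<in>F \<union> R. (rf R x)\<^sup>2 * m x)"
        using F finite_reach[OF R] mass_pos reach_verts[OF R] by (intro sum_mono2) (auto simp: less_imp_le)
      also have "\<dots> = (\<Sum>x\<in>R. (rf R x)\<^sup>2 * m x)"
        using F finite_reach[OF R] rf_outside[OF R] by (intro sum.mono_neutral_right) auto
      finally have le: "(\<Sum>x\<in>F. (rf R x)\<^sup>2 * m x) \<le> (\<Sum>x\<in>R. (rf R x)\<^sup>2 * m x)" .
      have "(\<Sum>x\<in>F. (rf R x)\<^sup>2 * m x) * (cmod (h R))\<^sup>2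
          \<le> (\<Sum>x\<in>R. (rf R x)\<^sup>2 * m x) * (cmod (h R))\<^sup>2" using le by (intro mult_right_mono) auto
      also have "\<dots> = (rm R * (\<Sum>x\<in>R. (rf R x)\<^sup>2 * m x)) * ((cmod (g R))\<^sup>2 * rm R)"
        by (simp add: h_def norm_mult power_mult_distrib power2_eq_square)
      also have "\<dots> \<le> B * ((cmod (g R))\<^sup>2 * rm R)"
        using B(2)[OF R] pos by (intro mult_right_mono) auto
      finally show ?thesis .
    qed
    have "(\<Sum>x\<in>F. (cmod (J_up G Et g x))\<^sup>2 * m x) \<le> (\<Sum>x\<in>F. \<Sum>R\<in>N. (rf R x)\<^sup>2 * m x * (cmod (h R))\<^sup>2)"
      unfolding J_up_eq h_def[symmetric] by (intro sum_mono pt)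
    also have "\<dots> = (\<Sum>R\<in>N. (\<Sum>x\<in>F. (rf R x)\<^sup>2 * m x) * (cmod (h R))\<^sup>2)"
      by (subst sum.swap) (simp add: sum_distrib_right)
    also have "\<dots> \<le> (\<Sum>R\<in>N. B * ((cmod (g R))\<^sup>2 * rm R))" by (intro sum_mono col)
    also have "\<dots> = B * (\<Sum>R\<in>N. (cmod (g R))\<^sup>2 * rm R)" by (simp add: sum_distrib_left)
    also have "\<dots> \<le> B * (ell2_norm red g)\<^sup>2"
      using ell2_finite_sum_le[OF nonneg_mass_red g N(1)] N(2) B(1)
      by (intro mult_left_mono) (simp_all add: red_simps)
    also have "\<dots> = (sqrt B * ell2_norm red g)\<^sup>2" using B(1) by (simp add: power_mult_distrib)
    finally show ?thesis .
  qed
  have z: "J_up G Et g x = 0" if "x \<notin> V" for g x using that by (simp add: J_up_eq J0_outside)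
  have nn: "0 \<le> sqrt B * ell2_norm red g" for g using B(1) ell2_norm_nonneg[OF nonneg_mass_red] by simp
  show ?thesis
    using ell2I[OF nonneg_mass z main nn] B(1) by (intro ell2_boundedI[of "sqrt B"]) simp_all
qed

section \<open>The reduced Laplacian\<close>

lemma red_weight_eq:
  assumes R: "R \<in> Reaches" and U: "U \<in> Reaches"
  shows "red_weight G Et R U = (\<Sum>r\<in>R. \<Sum>s\<in>U. lf R r * a r s * rf U s) * rm U"
proof -
  have "(\<Sum>r\<in>R. \<Sum>s\<in>U. gamma_left G Et R r * of_real (a r s) * of_real (rf U s))
      = of_real (\<Sum>r\<in>R. \<Sum>s\<in>U. lf R r * a r s * rf U s)"
    by (simp add: gamma_left_real[OF R])
  then show ?thesis unfolding red_weight_def by (simp only: Re_complex_of_real)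
qed

section \<open>Weights and degrees of the reduced graph as finite sums\<close>

definition near :: "'v set \<Rightarrow> 'v set set" where
  "near X = (\<Union>x\<in>X. {U \<in> Reaches. x \<in> U})"

lemma near_props: "finite X \<Longrightarrow> finite (near X)" "near X \<subseteq> Reaches"
  using finite_reaches_at by (auto simp: near_def)

lemma red_weight_row:
  assumes R: "R \<in> Reaches" and Y: "finite Y" "Y \<subseteq> V" "\<forall>x\<in>R. \<forall>y. (x, y) \<in> edges G \<longrightarrow> y \<in> Y"
    and U: "U \<in> Reaches"
  shows "red_weight G Et R U = (\<Sum>x\<in>R. \<Sum>y\<in>Y. lf R x * a x y * rf U y) * rm U"
proof -
  have "(\<Sum>s\<in>U. lf R x * a x s * rf U s) = (\<Sum>y\<in>Y. lf R x * a x y * rf U y)" if x: "x \<in> R" for x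
  proof -
    have xV: "x \<in> V" using reach_verts[OF R x] .
    have "(\<Sum>s\<in>U. lf R x * a x s * rf U s) = (\<Sum>s\<in>U \<union> Y. lf R x * a x s * rf U s)"
      using Y(1) finite_reach[OF U] rf_outside[OF U] by (intro sum.mono_neutral_left) auto
    also have "\<dots> = (\<Sum>s\<in>Y. lf R x * a x s * rf U s)"
    proof (rule sum.mono_neutral_right)
      show "\<forall>s\<in>U \<union> Y - Y. lf R x * a x s * rf U s = 0"
        using weight_zero[OF xV] reach_verts[OF U] Y(3) x by auto
    qed (use Y(1) finite_reach[OF U] in auto)
    finally show ?thesis .
  qed
  then show ?thesis unfolding red_weight_eq[OF R U] by simp
qed

lemma red_weight_row_zero:
  assumes R: "R \<in> Reaches" and Y: "finite Y" "Y \<subseteq> V" "\<forall>x\<in>R. \<forall>y. (x, y) \<in> edges G \<longrightarrow> y \<in> Y"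
    and U: "U \<in> Reaches" "U \<notin> near Y"
  shows "red_weight G Et R U = 0"
proof -
  have "rf U y = 0" if "y \<in> Y" for y using U that rf_outside[OF U(1)] by (auto simp: near_def)
  then show ?thesis unfolding red_weight_row[OF R Y U(1)] by simp
qed

lemma red_weight_column:
  assumes R: "R \<in> Reaches" and X: "finite X" "X \<subseteq> V" "\<forall>y\<in>R. \<forall>x. (x, y) \<in> edges G \<longrightarrow> x \<in> X"
    and U: "U \<in> Reaches"
  shows "red_weight G Et U R = (\<Sum>x\<in>X. \<Sum>y\<in>R. lf U x * a x y * rf R y) * rm R"
proof -
  have "(\<Sum>r\<in>U. \<Sum>y\<in>R. lf U r * a r y * rf R y) = (\<Sum>r\<in>U \<union> X. \<Sum>y\<in>R. lf U r * a r y * rf R y)"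
    using X(1) finite_reach[OF U] lf_outside[OF U] by (intro sum.mono_neutral_left) auto
  also have "\<dots> = (\<Sum>r\<in>X. \<Sum>y\<in>R. lf U r * a r y * rf R y)"
  proof (rule sum.mono_neutral_right)
    show "\<forall>r\<in>U \<union> X - X. (\<Sum>y\<in>R. lf U r * a r y * rf R y) = 0"
    proof
      fix r assume r: "r \<in> U \<union> X - X"
      have "a r y = 0" if "y \<in> R" for y
        using r that weight_zero[of r y] reach_verts[OF U] reach_verts[OF R] X(3) by blast
      then show "(\<Sum>y\<in>R. lf U r * a r y * rf R y) = 0" by simp
    qed
  qed (use X(1) finite_reach[OF U] in auto)
  finally show ?thesis unfolding red_weight_eq[OF U R] by simp
qed

text \<open>Summing over the target reaches removes the left kernel vectors, whose sum is 1 at every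
  vertex. What remains is the out-degree of \<open>G\<close> averaged with the right kernel
  vector.\<close>

lemma red_out_deg:
  assumes R: "R \<in> Reaches"
  shows "out_deg red R = rm R * (\<Sum>y\<in>R. rf R y * out_deg G y)"
proof -
  define X where "X = (\<Union>y\<in>R. {x. (x, y) \<in> edges G})"
  have X: "finite X" "X \<subseteq> V" "\<forall>y\<in>R. \<forall>x. (x, y) \<in> edges G \<longrightarrow> x \<in> X"
    unfolding X_def using finite_reach[OF R] finite_succs reach_verts[OF R] edges_verts by auto
  have zero: "red_weight G Et U R = 0" if U: "U \<in> Reaches" "U \<notin> near X" for U
  proof -
    have "lf U x = 0" if "x \<in> X" for x using U that lf_outside[OF U(1)] by (auto simp: near_def)
    then show ?thesis unfolding red_weight_column[OF R X U(1)] by simp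
  qed
  have one: "(\<Sum>U\<in>near X. lf U x) = 1" if x: "x \<in> X" for x
  proof -
    have "(\<Sum>U\<in>near X. lf U x) = (\<Sum>U\<in>{U \<in> Reaches. x \<in> U}. lf U x)"
    proof (rule sum.mono_neutral_right[OF near_props(1)[OF X(1)]])
      show "{U \<in> Reaches. x \<in> U} \<subseteq> near X" using x by (auto simp: near_def)
      show "\<forall>U\<in>near X - {U \<in> Reaches. x \<in> U}. lf U x = 0" using near_props(2) lf_outside by blast
    qed
    then show ?thesis using lf_sum[of x] x X by auto
  qed
  have deg: "out_deg G y = (\<Sum>x\<in>X. a x y)" if "y \<in> R" for y
    using that reach_verts[OF R that] X by (intro out_deg_eq) auto
  have "out_deg red R = (\<Sum>\<^sub>\<infinity>U\<in>Reaches. red_weight G Et U R)" by (simp add: out_deg_def red_simps)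
  also have "\<dots> = (\<Sum>U\<in>near X. red_weight G Et U R)"
    using zero near_props X by (intro infsum_restrict) auto
  also have "\<dots> = (\<Sum>U\<in>near X. (\<Sum>x\<in>X. \<Sum>y\<in>R. lf U x * (a x y * rf R y)) * rm R)"
  proof (rule sum.cong[OF refl])
    fix U assume "U \<in> near X"
    then have U: "U \<in> Reaches" using near_props(2) by blast
    show "red_weight G Et U R = (\<Sum>x\<in>X. \<Sum>y\<in>R. lf U x * (a x y * rf R y)) * rm R"
      unfolding red_weight_column[OF R X U] by (simp only: mult.assoc)
  qed
  also have "\<dots> = (\<Sum>U\<in>near X. \<Sum>x\<in>X. lf U x * (\<Sum>y\<in>R. a x y * rf R y)) * rm R"
    by (simp add: sum_distrib_right sum_distrib_left)
  also have "(\<Sum>U\<in>near X. \<Sum>x\<in>X. lf U x * (\<Sum>y\<in>R. a x y * rf R y))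
      = (\<Sum>x\<in>X. (\<Sum>U\<in>near X. lf U x) * (\<Sum>y\<in>R. a x y * rf R y))"
    by (subst sum.swap) (simp add: sum_distrib_right)
  also have "\<dots> = (\<Sum>x\<in>X. \<Sum>y\<in>R. a x y * rf R y)" by (simp add: one)
  also have "\<dots> = (\<Sum>y\<in>R. rf R y * out_deg G y)"
    by (subst sum.swap) (simp add: deg sum_distrib_left mult.commute)
  finally show ?thesis by (simp add: mult.commute)
qed

text \<open>The degree term collapses to its \<open>R\<close> component by the pointwise
  biorthogonality \<open>lf_J0\<close>; the weight term is expanded over the reaches that meet
  \<open>Y\<close>.\<close>

lemma D0_lap_J0:
  assumes R: "R \<in> Reaches" and Y: "finite Y" "Y \<subseteq> V" "\<forall>x\<in>R. \<forall>y. (x, y) \<in> edges G \<longrightarrow> y \<in> Y"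
  shows "D0 (lap_out G (J0 h)) R = of_real (\<Sum>y\<in>R. rf R y * out_deg G y) * h R
    - (\<Sum>U\<in>near Y. of_real (\<Sum>x\<in>R. \<Sum>y\<in>Y. lf R x * a x y * rf U y) * h U)"
proof -
  have Jy: "J0 h y = (\<Sum>U\<in>near Y. of_real (rf U y) * h U)" if y: "y \<in> Y" for y
    unfolding J0_def
  proof (rule sum.mono_neutral_left[OF near_props(1)[OF Y(1)]])
    show "{U \<in> Reaches. y \<in> U} \<subseteq> near Y" using y by (auto simp: near_def)
    have "rf U y = 0" if "U \<in> near Y - {U \<in> Reaches. y \<in> U}" for U
      using that near_props(2)[of Y] rf_outside[of U y] by blast
    then show "\<forall>U\<in>near Y - {U \<in> Reaches. y \<in> U}. of_real (rf U y) * h U = 0" by simp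
  qed
  have "D0 (lap_out G (J0 h)) R = (\<Sum>x\<in>R. of_real (lf R x) *
      (of_real (out_deg G x) * J0 h x - (\<Sum>y\<in>Y. of_real (a x y) * J0 h y)))"
    unfolding D0_def using R
  proof (simp, intro sum.cong refl)
    fix x assume x: "x \<in> R"
    have xV: "x \<in> V" using reach_verts[OF R x] .
    have "(\<Sum>\<^sub>\<infinity>y\<in>V. of_real (a x y) * J0 h y) = (\<Sum>y\<in>Y. of_real (a x y) * J0 h y)"
      using xV Y x by (intro weight_sum_eq) auto
    then show "of_real (lf R x) * of_real (m x) * lap_out G (J0 h) x = of_real (lf R x) *
      (of_real (out_deg G x) * J0 h x - (\<Sum>y\<in>Y. of_real (a x y) * J0 h y))"
      using xV mass_pos[OF xV] by (simp add: lap_out_def)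
  qed
  also have "\<dots> = (\<Sum>x\<in>R. of_real (out_deg G x) * (of_real (lf R x) * J0 h x))
      - (\<Sum>x\<in>R. \<Sum>y\<in>Y. of_real (lf R x * a x y) * J0 h y)"
    by (simp add: sum_subtractf[symmetric] sum_distrib_left algebra_simps)
  also have "(\<Sum>x\<in>R. of_real (out_deg G x) * (of_real (lf R x) * J0 h x))
      = of_real (\<Sum>y\<in>R. rf R y * out_deg G y) * h R"
    unfolding lf_J0[OF R] by (simp add: sum_distrib_left mult_ac)
  also have "(\<Sum>x\<in>R. \<Sum>y\<in>Y. of_real (lf R x * a x y) * J0 h y)
      = (\<Sum>x\<in>R. \<Sum>y\<in>Y. \<Sum>U\<in>near Y. of_real (lf R x * a x y * rf U y) * h U)"
    by (intro sum.cong refl) (simp add: Jy sum_distrib_left mult.assoc)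
  also have "\<dots> = (\<Sum>U\<in>near Y. \<Sum>x\<in>R. \<Sum>y\<in>Y. of_real (lf R x * a x y * rf U y) * h U)"
  proof -
    have "(\<Sum>x\<in>R. \<Sum>y\<in>Y. \<Sum>U\<in>near Y. of_real (lf R x * a x y * rf U y) * h U)
        = (\<Sum>x\<in>R. \<Sum>U\<in>near Y. \<Sum>y\<in>Y. of_real (lf R x * a x y * rf U y) * h U)"
      by (intro sum.cong refl) (rule sum.swap)
    then show ?thesis by (simp only: sum.swap[of _ "near Y" R])
  qed
  also have "\<dots> = (\<Sum>U\<in>near Y. of_real (\<Sum>x\<in>R. \<Sum>y\<in>Y. lf R x * a x y * rf U y) * h U)"
    by (simp add: sum_distrib_right)
  finally show ?thesis .
qed

text \<open>The normalisations match: the factor \<open>rm U\<close> of the reduced weights is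
  supplied by \<open>J_up\<close>, and the division by the reduced mass in the Laplacian by
  \<open>J_down\<close>.\<close>

lemma J_down_lap_J_up: "J_down G Et (lap_out G (J_up G Et g)) = lap_out red g"
proof
  fix R
  show "J_down G Et (lap_out G (J_up G Et g)) R = lap_out red g R"
  proof (cases "R \<in> Reaches")
    case R: True
    define Y where "Y = (\<Union>x\<in>R. {y. (x, y) \<in> edges G})"
    have Y: "finite Y" "Y \<subseteq> V" "\<forall>x\<in>R. \<forall>y. (x, y) \<in> edges G \<longrightarrow> y \<in> Y"
      unfolding Y_def using finite_reach[OF R] finite_preds reach_verts[OF R] edges_verts by auto
    have "(\<Sum>\<^sub>\<infinity>U\<in>Reaches. of_real (red_weight G Et R U) * g U)
        = (\<Sum>U\<in>near Y. of_real (red_weight G Et R U) * g U)"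
      using near_props Y(1) red_weight_row_zero[OF R Y] by (intro infsum_restrict) auto
    also have "\<dots> = (\<Sum>U\<in>near Y. of_real (\<Sum>x\<in>R. \<Sum>y\<in>Y. lf R x * a x y * rf U y) * (of_real (rm U) * g U))"
    proof (rule sum.cong[OF refl])
      fix U assume "U \<in> near Y"
      then have U: "U \<in> Reaches" using near_props(2) by blast
      show "of_real (red_weight G Et R U) * g U
          = of_real (\<Sum>x\<in>R. \<Sum>y\<in>Y. lf R x * a x y * rf U y) * (of_real (rm U) * g U)"
        unfolding red_weight_row[OF R Y U] by (simp only: of_real_mult mult.assoc)
    qed
    finally have s: "(\<Sum>\<^sub>\<infinity>U\<in>Reaches. of_real (red_weight G Et R U) * g U) = \<dots>" .
    have "rm R > 0" using red_mass_pos[OF R] .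
    then show ?thesis
      using R unfolding J_down_eq J_up_eq D0_lap_J0[OF R Y] lap_out_def red_simps s red_out_deg[OF R]
      by (simp add: field_simps)
  qed (simp add: J_down_eq D0_def lap_out_def red_simps)
qed

end

section \<open>The limit of strong coupling\<close>

lemma resolvent_setD:
  assumes z: "z \<in> resolvent_set G A" and lin: "lin_on (ell2 G) (\<lambda>f x. A f x - z * f x)"
    and G: "nonneg_mass G"
  shows "ell2_bounded G G (resolvent G A z)" "lin_on (ell2 G) (resolvent G A z)"
    "\<And>g. g \<in> ell2 G \<Longrightarrow> (\<lambda>x. A (resolvent G A z g) x - z * resolvent G A z g x) = g"
    "\<And>f. f \<in> ell2 G \<Longrightarrow> resolvent G A z (\<lambda>x. A f x - z * f x) = f"
proof -
  let ?A = "\<lambda>f x. A f x - z * f x"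
  have bij: "bij_betw ?A (ell2 G) (ell2 G)" and bd: "op_norm G G (op_inverse G ?A) < \<infinity>"
    using z unfolding resolvent_set_def by blast+
  have im: "?A ` ell2 G = ell2 G" and inj: "inj_on ?A (ell2 G)"
    using bij unfolding bij_betw_def by blast+
  show "ell2_bounded G G (resolvent G A z)"
    using bd unfolding op_norm_finite_iff resolvent_def .
  show "lin_on (ell2 G) (resolvent G A z)"
    unfolding resolvent_def op_inverse_def using lin bij ell2_comb(1)[OF G] by (rule lin_on_inv_into)
  show "(\<lambda>x. A (resolvent G A z g) x - z * resolvent G A z g x) = g" if g: "g \<in> ell2 G" for g
  proof -
    have "g \<in> ?A ` ell2 G" using g im by simp
    from f_inv_into_f[OF this] show ?thesis unfolding resolvent_def op_inverse_def .
  qed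
  show "resolvent G A z (?A f) = f" if f: "f \<in> ell2 G" for f
    unfolding resolvent_def op_inverse_def using inv_into_f_f[OF inj f] .
qed

context cluster_graph
begin

abbreviation "L \<equiv> lap_out G"

lemma L_eq:
  assumes "x \<in> V" "finite Y" "Y \<subseteq> V" "\<forall>y. (x, y) \<in> edges G \<or> (y, x) \<in> edges G \<longrightarrow> y \<in> Y"
  shows "L f x = (\<Sum>y\<in>Y. of_real (a y x) * f x - of_real (a x y) * f y) / of_real (m x)"
proof -
  have "(\<Sum>\<^sub>\<infinity>y\<in>V. of_real (a x y) * f y) = (\<Sum>y\<in>Y. of_real (a x y) * f y)"
    using assms by (intro weight_sum_eq) auto
  moreover have "out_deg G x = (\<Sum>y\<in>Y. a y x)" using assms by (intro out_deg_eq) auto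
  ultimately show ?thesis using assms(1) by (simp add: lap_out_def sum_subtractf sum_distrib_right)
qed

lemma neighbours:
  assumes "x \<in> V"
  obtains Y where "finite Y" "Y \<subseteq> V" "\<forall>y. (x, y) \<in> edges G \<or> (y, x) \<in> edges G \<longrightarrow> y \<in> Y" "W \<subseteq> Y"
proof
  \<comment> \<open>\<open>W\<close> is included so that the sums for \<open>L\<close> and for
    \<open>T\<close> can be taken over the same set.\<close>
  let ?Y = "{y. (x, y) \<in> edges G} \<union> {y. (y, x) \<in> edges G} \<union> W"
  show "finite ?Y" using finite_preds[OF assms] finite_succs[OF assms] finite_W by simp
  show "?Y \<subseteq> V" using edges_verts W_verts by blast
qed auto

lemma L_lin: "L (\<lambda>x. f x + c * g x) = (\<lambda>x. L f x + c * L g x)"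
proof
  fix x
  show "L (\<lambda>x. f x + c * g x) x = L f x + c * L g x"
  proof (cases "x \<in> V")
    case True
    then obtain Y where Y: "finite Y" "Y \<subseteq> V" "\<forall>y. (x, y) \<in> edges G \<or> (y, x) \<in> edges G \<longrightarrow> y \<in> Y"
      by (rule neighbours)
    have "(\<Sum>y\<in>Y. of_real (a y x) * (f x + c * g x) - of_real (a x y) * (f y + c * g y))
      = (\<Sum>y\<in>Y. of_real (a y x) * f x - of_real (a x y) * f y)
        + c * (\<Sum>y\<in>Y. of_real (a y x) * g x - of_real (a x y) * g y)"
      by (simp add: sum_distrib_left sum.distrib[symmetric] algebra_simps)
    then show ?thesis unfolding L_eq[OF True Y] by (simp add: add_divide_distrib)
  qed (simp add: lap_out_def)
qed

lemma T_scale: "T (\<lambda>x. c * f x) = (\<lambda>x. c * T f x)"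
proof -
  have "T (\<lambda>x. 0) = (\<lambda>x. 0)" by (simp add: T_eq fun_eq_iff)
  then show ?thesis using T_lin[of "\<lambda>x. 0" c f] by simp
qed

text \<open>The edges outside the clusters carry the weights \<open>a - cw\<close>, so their
  Laplacian is \<open>L - T\<close>; adding \<open>\<beta>\<close> times \<open>T\<close> leaves the
  coefficient \<open>\<beta> - 1\<close>.\<close>

lemma lap_out_scaled_eq: "lap_out_scaled G Et \<beta> f x = L f x + of_real (\<beta> - 1) * T f x"
proof (cases "x \<in> V")
  case x: True
  obtain Y where Y: "finite Y" "Y \<subseteq> V" "\<forall>y. (x, y) \<in> edges G \<or> (y, x) \<in> edges G \<longrightarrow> y \<in> Y"
    "W \<subseteq> Y" using x by (rule neighbours)
  define b where "b = (\<lambda>i j. if (i, j) \<in> edges G - Et then a i j else 0)"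
  have b: "b i j = a i j - cw i j" if "i \<in> V" "j \<in> V" for i j
    using weight_zero[OF that] Et_edges by (auto simp: b_def cw_def)
  have deg: "out_deg (restrict_graph G (edges G - Et)) x = (\<Sum>y\<in>Y. b y x)"
    unfolding out_deg_def restrict_graph_def using Y by (simp add: b_def) (intro infsum_restrict, auto)
  have "(\<Sum>\<^sub>\<infinity>y\<in>V. of_real (b x y) * f y) = (\<Sum>y\<in>Y. of_real (b x y) * f y)"
    using Y by (intro infsum_restrict) (auto simp: b_def)
  then have "lap_out (restrict_graph G (edges G - Et)) f x
      = (\<Sum>y\<in>Y. of_real (b y x) * f x - of_real (b x y) * f y) / of_real (m x)"
    using x unfolding lap_out_def deg
    by (simp add: restrict_graph_def b_def sum_subtractf sum_distrib_right)
  also have "\<dots> = (\<Sum>y\<in>Y. (of_real (a y x) * f x - of_real (a x y) * f y)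
      - (of_real (cw y x) * f x - of_real (cw x y) * f y)) / of_real (m x)"
  proof -
    have "of_real (b y x) * f x - of_real (b x y) * f y = (of_real (a y x) * f x - of_real (a x y) * f y)
      - (of_real (cw y x) * f x - of_real (cw x y) * f y)" if "y \<in> Y" for y
    proof -
      have "y \<in> V" using that Y(2) by blast
      then show ?thesis using b[of y x] b[of x y] x by (simp add: left_diff_distrib)
    qed
    then show ?thesis by simp
  qed
  also have "\<dots> = L f x - (\<Sum>y\<in>Y. of_real (cw y x) * f x - of_real (cw x y) * f y) / of_real (m x)"
    unfolding L_eq[OF x Y(1-3)] by (simp only: sum_subtractf diff_divide_distrib)
  also have "(\<Sum>y\<in>Y. of_real (cw y x) * f x - of_real (cw x y) * f y)
      = (\<Sum>y\<in>W. of_real (cw y x) * f x - of_real (cw x y) * f y)"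
    using Y(1,4) cw_outside_W by (intro sum.mono_neutral_right) auto
  finally have "lap_out (restrict_graph G (edges G - Et)) f x = L f x - T f x" using x by (simp add: T_eq)
  then show ?thesis by (simp add: lap_out_scaled_def algebra_simps)
qed (simp add: lap_out_scaled_def lap_out_def restrict_graph_def)

end

text \<open>
  \<open>B\<close> is the limit operator. Since \<open>B g\<close> solves the block of the resolvent equation on the range
  of \<open>P\<close>, the residual \<open>H g\<close> equals \<open>Q (g - L (B g))\<close>. The Schur complement of the block of \<open>L + T / \<kappa> - z\<close> on the range of
  the spectral projection, multiplied by \<open>\<kappa>\<close> and by the inverse \<open>S\<close> of \<open>T\<close> on the range of \<open>Q\<close>, is
  \<open>1 + \<kappa> U\<close> with \<open>\<kappa> = 1 / (\<beta> - 1)\<close>. It lives on a finite-dimensional space.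
\<close>

locale reduced_resolvent = cluster_graph +
  fixes z :: complex
  assumes z: "z \<in> resolvent_set red (lap_out red)"
begin

abbreviation "Rz \<equiv> resolvent red (lap_out red) z"

definition B :: "('a \<Rightarrow> complex) \<Rightarrow> 'a \<Rightarrow> complex" where
  "B g = J_up G Et (Rz (J_down G Et g))"

definition H :: "('a \<Rightarrow> complex) \<Rightarrow> 'a \<Rightarrow> complex" where
  "H g x = g x - L (B g) x + z * B g x"

definition U :: "('a \<Rightarrow> complex) \<Rightarrow> 'a \<Rightarrow> complex" where
  "U q = S (\<lambda>x. H (L q) x - z * q x)"

text \<open>Linearity is inherited from \<open>L\<close> through \<open>J_down_lap_J_up\<close>,
  which spares a treatment of the infinite sums over the reduced graph.\<close>

lemma lap_red_lin: "lin_on (ell2 red) (\<lambda>f x. lap_out red f x - z * f x)"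
  unfolding lin_on_def J_down_lap_J_up[symmetric]
  by (auto simp: J_up_lin L_lin J_down_lin fun_eq_iff algebra_simps)

lemmas Rz_facts = resolvent_setD[OF z lap_red_lin nonneg_mass_red]

lemma J_down_ell2: "g \<in> ell2 G \<Longrightarrow> J_down G Et g \<in> ell2 red"
  using ell2_bounded_mem[OF J_down_bounded] .

lemma L_ell2: "f \<in> ell2 G \<Longrightarrow> L f \<in> ell2 G"
  using ell2_bounded_mem[OF lap_out_bounded] .

lemma B_bounded: "ell2_bounded G G B"
  unfolding B_def
  by (rule ell2_bounded_compose[OF ell2_bounded_compose[OF J_down_bounded Rz_facts(1)] J_up_bounded])

lemma B_ell2: "g \<in> ell2 G \<Longrightarrow> B g \<in> ell2 G"
  using ell2_bounded_mem[OF B_bounded] .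

lemma B_lin: "lin_on (ell2 G) B"
  unfolding lin_on_def
proof (intro ballI allI)
  fix f g c assume f: "f \<in> ell2 G" and g: "g \<in> ell2 G"
  show "B (\<lambda>x. f x + c * g x) = (\<lambda>x. B f x + c * B g x)"
    unfolding B_def J_down_lin lin_onD[OF Rz_facts(2) J_down_ell2[OF f] J_down_ell2[OF g]] J_up_lin ..
qed

lemma H_lin: "lin_on (ell2 G) H"
  unfolding lin_on_def H_def
proof (intro ballI allI ext)
  fix f g c x assume f: "f \<in> ell2 G" and g: "g \<in> ell2 G"
  show "f x + c * g x - L (B (\<lambda>x. f x + c * g x)) x + z * B (\<lambda>x. f x + c * g x) x
      = f x - L (B f) x + z * B f x + c * (g x - L (B g) x + z * B g x)"
    unfolding lin_onD[OF B_lin f g] L_lin by (simp add: algebra_simps)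
qed

lemma H_bounded: "ell2_bounded G G H"
proof -
  have "H = (\<lambda>g x. (g x - L (B g) x) + z * B g x)" by (simp add: H_def fun_eq_iff)
  then show ?thesis
    using ell2_bounded_comb[OF nonneg_mass ell2_bounded_diff[OF nonneg_mass ell2_bounded_id
        ell2_bounded_compose[OF B_bounded lap_out_bounded]] B_bounded] by simp
qed

lemma D0_H:
  assumes g: "g \<in> ell2 G" shows "D0 (H g) = (\<lambda>R. 0)"
proof (rule D0_eq_zeroI)
  fix R assume R: "R \<in> Reaches"
  define u where "u = Rz (J_down G Et g)"
  have red: "lap_out red u R - z * u R = J_down G Et g R"
    using fun_cong[OF Rz_facts(3)[OF J_down_ell2[OF g]]] by (simp add: u_def)
  have Bg: "B g = J_up G Et u" by (simp add: B_def u_def)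
  have "H g = (\<lambda>x. (g x + (-1) * L (B g) x) + z * B g x)" by (simp add: H_def fun_eq_iff)
  then have "J_down G Et (H g) R
      = (J_down G Et g R + (-1) * J_down G Et (L (B g)) R) + z * J_down G Et (B g) R"
    by (simp only: J_down_lin)
  also have "\<dots> = 0"
    unfolding Bg J_down_lap_J_up J_down_J_up[OF R] red[symmetric] by simp
  finally show "D0 (H g) R = 0" using red_mass_pos[OF R] by (simp add: J_down_eq)
qed

lemma Q_H: "g \<in> ell2 G \<Longrightarrow> Q (H g) = H g"
  using Q_id D0_H by blast

lemma T_B: "T (B g) = (\<lambda>x. 0)"
  by (simp add: B_def J_up_eq T_J0)

lemma H_V: "g \<in> ell2 G \<Longrightarrow> H g \<in> supp_funs V"
  using ell2_supp[OF ell2_bounded_mem[OF H_bounded]] .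

lemma U_arg:
  assumes q: "q \<in> supp_funs W" shows "(\<lambda>x. H (L q) x - z * q x) \<in> supp_funs V"
  using supp_funs_comb[OF H_V[OF L_ell2[OF supp_W_ell2[OF q]]] supp_funs_mono[OF W_verts q], of "- z"]
  by simp

lemma U_supp: "q \<in> supp_funs W \<Longrightarrow> U q \<in> supp_funs W"
  unfolding U_def using S_spec(1)[OF U_arg] .

lemma U_lin: "lin_on (supp_funs W) U"
  unfolding lin_on_def
proof (intro ballI allI)
  fix p q c assume p: "p \<in> supp_funs W" and q: "q \<in> supp_funs W"
  have "(\<lambda>x. H (L (\<lambda>x. p x + c * q x)) x - z * (p x + c * q x))
      = (\<lambda>x. (H (L p) x - z * p x) + c * (H (L q) x - z * q x))"
    unfolding L_lin lin_onD[OF H_lin L_ell2[OF supp_W_ell2[OF p]] L_ell2[OF supp_W_ell2[OF q]]]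
    by (simp add: fun_eq_iff algebra_simps)
  then show "U (\<lambda>x. p x + c * q x) = (\<lambda>x. U p x + c * U q x)"
    unfolding U_def using lin_onD[OF S_lin U_arg[OF p] U_arg[OF q]] by simp
qed

lemma Q_U_arg:
  assumes q: "q \<in> supp_funs W" "D0 q = (\<lambda>R. 0)"
  shows "Q (\<lambda>x. H (L q) x - z * q x) = (\<lambda>x. H (L q) x - z * q x)"
proof (rule Q_id)
  have "D0 (\<lambda>x. H (L q) x + (- z) * q x) = (\<lambda>R. D0 (H (L q)) R + (- z) * D0 q R)" by (rule D0_lin)
  then show "D0 (\<lambda>x. H (L q) x - z * q x) = (\<lambda>R. 0)"
    using D0_H[OF L_ell2[OF supp_W_ell2[OF q(1)]]] q(2) by simp
qed

text \<open>The origin of the formula: if \<open>q\<close> is the component of \<open>f\<close> in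
  the range of \<open>Q\<close>, the block on the range of the projection forces
  \<open>f = B (g - L q) + q\<close>. Since \<open>T\<close> annihilates the range of
  \<open>B\<close>, the rest of the equation reads
  \<open>T q / \<kappa> = H g - H (L q) + z q\<close>, and applying \<open>S\<close> turns it into
  the hypothesis on \<open>q\<close>.\<close>

lemma schur_solution:
  assumes \<kappa>: "\<kappa> \<noteq> 0" and g: "g \<in> ell2 G" and q: "q \<in> supp_funs W"
    and eq: "(\<lambda>x. q x + \<kappa> * U q x) = (\<lambda>x. \<kappa> * S (H g) x)"
  defines "f \<equiv> \<lambda>x. B (\<lambda>x. g x - L q x) x + q x"
  shows "(\<lambda>x. L f x + T f x / \<kappa> - z * f x) = g"
proof
  fix x
  have qe: "q = (\<lambda>x. \<kappa> * S (H g) x + (- \<kappa>) * U q x)"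
    using eq by (simp add: fun_eq_iff algebra_simps)
  note Sg = S_spec[OF H_V[OF g]] and Sq = S_spec[OF U_arg[OF q], folded U_def]
  \<comment> \<open>\<open>D0 q = 0\<close> comes from the equation itself, which exhibits
    \<open>q\<close> as a combination of values of \<open>S\<close>.\<close>
  have "D0 q = (\<lambda>R. D0 (\<lambda>x. \<kappa> * S (H g) x) R + (- \<kappa>) * D0 (U q) R)" by (subst qe) (rule D0_lin)
  then have D: "D0 q = (\<lambda>R. 0)" unfolding D0_scale by (simp add: Sg Sq)
  have "T q = (\<lambda>x. T (\<lambda>x. \<kappa> * S (H g) x) x + (- \<kappa>) * T (U q) x)" by (subst qe) (rule T_lin)
  then have "T q = (\<lambda>x. \<kappa> * H g x + (- \<kappa>) * (H (L q) x - z * q x))"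
    unfolding T_scale Sg Sq Q_H[OF g] Q_U_arg[OF q D] .
  then have Tq: "T q x = \<kappa> * (H g x - H (L q) x + z * q x)" by (simp add: algebra_simps)
  have Lq: "L q \<in> ell2 G" using L_ell2[OF supp_W_ell2[OF q]] .
  have Hw: "H (\<lambda>x. g x - L q x) = (\<lambda>x. H g x - H (L q) x)" using lin_on_diff[OF H_lin g Lq] .
  have "f = (\<lambda>x. B (\<lambda>x. g x - L q x) x + 1 * q x)" by (simp add: f_def)
  then have Lf: "L f x = L (B (\<lambda>x. g x - L q x)) x + L q x"
    and Tf: "T f x = T q x" by (simp_all only: L_lin T_lin T_B) simp_all
  have "T q x / \<kappa> = H (\<lambda>x. g x - L q x) x + z * q x" using \<kappa> by (simp add: Tq Hw)
  then show "L f x + T f x / \<kappa> - z * f x = g x"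
    unfolding Lf Tf by (simp add: H_def f_def algebra_simps)
qed

text \<open>The elimination read backwards for \<open>g = 0\<close>: \<open>J_down\<close> removes
  \<open>T\<close> and yields \<open>J_up u = - B (L q)\<close>; inserting this and applying
  \<open>S\<close> leaves \<open>q + \<kappa> U q = 0\<close>.\<close>

lemma schur_injective:
  assumes \<kappa>: "\<kappa> \<noteq> 0" and f: "f \<in> ell2 G" and eq: "(\<lambda>x. L f x + T f x / \<kappa> - z * f x) = (\<lambda>x. 0)"
    and inj: "\<And>q. q \<in> supp_funs W \<Longrightarrow> (\<lambda>x. q x + \<kappa> * U q x) = (\<lambda>x. 0) \<Longrightarrow> q = (\<lambda>x. 0)"
  shows "f = (\<lambda>x. 0)"
proof -
  define q where "q = Q f"
  define u where "u = J_down G Et f"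
  have q: "q \<in> supp_funs W" unfolding q_def using Q_supp[OF ell2_supp[OF f]] .
  have D: "D0 q = (\<lambda>R. 0)" unfolding q_def by (rule D0_Q)
  have Lq: "L q \<in> ell2 G" using L_ell2[OF supp_W_ell2[OF q]] .
  have u: "u \<in> ell2 red" unfolding u_def using J_down_ell2[OF f] .
  have fe: "f = (\<lambda>x. J_up G Et u x + 1 * q x)" by (simp add: u_def J_up_J_down q_def Q_def)
  have Tf: "T f = T q" by (subst fe, subst T_lin) (simp add: J_up_eq T_J0)
  have Lf: "L f = (\<lambda>x. L (J_up G Et u) x + 1 * L q x)" by (subst fe) (rule L_lin)
  have JT: "J_down G Et (T q) = (\<lambda>R. 0)" by (simp add: fun_eq_iff J_down_eq D0_T)
  have "L f = (\<lambda>x. 0 + z * f x + (- 1 / \<kappa>) * T q x)"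
    using eq unfolding Tf by (simp add: fun_eq_iff algebra_simps)
  then have "J_down G Et (L f) = (\<lambda>R. J_down G Et (\<lambda>x. 0) R + z * u R + (- 1 / \<kappa>) * J_down G Et (T q) R)"
    by (simp only: J_down_lin u_def)
  moreover have "J_down G Et (L f) = (\<lambda>R. lap_out red u R + 1 * J_down G Et (L q) R)"
    unfolding Lf J_down_lin J_down_lap_J_up ..
  ultimately have "lap_out red u R + J_down G Et (L q) R = z * u R" for R
    unfolding JT by (simp add: fun_eq_iff J_down_eq D0_zero)
  then have "(\<lambda>R. lap_out red u R - z * u R) = (\<lambda>R. - 1 * J_down G Et (L q) R)"
    by (simp add: fun_eq_iff algebra_simps)
  then have "u = Rz (\<lambda>R. - 1 * J_down G Et (L q) R)" using Rz_facts(4)[OF u] by simp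
  also have "\<dots> = (\<lambda>R. - 1 * Rz (J_down G Et (L q)) R)"
    using Rz_facts(2) J_down_ell2[OF Lq] zero_ell2 by (rule lin_on_scale)
  finally have "u = (\<lambda>R. 0 + (- 1) * Rz (J_down G Et (L q)) R)" by simp
  then have "J_up G Et u = (\<lambda>x. J_up G Et (\<lambda>R. 0) x + (- 1) * B (L q) x)"
    by (simp only: J_up_lin B_def)
  then have Ju: "J_up G Et u = (\<lambda>x. - B (L q) x)" by (simp add: J_up_eq J0_zero)
  have LJ: "L (J_up G Et u) = (\<lambda>x. - L (B (L q)) x)"
    using L_lin[of "\<lambda>x. 0" "- 1" "B (L q)"] unfolding Ju by (simp add: lap_out_def fun_eq_iff)
  have "T q x = - \<kappa> * (H (L q) x - z * q x)" for x
  proof -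
    have "T q x / \<kappa> = z * f x - L f x"
      using fun_cong[OF eq, of x] unfolding Tf by (simp add: algebra_simps)
    also have "\<dots> = - (H (L q) x - z * q x)"
    proof -
      have Lfx: "L f x = - L (B (L q)) x + L q x" unfolding Lf unfolding LJ by simp
      have fx: "f x = - B (L q) x + q x" using fun_cong[OF fe, of x] unfolding Ju by simp
      show ?thesis unfolding Lfx fx H_def by (simp add: algebra_simps)
    qed
    finally show ?thesis using \<kappa> by (simp add: field_simps)
  qed
  then have Tq: "T q = (\<lambda>x. - \<kappa> * (H (L q) x - z * q x))" ..
  have arg: "(\<lambda>x. - \<kappa> * (H (L q) x - z * q x)) \<in> supp_funs V"
    using U_arg[OF q] by (simp add: supp_funs_def)
  have "D0 (\<lambda>x. - \<kappa> * (H (L q) x - z * q x)) = (\<lambda>R. 0)" using D0_T[of q] unfolding Tq .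
  then have "S (\<lambda>x. - \<kappa> * (H (L q) x - z * q x)) = q"
    using Tq Q_id by (intro S_unique[OF arg q D]) simp
  moreover have "S (\<lambda>x. - \<kappa> * (H (L q) x - z * q x)) = (\<lambda>x. - \<kappa> * U q x)"
    unfolding U_def using S_lin U_arg[OF q] zero_supp_funs by (rule lin_on_scale)
  ultimately have "q x = - \<kappa> * U q x" for x by metis
  then have "(\<lambda>x. q x + \<kappa> * U q x) = (\<lambda>x. 0)" by (simp add: fun_eq_iff)
  then have q0: "q = (\<lambda>x. 0)" by (rule inj[OF q])
  have "L q = (\<lambda>x. 0)" unfolding q0 by (simp add: lap_out_def fun_eq_iff)
  then have "B (L q) = (\<lambda>x. 0)" using lin_on_zero[OF B_lin zero_ell2] by simp
  then show ?thesis using fe Ju q0 by simp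
qed

text \<open>The difference from the limit operator is \<open>q - B (L q)\<close>, where
  \<open>q\<close> solves the Schur equation with right-hand side \<open>\<kappa> S (H g)\<close>.
  The lower bound for \<open>q + \<kappa> U q\<close> makes \<open>q\<close>, and with it the
  difference, of order \<open>\<kappa>\<close>.\<close>

lemma resolvent_estimate:
  "\<exists>c>0. \<exists>C\<ge>0. \<forall>\<kappa>. \<kappa> \<noteq> 0 \<longrightarrow> cmod \<kappa> * c \<le> 1 \<longrightarrow>
     z \<in> resolvent_set G (\<lambda>f x. L f x + T f x / \<kappa>) \<and>
     (\<forall>g\<in>ell2 G. (\<lambda>x. resolvent G (\<lambda>f x. L f x + T f x / \<kappa>) z g x - B g x) \<in> ell2 G \<and>
        ell2_norm G (\<lambda>x. resolvent G (\<lambda>f x. L f x + T f x / \<kappa>) z g x - B g x) \<le> C * cmod \<kappa> * ell2_norm G g)"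
proof -
  obtain c where c: "c > 0" and pert: "\<And>\<kappa>. cmod \<kappa> * c \<le> 1 \<Longrightarrow>
      (\<forall>q\<in>supp_funs W. l1_norm W q \<le> 2 * l1_norm W (\<lambda>x. q x + \<kappa> * U q x)) \<and>
      bij_betw (\<lambda>q x. q x + \<kappa> * U q x) (supp_funs W) (supp_funs W)"
    using small_perturbation_bij[OF finite_W U_lin U_supp] by blast
  have linE: "lin_on (supp_funs W) (\<lambda>q x. q x - B (L q) x)"
    unfolding lin_on_def
  proof (intro ballI allI)
    fix p q c assume p: "p \<in> supp_funs W" and q: "q \<in> supp_funs W"
    show "(\<lambda>x. p x + c * q x - B (L (\<lambda>x. p x + c * q x)) x)
        = (\<lambda>x. p x - B (L p) x + c * (q x - B (L q) x))"
      unfolding L_lin lin_onD[OF B_lin L_ell2[OF supp_W_ell2[OF p]] L_ell2[OF supp_W_ell2[OF q]]]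
      by (simp add: fun_eq_iff algebra_simps)
  qed
  have intoE: "(\<lambda>x. q x - B (L q) x) \<in> ell2 G" if q: "q \<in> supp_funs W" for q
    using ell2_diff[OF nonneg_mass supp_W_ell2[OF q] B_ell2[OF L_ell2[OF supp_W_ell2[OF q]]]] .
  obtain c1 where c1: "c1 \<ge> 0" "\<And>q. q \<in> supp_funs W \<Longrightarrow>
      ell2_norm G (\<lambda>x. q x - B (L q) x) \<le> c1 * l1_norm W q"
    using lin_ell2_bounded[OF nonneg_mass finite_W linE intoE] by blast
  obtain d where d: "d \<ge> 0" "\<And>f. f \<in> ell2 G \<Longrightarrow> l1_norm W f \<le> d * ell2_norm G f"
    using l1_ell2_bound by blast
  obtain s where s: "s \<ge> 0" "\<And>g. g \<in> ell2 G \<Longrightarrow> S (H g) \<in> ell2 G"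
      "\<And>g. g \<in> ell2 G \<Longrightarrow> ell2_norm G (S (H g)) \<le> s * ell2_norm G g"
    using ell2_bounded_compose[OF H_bounded S_bounded] by (rule ell2_boundedE) blast
  \<comment> \<open>The factors bound, in this order, the map from \<open>q\<close> to
    \<open>q - B (L q)\<close>, the inverse of \<open>1 + \<kappa> U\<close>, the restriction to
    \<open>W\<close>, and \<open>S\<close> after \<open>H\<close>.\<close>
  define C where "C = c1 * (2 * (d * s))"
  have C: "C \<ge> 0" using c1 d s by (simp add: C_def)
  show ?thesis
  proof (rule exI[of _ c], intro conjI c exI[of _ C] C allI impI)
    fix \<kappa> :: complex assume \<kappa>: "\<kappa> \<noteq> 0" "cmod \<kappa> * c \<le> 1"
    define M where "M = (\<lambda>q x. q x + \<kappa> * U q x)"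
    have bij: "bij_betw M (supp_funs W) (supp_funs W)"
      and low: "\<And>q. q \<in> supp_funs W \<Longrightarrow> l1_norm W q \<le> 2 * l1_norm W (M q)"
      using pert[OF \<kappa>(2)] by (auto simp: M_def)
    define qf where "qf = (\<lambda>g. inv_into (supp_funs W) M (\<lambda>x. \<kappa> * S (H g) x))"
    have rhs: "(\<lambda>x. \<kappa> * S (H g) x) \<in> supp_funs W" if g: "g \<in> ell2 G" for g
      using S_spec(1)[OF H_V[OF g]] by (simp add: supp_funs_def)
    have qf: "qf g \<in> supp_funs W" "M (qf g) = (\<lambda>x. \<kappa> * S (H g) x)" if g: "g \<in> ell2 G" for g
    proof -
      have im: "(\<lambda>x. \<kappa> * S (H g) x) \<in> M ` supp_funs W" using rhs[OF g] bij by (simp add: bij_betw_def)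
      show "qf g \<in> supp_funs W" "M (qf g) = (\<lambda>x. \<kappa> * S (H g) x)"
        unfolding qf_def by (rule inv_into_into[OF im]) (rule f_inv_into_f[OF im])
    qed
    define R where "R = (\<lambda>g x. B (\<lambda>x. g x - L (qf g) x) x + qf g x)"
    have Lqf: "L (qf g) \<in> ell2 G" if "g \<in> ell2 G" for g using L_ell2[OF supp_W_ell2[OF qf(1)[OF that]]] .
    have diff: "(\<lambda>x. R g x - B g x) = (\<lambda>x. qf g x - B (L (qf g)) x)" if g: "g \<in> ell2 G" for g
      using lin_on_diff[OF B_lin g Lqf[OF g]] by (simp add: R_def fun_eq_iff)
    have est: "ell2_norm G (\<lambda>x. R g x - B g x) \<le> C * cmod \<kappa> * ell2_norm G g" if g: "g \<in> ell2 G" for g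
    proof -
      have "l1_norm W (\<lambda>x. \<kappa> * S (H g) x) = cmod \<kappa> * l1_norm W (S (H g))"
        by (simp add: l1_norm_def norm_mult sum_distrib_left)
      also have "\<dots> \<le> cmod \<kappa> * (d * (s * ell2_norm G g))"
        using d s g by (intro mult_left_mono order.trans[OF d(2)[OF s(2)[OF g]]]) auto
      finally have "l1_norm W (qf g) \<le> 2 * (cmod \<kappa> * (d * (s * ell2_norm G g)))"
        using low[OF qf(1)[OF g]] qf(2)[OF g] by simp
      then have "c1 * l1_norm W (qf g) \<le> c1 * (2 * (cmod \<kappa> * (d * (s * ell2_norm G g))))"
        using c1(1) by (rule mult_left_mono)
      then show ?thesis using c1(2)[OF qf(1)[OF g]] unfolding diff[OF g] C_def by (simp add: mult_ac)
    qed
    have diff_ell2: "(\<lambda>x. R g x - B g x) \<in> ell2 G" if g: "g \<in> ell2 G" for g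
      unfolding diff[OF g] using intoE[OF qf(1)[OF g]] .
    have diff_bd: "ell2_bounded G G (\<lambda>g x. R g x - B g x)"
      using C diff_ell2 est by (intro ell2_boundedI[of "C * cmod \<kappa>"]) simp_all
    have Rbd: "ell2_bounded G G R"
      using ell2_bounded_comb[OF nonneg_mass diff_bd B_bounded, of 1] by simp
    let ?A = "\<lambda>f x. L f x + T f x / \<kappa>"
    have linA: "lin_on (ell2 G) (\<lambda>f x. ?A f x - z * f x)"
      by (auto simp: lin_on_def L_lin T_lin fun_eq_iff add_divide_distrib algebra_simps)
    have intoA: "?A f \<in> ell2 G" if "f \<in> ell2 G" for f
      using ell2_comb(1)[OF nonneg_mass L_ell2[OF that] T_ell2, of "1 / \<kappa>"] by simp
    have injM: "q = (\<lambda>x. 0)" if "q \<in> supp_funs W" "(\<lambda>x. q x + \<kappa> * U q x) = (\<lambda>x. 0)" for q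
    proof -
      have "M (\<lambda>x. 0) = (\<lambda>x. 0)" using lin_on_zero[OF U_lin zero_supp_funs] by (simp add: M_def)
      then have "M q = M (\<lambda>x. 0)" using that(2) by (simp add: M_def)
      then show ?thesis using bij that(1) zero_supp_funs unfolding bij_betw_def inj_on_def by blast
    qed
    have solA: "(\<lambda>x. ?A (R g) x - z * R g x) = g" if g: "g \<in> ell2 G" for g
      using schur_solution[OF \<kappa>(1) g qf(1)[OF g]] qf(2)[OF g] unfolding M_def R_def by blast
    have res: "z \<in> resolvent_set G ?A" "\<And>g. g \<in> ell2 G \<Longrightarrow> resolvent G ?A z g = R g"
      using resolvent_setI[OF nonneg_mass linA intoA schur_injective[OF \<kappa>(1) _ _ injM] Rbd solA] by blast+
    show "z \<in> resolvent_set G ?A" by (rule res(1))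
    show "\<forall>g\<in>ell2 G. (\<lambda>x. resolvent G ?A z g x - B g x) \<in> ell2 G \<and>
        ell2_norm G (\<lambda>x. resolvent G ?A z g x - B g x) \<le> C * cmod \<kappa> * ell2_norm G g"
      using res(2) est diff_ell2 by simp
  qed
qed

end

theorem theorem4p18:
  fixes G :: "'v wgraph" and \<F> :: "('v \<times> 'v) set set" and Et :: "('v \<times> 'v) set" and z :: complex
  assumes graph: "weighted_digraph G"
    and clusters: "directed_clusters G \<F>"
    and Et: "Et = \<Union>\<F>"
    and z_nonzero: "z \<noteq> 0"
    and z_resolvent: "z \<in> resolvent_set (reduced_graph G Et) (lap_out (reduced_graph G Et))"
  shows "(\<exists>C>0. \<exists>\<beta>\<^sub>0>0. \<forall>\<beta>\<ge>\<beta>\<^sub>0.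
            z \<in> resolvent_set G (lap_out_scaled G Et \<beta>) \<and>
            op_norm G G
              (\<lambda>f x. resolvent G (lap_out_scaled G Et \<beta>) z f x
                     - J_up G Et (resolvent (reduced_graph G Et) (lap_out (reduced_graph G Et)) z
                         (J_down G Et f)) x)
            \<le> ennreal (C / \<beta>)) \<and>
         ((\<lambda>\<beta>. op_norm G G
              (\<lambda>f x. resolvent G (lap_out_scaled G Et \<beta>) z f x
                     - J_up G Et (resolvent (reduced_graph G Et) (lap_out (reduced_graph G Et)) z
                         (J_down G Et f)) x))
            \<longlongrightarrow> 0) at_top"
    (is "?bound \<and> (?N \<longlongrightarrow> 0) at_top")
proof -
  interpret reduced_resolvent G Et z
    using graph clusters z_resolvent unfolding Et
    by unfold_locales (auto simp: directed_clusters_def)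
  obtain c C where c: "c > 0" and C: "C \<ge> 0" and est: "\<And>\<kappa>. \<kappa> \<noteq> 0 \<Longrightarrow> cmod \<kappa> * c \<le> 1 \<Longrightarrow>
     z \<in> resolvent_set G (\<lambda>f x. L f x + T f x / \<kappa>) \<and>
     (\<forall>g\<in>ell2 G. (\<lambda>x. resolvent G (\<lambda>f x. L f x + T f x / \<kappa>) z g x - B g x) \<in> ell2 G \<and>
        ell2_norm G (\<lambda>x. resolvent G (\<lambda>f x. L f x + T f x / \<kappa>) z g x - B g x) \<le> C * cmod \<kappa> * ell2_norm G g)"
    using resolvent_estimate by blast
  \<comment> \<open>The threshold \<open>2 + c\<close> ensures both
    \<open>c \<le> \<beta> - 1\<close>, the smallness required of \<open>\<kappa>\<close>, and
    \<open>1 / (\<beta> - 1) \<le> 2 / \<beta>\<close>. The added 1 keeps the constant positive when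
    \<open>C = 0\<close>.\<close>
  have main: "z \<in> resolvent_set G (lap_out_scaled G Et \<beta>) \<and> ?N \<beta> \<le> ennreal ((2 * C + 1) / \<beta>)"
    if \<beta>: "\<beta> \<ge> 2 + c" for \<beta>
  proof -
    define \<kappa> where "\<kappa> = complex_of_real (1 / (\<beta> - 1))"
    have b: "\<beta> - 1 > 0" "\<beta> - 1 \<ge> c" "\<beta> \<ge> 2" using \<beta> c by simp_all
    have "cmod \<kappa> = \<bar>1 / (\<beta> - 1)\<bar>" unfolding \<kappa>_def by (rule norm_of_real)
    then have \<kappa>: "\<kappa> \<noteq> 0" "cmod \<kappa> = 1 / (\<beta> - 1)" using b by auto
    have sm: "cmod \<kappa> * c \<le> 1" using b \<kappa> by simp
    have "T f x / \<kappa> = of_real (\<beta> - 1) * T f x" for f x by (simp add: \<kappa>_def divide_inverse)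
    then have A: "(\<lambda>f x. L f x + T f x / \<kappa>) = lap_out_scaled G Et \<beta>"
      by (simp add: lap_out_scaled_eq fun_eq_iff)
    note e = est[OF \<kappa>(1) sm, unfolded A]
    have "C * cmod \<kappa> \<le> (2 * C + 1) / \<beta>"
    proof -
      have "1 / (\<beta> - 1) \<le> 2 / \<beta>" using b by (simp add: field_simps)
      then have "C * (1 / (\<beta> - 1)) \<le> C * (2 / \<beta>)" using C by (rule mult_left_mono)
      also have "\<dots> \<le> (2 * C + 1) / \<beta>" using b by (simp add: field_simps)
      finally show ?thesis using \<kappa> by simp
    qed
    moreover have "?N \<beta> \<le> ennreal (C * cmod \<kappa>)"
      using e C by (intro op_norm_le) (simp_all add: B_def)
    ultimately show ?thesis using e by (meson ennreal_leI order.trans)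
  qed
  have ?bound using main c C by (intro exI[of _ "2 * C + 1"] conjI exI[of _ "2 + c"]) auto
  moreover have "(?N \<longlongrightarrow> 0) at_top"
  proof (rule tendsto_sandwich[OF _ _ tendsto_const])
    show "\<forall>\<^sub>F \<beta> in at_top. 0 \<le> ?N \<beta>" by simp
    show "\<forall>\<^sub>F \<beta> in at_top. ?N \<beta> \<le> ennreal ((2 * C + 1) / \<beta>)"
      by (rule eventually_at_top_linorderI[of "2 + c"]) (rule main[THEN conjunct2])
    have "((\<lambda>\<beta>. (2 * C + 1) / \<beta>) \<longlongrightarrow> 0) at_top"
      by (rule tendsto_divide_0[OF tendsto_const filterlim_at_top_imp_at_infinity[OF filterlim_ident]])
    from tendsto_ennrealI[OF this]
    show "((\<lambda>\<beta>. ennreal ((2 * C + 1) / \<beta>)) \<longlongrightarrow> 0) at_top" by simp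
  qed
  ultimately show ?thesis ..
qed

end
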